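(* Let $\{X,A,A(\cdot),\tilde q\}$ be a CTJMDP satisfying $\bar q(x)<\infty$ for all $x\in X$. Let $T\in\mathbb{R}_+$, let $u_i\in(0,T]$, $i=1,2,\ldots$, and let the cost functions $c$ and $G_i$, $i=1,2,\ldots$, take nonnegative values. For an initial distribution $\gamma$ on $X$ and a policy $\pi$, let $\varphi$ be a Markov policy satisfying $$P_\gamma^{\pi}(t,Z,B)=\int_Z\varphi(B\mid z,t)\,P_\gamma^{\pi}(t,dz)\qquad\text{for all } t\in\mathbb{R}_+,\ Z\in\mathfrak{B}(X),\ B\in\mathfrak{B}(A).$$ Then for all $\alpha\in\mathbb{R}$ $$V_\alpha^T(\gamma,\varphi)\le V_\alpha^T(\gamma,\pi).$$ If, in addition, $P_\gamma^\varphi(T,X)=1$, then $V_\alpha^T(\gamma,\varphi)=V_\alpha^T(\gamma,\pi)$.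
   Context: Notation: $\mathbb{R}_+=(0,+\infty)$, $\mathbb{R}_+^0=[0,+\infty)$, $\bar{\mathbb{R}}_+=(0,+\infty]$, $\bar{\mathbb{R}}=[-\infty,+\infty]$; $\mathfrak{B}(S)$ is the $\sigma$-algebra of a standard Borel space $S$, $\mathcal{P}(S)$ the set of probability measures on it, $I$ denotes indicators, $\delta_s$ the Dirac measure at $s$. Model. A continuous-time jump Markov decision process (CTJMDP) $\{X,A,A(\cdot),\tilde q\}$ consists of standard Borel spaces $X$ (states) and $A$ (actions); nonempty sets $A(x)\subseteq A$, $x\in X$, such that $Gr(A)=\{(x,a):x\in X,\ a\in A(x)\}$ is a measurable subset of $X\times A$ containing the graph of a measurable mapping $X\to A$; and, for $(x,a)\in Gr(A)$, a signed measure $\tilde q(x,a,\cdot)$ on $X$ with $\tilde q(x,a,X)=0$, $0\le\tilde q(x,a,Z\setminus\{x\})<\infty$, and $\tilde q(x,a,Z)$ measurable on $Gr(A)$ for each $Z\in\mathfrak{B}(X)$. Put $\tilde q(x,a)=\tilde q(x,a,X\setminus\{x\})$ and $\bar q(x)=\sup_{a\in A(x)}\tilde q(x,a)$. For a probability measure $p$ on actions and a function $f$ of state-action pairs, $f(z,p)=\int_{A(z)}f(z,a)\,p(da)$ whenever defined; in particular this defines $\tilde q(z,p,Z)$ and $\tilde q(z,p)$. Sample space. Add isolated points $x_\infty\notin X$, $a_\infty\notin A$; $\bar X=X\cup\{x_\infty\}$, $\bar A=A\cup\{a_\infty\}$, $A(x_\infty)=\{a_\infty\}$. $\Omega$ is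 the set of sequences $(x_0,t_1,x_1,t_2,x_2,\ldots)\in X\times(\bar{\mathbb{R}}_+\times\bar X)^\infty$ such that, for $n\ge1$: if $t_n<\infty$ then $x_n\in X$ and $t_{n+1}>t_n$; if $t_n=+\infty$ then $x_n=x_\infty$ and $t_{n+1}=+\infty$. $\mathcal{F}$ is the Borel $\sigma$-algebra of $\Omega$. Put $t_0=0$, $t_\infty=\lim_n t_n$, $\xi_t=x_n$ for $t_n\le t<t_{n+1}$, $\xi_t=x_\infty$ for $t\ge t_\infty$, and $\mathcal{F}_t=\sigma(\xi_s:0\le s\le t)$. Policies. A policy $\pi$ assigns to $(\omega,t)\in\Omega\times\mathbb{R}_+$ a probability measure $\pi_t(\omega)=\pi(\cdot\mid\omega,t)$ such that $\pi(B\mid\omega,t)$ is a predictable process for each $B\in\mathfrak{B}(A)$, $\pi(A(\xi_{t-}(\omega))\mid\omega,t)=1$ if $t<t_\infty(\omega)$, and $\pi(\cdot\mid\omega,t)=\delta_{a_\infty}$ if $t\ge t_\infty(\omega)$. Equivalently, for $t_n<t\le t_{n+1}$, $t<t_\infty$, $\pi(\cdot\mid\omega,t)=\pi^n(\cdot\mid x_0,t_1,x_1,\ldots,t_n,x_n,t-t_n)$ for transition probabilities $\pi^n$, $n\ge0$. A policy is Markov if there is a transition probability $\tilde\pi$ from $X\times\mathbb{R}_+$ to $A$ with $\pi(\cdot\mid\omega,t)=\tilde\pi(\cdot\mid\xi_{t-}(\omega),t)$ for $t<t_\infty(\omega)$; one writes $\pi(\cdot\mid z,t)$ for $\tilde\pi(\cdot\mid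 z,t)$. Probability measures. For a policy $\pi$ and $\gamma\in\mathcal{P}(X)$, $\mathbb{P}_\gamma^\pi$ is the unique probability measure on $(\Omega,\mathcal{F})$ such that $x_0$ has distribution $\gamma$ and the predictable random measure $\nu^\pi([0,t],Z)=\int_0^t\tilde q(\xi_s,\pi_s,Z\setminus\{\xi_s\})I\{\xi_s\in X\}\,ds$ is the compensator, with respect to $(\mathcal{F}_t)$, of the jump measure $\mu([0,t],Z)=\sum_{n\ge1}I\{t_n\le t,\ x_n\in Z\}$; $\mathbb{E}_\gamma^\pi$ is its expectation. The marginals are, for $t\in\mathbb{R}_+$, $Z\in\mathfrak{B}(\bar X)$, $B\in\mathfrak{B}(\bar A)$: $P_\gamma^\pi(t,Z)=\mathbb{P}_\gamma^\pi(\xi_t\in Z)$ and $P_\gamma^\pi(t,Z,B)=\mathbb{E}_\gamma^\pi[I\{\xi_t\in Z\}\,\pi(B\mid\omega,t)]$. Costs. The functions $c,G_i:\bar X\times\bar A\to\bar{\mathbb{R}}$, $i=1,2,\ldots$, are measurable with $c(x_\infty,\cdot)=c(\cdot,a_\infty)=G_i(x_\infty,\cdot)=G_i(\cdot,a_\infty)=0$. For nonnegative $c,G_i$, the finite-horizon expected total discounted cost with discount rate $\alpha\in\mathbb{R}$ is $$V_\alpha^T(\gamma,\pi)=\mathbb{E}_\gamma^\pi\Big[\int_0^{T\wedge t_\infty}e^{-\alpha s}c(\xi_s,\pi_s)\,ds+\sum_{i=1}^\infty e^{-\alpha u_i}G_i(\xi_{u_i},\pi_{u_i})\Big].$$ 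*)

theory Defs
  imports "HOL-Probability.Probability"
begin

text \<open>
  Measurable spaces are values of type \<^typ>\<open>'a measure\<close> of which only the underlying set and
  the sigma-algebra are used.  The points $x_\infty$ and $a_\infty$ are \<^const>\<open>None\<close>.
\<close>

definition standard_borel :: "'a measure \<Rightarrow> bool" where
  "standard_borel M \<longleftrightarrow>
     (\<exists>T. completely_metrizable_space T \<and> second_countable T \<and>
          topspace T = space M \<and> sets M = sigma_sets (space M) {U. openin T U})"

definition adjoin_point :: "'a measure \<Rightarrow> 'a option measure" where
  "adjoin_point M =
     sigma (insert None (Some ` space M)) (insert {None} ((`) Some ` sets M))"

abbreviation pos_reals :: "real measure" where
  "pos_reals \<equiv> restrict_space borel {0<..}"

abbreviation pos_ereals :: "ereal measure" where
  "pos_ereals \<equiv> restrict_space borel {0<..}"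

definition signed_measure :: "'a measure \<Rightarrow> ('a set \<Rightarrow> real) \<Rightarrow> bool" where
  "signed_measure M m \<longleftrightarrow>
     (\<forall>Z :: nat \<Rightarrow> 'a set. range Z \<subseteq> sets M \<longrightarrow> disjoint_family Z \<longrightarrow>
        (\<lambda>n. m (Z n)) sums m (\<Union>n. Z n))"

definition action_graph :: "'x measure \<Rightarrow> ('x \<Rightarrow> 'a set) \<Rightarrow> ('x \<times> 'a) set" where
  "action_graph X Act = {(x, a). x \<in> space X \<and> a \<in> Act x}"

text \<open>
  Real values for \<open>q x a Z\<close> are no restriction: \<open>q x a (X - {x})\<close> is finite and
  \<open>q x a X = 0\<close>, so the signed measure \<open>q x a\<close> is finite.
\<close>

locale CTJMDP =
  fixes X :: "'x measure" and A :: "'a measure"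
    and Act :: "'x \<Rightarrow> 'a set" and q :: "'x \<Rightarrow> 'a \<Rightarrow> 'x set \<Rightarrow> real"
  assumes standard_borel_X: "standard_borel X"
    and standard_borel_A: "standard_borel A"
    and Act_subset: "x \<in> space X \<Longrightarrow> Act x \<subseteq> space A"
    and Act_nonempty: "x \<in> space X \<Longrightarrow> Act x \<noteq> {}"
    and graph_measurable: "action_graph X Act \<in> sets (X \<Otimes>\<^sub>M A)"
    and selector: "\<exists>f \<in> measurable X A. \<forall>x \<in> space X. f x \<in> Act x"
    and q_signed: "x \<in> space X \<Longrightarrow> a \<in> Act x \<Longrightarrow> signed_measure X (q x a)"
    and q_space: "x \<in> space X \<Longrightarrow> a \<in> Act x \<Longrightarrow> q x a (space X) = 0"
    and q_nonneg: "x \<in> space X \<Longrightarrow> a \<in> Act x \<Longrightarrow> Z \<in> sets X \<Longrightarrow> 0 \<le> q x a (Z - {x})"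
    and q_measurable: "Z \<in> sets X \<Longrightarrow>
          (\<lambda>(x, a). q x a Z) \<in> borel_measurable (restrict_space (X \<Otimes>\<^sub>M A) (action_graph X Act))"

definition jump_rate :: "'x measure \<Rightarrow> ('x \<Rightarrow> 'a \<Rightarrow> 'x set \<Rightarrow> real) \<Rightarrow> 'x \<Rightarrow> 'a \<Rightarrow> real" where
  "jump_rate X q x a = q x a (space X - {x})"

definition max_jump_rate ::
    "'x measure \<Rightarrow> ('x \<Rightarrow> 'a set) \<Rightarrow> ('x \<Rightarrow> 'a \<Rightarrow> 'x set \<Rightarrow> real) \<Rightarrow> 'x \<Rightarrow> ereal" where
  "max_jump_rate X Act q x = (SUP a\<in>Act x. ereal (jump_rate X q x a))"

fun actions :: "('x \<Rightarrow> 'a set) \<Rightarrow> 'x option \<Rightarrow> 'a option set" where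
  "actions Act (Some x) = Some ` Act x"
| "actions Act None = {None}"

definition action_mean ::
    "('x \<Rightarrow> 'a set) \<Rightarrow> ('x option \<times> 'a option \<Rightarrow> ennreal) \<Rightarrow>
     'x option \<Rightarrow> 'a option measure \<Rightarrow> ennreal" where
  "action_mean Act f z p = (\<integral>\<^sup>+a\<in>actions Act z. f (z, a) \<partial>p)"

text \<open>
  A trajectory is a pair of $x_0$ and a sequence whose $n$-th entry, counted from 0, is
  $(t_{n+1}, x_{n+1})$.
\<close>

type_synonym 'x trajectory = "'x \<times> (nat \<Rightarrow> ereal \<times> 'x option)"

fun jump_time :: "'x trajectory \<Rightarrow> nat \<Rightarrow> ereal" where
  "jump_time \<omega> 0 = 0"
| "jump_time \<omega> (Suc n) = fst (snd \<omega> n)"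

fun jump_state :: "'x trajectory \<Rightarrow> nat \<Rightarrow> 'x option" where
  "jump_state \<omega> 0 = Some (fst \<omega>)"
| "jump_state \<omega> (Suc n) = snd (snd \<omega> n)"

definition trajectories :: "'x measure \<Rightarrow> 'x trajectory measure" where
  "trajectories X =
     restrict_space (X \<Otimes>\<^sub>M (\<Pi>\<^sub>M n\<in>UNIV. pos_ereals \<Otimes>\<^sub>M adjoin_point X))
       {\<omega>. \<forall>n\<ge>1.
          (jump_time \<omega> n < \<infinity> \<longrightarrow>
             jump_state \<omega> n \<in> Some ` space X \<and> jump_time \<omega> n < jump_time \<omega> (Suc n)) \<and>
          (jump_time \<omega> n = \<infinity> \<longrightarrow>
             jump_state \<omega> n = None \<and> jump_time \<omega> (Suc n) = \<infinity>)}"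

definition explosion_time :: "'x trajectory \<Rightarrow> ereal" where
  "explosion_time \<omega> = lim (jump_time \<omega>)"

text \<open>On trajectories the index \<open>n\<close> below is unique, and it exists iff \<open>t\<close> precedes the explosion.\<close>

definition state :: "'x trajectory \<Rightarrow> real \<Rightarrow> 'x option" where
  "state \<omega> t =
     (if \<exists>n. jump_time \<omega> n \<le> ereal t \<and> ereal t < jump_time \<omega> (Suc n)
      then jump_state \<omega> (THE n. jump_time \<omega> n \<le> ereal t \<and> ereal t < jump_time \<omega> (Suc n))
      else None)"

definition state_before :: "'x trajectory \<Rightarrow> real \<Rightarrow> 'x option" where
  "state_before \<omega> t =
     (if \<exists>n. jump_time \<omega> n < ereal t \<and> ereal t \<le> jump_time \<omega> (Suc n)
      then jump_state \<omega> (THE n. jump_time \<omega> n < ereal t \<and> ereal t \<le> jump_time \<omega> (Suc n))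
      else None)"

definition state_filtration :: "'x measure \<Rightarrow> real \<Rightarrow> 'x trajectory measure" where
  "state_filtration X t =
     sigma (space (trajectories X))
       {(\<lambda>\<omega>. state \<omega> s) -` Z \<inter> space (trajectories X) |s Z.
          0 \<le> s \<and> s \<le> t \<and> Z \<in> sets (adjoin_point X)}"

definition predictable_sets :: "'x measure \<Rightarrow> ('x trajectory \<times> real) measure" where
  "predictable_sets X =
     sigma (space (trajectories X) \<times> {0<..})
       {F \<times> {s<..t} |F s t. 0 \<le> s \<and> s < t \<and> F \<in> sets (state_filtration X s)}"

definition history :: "nat \<Rightarrow> 'x trajectory \<Rightarrow> 'x \<times> (nat \<Rightarrow> real \<times> 'x)" where
  "history n \<omega> =
     (fst \<omega>, \<lambda>i\<in>{..<n}. (real_of_ereal (jump_time \<omega> (Suc i)), the (jump_state \<omega> (Suc i))))"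

definition histories :: "'x measure \<Rightarrow> nat \<Rightarrow> ('x \<times> (nat \<Rightarrow> real \<times> 'x)) measure" where
  "histories X n = X \<Otimes>\<^sub>M (\<Pi>\<^sub>M i\<in>{..<n}. pos_reals \<Otimes>\<^sub>M X)"

text \<open>
  Predictability of a policy is expressed by its transition probabilities \<open>\<kappa> n\<close> between
  consecutive jumps.  Measurability with respect to \<^const>\<open>predictable_sets\<close> cannot be demanded
  literally on all trajectories.  A trajectory may stay in the same state at a jump time, and such
  a jump is invisible to \<^const>\<open>state_filtration\<close>; if infinitely many of them accumulate at \<open>t\<close>,
  the explosion at \<open>t\<close> cannot be told from the past of \<open>t\<close>, although every policy is
  concentrated on \<open>A\<close> before the explosion and on the added point from then on.  Trajectories
  with such jumps have probability zero under \<open>process_law\<close> below, and on the others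
  \<^const>\<open>state_filtration\<close> is the filtration of the jump times and states.
\<close>

definition policy ::
    "'x measure \<Rightarrow> 'a measure \<Rightarrow> ('x \<Rightarrow> 'a set) \<Rightarrow>
     ('x trajectory \<Rightarrow> real \<Rightarrow> 'a option measure) \<Rightarrow> bool" where
  "policy X A Act \<pi> \<longleftrightarrow>
     (\<exists>\<kappa> :: nat \<Rightarrow> ('x \<times> (nat \<Rightarrow> real \<times> 'x)) \<times> real \<Rightarrow> 'a measure.
        (\<forall>n. \<kappa> n \<in> measurable (histories X n \<Otimes>\<^sub>M pos_reals) (prob_algebra A)) \<and>
        (\<forall>\<omega> \<in> space (trajectories X). \<forall>t>0. \<forall>n.
           jump_time \<omega> n < ereal t \<longrightarrow> ereal t \<le> jump_time \<omega> (Suc n) \<longrightarrow>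
           ereal t < explosion_time \<omega> \<longrightarrow>
           \<pi> \<omega> t = distr (\<kappa> n (history n \<omega>, t - real_of_ereal (jump_time \<omega> n)))
                       (adjoin_point A) Some)) \<and>
     (\<forall>\<omega> \<in> space (trajectories X). \<forall>t>0.
        (ereal t < explosion_time \<omega> \<longrightarrow>
           emeasure (\<pi> \<omega> t) (actions Act (state_before \<omega> t)) = 1) \<and>
        (explosion_time \<omega> \<le> ereal t \<longrightarrow> \<pi> \<omega> t = return (adjoin_point A) None))"

definition markov_policy ::
    "'x measure \<Rightarrow> 'a measure \<Rightarrow> ('x \<Rightarrow> 'a set) \<Rightarrow>
     ('x trajectory \<Rightarrow> real \<Rightarrow> 'a option measure) \<Rightarrow> ('x \<times> real \<Rightarrow> 'a measure) \<Rightarrow> bool" where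
  "markov_policy X A Act \<pi> \<pi>' \<longleftrightarrow>
     policy X A Act \<pi> \<and>
     \<pi>' \<in> measurable (X \<Otimes>\<^sub>M pos_reals) (prob_algebra A) \<and>
     (\<forall>\<omega> \<in> space (trajectories X). \<forall>t>0. ereal t < explosion_time \<omega> \<longrightarrow>
        \<pi> \<omega> t = distr (\<pi>' (the (state_before \<omega> t), t)) (adjoin_point A) Some)"

definition jump_measure :: "'x measure \<Rightarrow> 'x trajectory \<Rightarrow> (real \<times> 'x) measure" where
  "jump_measure X \<omega> =
     distr (count_space {n. 1 \<le> n \<and> jump_time \<omega> n < \<infinity>}) (pos_reals \<Otimes>\<^sub>M X)
       (\<lambda>n. (real_of_ereal (jump_time \<omega> n), the (jump_state \<omega> n)))"

text \<open>
  $\nu^\pi(D) = \int_0^\infty \tilde q(\xi_s, \pi_s, D_s \setminus \{\xi_s\}) I\{\xi_s \in X\}\,ds$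
  with sections $D_s = \{x \mid (s, x) \in D\}$; for $D = (0,t] \times Z$ this is
  $\nu^\pi([0,t], Z)$.
\<close>

definition intensity_measure ::
    "'x measure \<Rightarrow> ('x \<Rightarrow> 'a set) \<Rightarrow> ('x \<Rightarrow> 'a \<Rightarrow> 'x set \<Rightarrow> real) \<Rightarrow>
     ('x trajectory \<Rightarrow> real \<Rightarrow> 'a option measure) \<Rightarrow> 'x trajectory \<Rightarrow> (real \<times> 'x) measure" where
  "intensity_measure X Act q \<pi> \<omega> =
     measure_of (space (pos_reals \<Otimes>\<^sub>M X)) (sets (pos_reals \<Otimes>\<^sub>M X))
       (\<lambda>D. \<integral>\<^sup>+s\<in>{0<..}.
          (case state \<omega> s of
             None \<Rightarrow> 0
           | Some z \<Rightarrow>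
               action_mean Act (\<lambda>(_, a). ennreal (q z (the a) (Pair s -` D - {z})))
                 (Some z) (\<pi> \<omega> s))
          \<partial>lborel)"

definition compensates ::
    "'x measure \<Rightarrow> 'x trajectory measure \<Rightarrow> ('x trajectory \<Rightarrow> (real \<times> 'x) measure) \<Rightarrow>
     ('x trajectory \<Rightarrow> (real \<times> 'x) measure) \<Rightarrow> bool" where
  "compensates X P \<nu> \<mu> \<longleftrightarrow>
     (\<forall>W :: ('x trajectory \<times> real) \<times> 'x \<Rightarrow> ennreal.
        W \<in> borel_measurable (predictable_sets X \<Otimes>\<^sub>M X) \<longrightarrow>
        (\<integral>\<^sup>+\<omega>. \<integral>\<^sup>+(s, x). W ((\<omega>, s), x) \<partial>\<mu> \<omega> \<partial>P) =
        (\<integral>\<^sup>+\<omega>. \<integral>\<^sup>+(s, x). W ((\<omega>, s), x) \<partial>\<nu> \<omega> \<partial>P))"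

definition process_law ::
    "'x measure \<Rightarrow> ('x \<Rightarrow> 'a set) \<Rightarrow> ('x \<Rightarrow> 'a \<Rightarrow> 'x set \<Rightarrow> real) \<Rightarrow> 'x measure \<Rightarrow>
     ('x trajectory \<Rightarrow> real \<Rightarrow> 'a option measure) \<Rightarrow> 'x trajectory measure \<Rightarrow> bool" where
  "process_law X Act q \<gamma> \<pi> P \<longleftrightarrow>
     P \<in> space (prob_algebra (trajectories X)) \<and>
     distr P X fst = \<gamma> \<and>
     compensates X P (intensity_measure X Act q \<pi>) (jump_measure X)"

definition state_marginal ::
    "'x measure \<Rightarrow> 'x trajectory measure \<Rightarrow> real \<Rightarrow> 'x option measure" where
  "state_marginal X P t = distr P (adjoin_point X) (\<lambda>\<omega>. state \<omega> t)"

definition state_action_marginal ::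
    "'x trajectory measure \<Rightarrow> ('x trajectory \<Rightarrow> real \<Rightarrow> 'a option measure) \<Rightarrow>
     real \<Rightarrow> 'x option set \<Rightarrow> 'a option set \<Rightarrow> ennreal" where
  "state_action_marginal P \<pi> t Z B =
     (\<integral>\<^sup>+\<omega>. indicator Z (state \<omega> t) * emeasure (\<pi> \<omega> t) B \<partial>P)"

definition cost_function ::
    "'x measure \<Rightarrow> 'a measure \<Rightarrow> ('x option \<times> 'a option \<Rightarrow> ennreal) \<Rightarrow> bool" where
  "cost_function X A c \<longleftrightarrow>
     c \<in> borel_measurable (adjoin_point X \<Otimes>\<^sub>M adjoin_point A) \<and>
     (\<forall>a. c (None, a) = 0) \<and> (\<forall>z. c (z, None) = 0)"

definition total_cost ::
    "('x \<Rightarrow> 'a set) \<Rightarrow> ('x option \<times> 'a option \<Rightarrow> ennreal) \<Rightarrow>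
     (nat \<Rightarrow> 'x option \<times> 'a option \<Rightarrow> ennreal) \<Rightarrow> (nat \<Rightarrow> real) \<Rightarrow> real \<Rightarrow> real \<Rightarrow>
     'x trajectory measure \<Rightarrow> ('x trajectory \<Rightarrow> real \<Rightarrow> 'a option measure) \<Rightarrow> ennreal" where
  "total_cost Act c G u T \<alpha> P \<pi> =
     (\<integral>\<^sup>+\<omega>.
        (\<integral>\<^sup>+s\<in>{s. 0 < s \<and> ereal s \<le> min (ereal T) (explosion_time \<omega>)}.
           ennreal (exp (- \<alpha> * s)) * action_mean Act c (state \<omega> s) (\<pi> \<omega> s) \<partial>lborel) +
        (\<Sum>i. ennreal (exp (- \<alpha> * u i)) *
           action_mean Act (G i) (state \<omega> (u i)) (\<pi> \<omega> (u i)))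
      \<partial>P)"

end

theory Submission
  imports Defs
begin

text \<open>
  Write \<open>m\<^sub>t\<close> and \<open>m'\<^sub>t\<close> for the laws of the state at time \<open>t\<close>, before the explosion, under \<open>\<pi>\<close>
  and under \<open>\<phi>\<close>.  By the hypothesis on the marginals, and because a fixed time is almost surely not
  a jump time, the two costs are integrals of the same nonnegative functions of time and state,
  one against \<open>m\<close> and the other against \<open>m'\<close> (\<open>total_cost_eq\<close>).  Hence it suffices that
  \<open>m'\<^sub>t(Z) \<le> m\<^sub>t(Z)\<close> for all \<open>t > 0\<close> and \<open>Z\<close> (\<open>visit_law_le\<close>).  If \<open>m'\<^sub>T\<close> has mass 1, then so has \<open>m'\<^sub>s\<close>
  for \<open>s \<le> T\<close>, and since \<open>m\<^sub>s\<close> has mass at most 1, the two laws and the two costs agree.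

  The inequality says that \<open>m'\<close> is the minimal solution of Kolmogorov's forward equation, and that \<open>m\<close>
  is a solution.  For \<open>\<pi>\<close>, the compensator and the hypothesis show that the jumps have, in
  expectation, the intensities of the Markov kernel averaged over \<open>m\<close> (\<open>jump_balance_UNIV\<close>).  To a visit
  of a state of \<open>Z\<close> at time \<open>s \<le> t\<close> attach the weight \<open>h(s)\<close>, the exponential of minus the exit rate
  integrated over \<open>[s, t]\<close>.  Along a visit the weight grows at the exit rate (\<open>stay_balance\<close>).  After summation over
  all visits and taking expectations, the weights at the ends of the visits cancel against the
  integrals of the growth, and what remains is that \<open>m\<^sub>t(Z)\<close> is the expected sum of the weights at
  the beginnings of the visits (\<open>renewal\<close>).  All terms are nonnegative, so nothing has to be said
  about the behaviour at the explosion; only the cancelled term must be finite, and therefore \<open>Z\<close>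
  is first taken among states with bounded exit rate.  A second use of the balance, now for the
  beginnings of the visits, gives the integrated forward equation (\<open>forward_equation\<close>).

  For \<open>\<phi>\<close> the balance holds also for the first \<open>N\<close> jumps only (\<open>jump_balance_markov\<close>).  So the law of the
  state at \<open>t\<close> on the event of at most \<open>N\<close> jumps arises from the laws for at most \<open>N - 1\<close> jumps by the
  monotone operator of which \<open>m\<close> is a fixed point.  By induction on \<open>N\<close> these laws are at most \<open>m\<close>
  (\<open>visit_law_le_finite\<close>), and their supremum is \<open>m'\<close>.

  The number of jumps has to be expressed predictably.  The filtration of the states does not see
  jumps that do not change the state, but these have probability zero (\<open>AE_jump_visible\<close>), and the
  number of visible changes before \<open>s\<close> is predictable (\<open>changes_predictable\<close>).
\<close>

section \<open>Standard Borel spaces and adjoined points\<close>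

lemma standard_borel_separating_sequence:
  assumes "standard_borel M"
  obtains U :: "nat \<Rightarrow> 'a set"
  where "\<And>n. U n \<in> sets M"
    and "\<And>x y. x \<in> space M \<Longrightarrow> y \<in> space M \<Longrightarrow> x \<noteq> y \<Longrightarrow> \<exists>n. x \<in> U n \<and> y \<notin> U n"
proof -
  obtain T where T: "completely_metrizable_space T" "second_countable T"
    "topspace T = space M" "sets M = sigma_sets (space M) {U. openin T U}"
    using assms unfolding standard_borel_def by blast
  have haus: "Hausdorff_space T"
    using T(1) completely_metrizable_imp_metrizable_space metrizable_imp_Hausdorff_space by blast
  obtain \<B> where B: "countable \<B>" "\<And>V. V \<in> \<B> \<Longrightarrow> openin T V"
    "\<And>U x. openin T U \<Longrightarrow> x \<in> U \<Longrightarrow> \<exists>V \<in> \<B>. x \<in> V \<and> V \<subseteq> U"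
    using T(2) unfolding second_countable_def by metis
  define U where "U = from_nat_into (insert {} \<B>)"
  have rng: "range U = insert {} \<B>"
    unfolding U_def using B(1) by (intro range_from_nat_into) auto
  have "U n \<in> sets M" for n
  proof -
    have "U n \<in> insert {} \<B>" using rng by blast
    then have "openin T (U n)" using B(2) by auto
    then show ?thesis unfolding T(4) by blast
  qed
  moreover have "\<exists>n. x \<in> U n \<and> y \<notin> U n" if "x \<in> space M" "y \<in> space M" "x \<noteq> y" for x y
  proof -
    have "x \<in> topspace T" "y \<in> topspace T" "x \<noteq> y" using that T(3) by auto
    then obtain V W where "openin T V" "openin T W" "x \<in> V" "y \<in> W" "disjnt V W"
      using haus[unfolded Hausdorff_space_def, rule_format, of x y] by blast
    then obtain V' where "V' \<in> \<B>" "x \<in> V'" "V' \<subseteq> V" using B(3) by blast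
    moreover have "y \<notin> V'" using \<open>y \<in> W\<close> \<open>disjnt V W\<close> \<open>V' \<subseteq> V\<close> by (auto simp: disjnt_def)
    ultimately show ?thesis using rng by (metis insertCI rangeE)
  qed
  ultimately show ?thesis using that by blast
qed

text \<open>
  Points are separated by countably many measurable sets, so the diagonal is measurable.  This makes
  it possible to compare states and to remove the current state from the target of a jump.
\<close>

lemma standard_borel_diagonal:
  assumes "standard_borel M"
  shows "{p \<in> space (M \<Otimes>\<^sub>M M). fst p = snd p} \<in> sets (M \<Otimes>\<^sub>M M)"
proof -
  obtain U :: "nat \<Rightarrow> 'a set" where U: "\<And>n. U n \<in> sets M"
    and sep: "\<And>x y. x \<in> space M \<Longrightarrow> y \<in> space M \<Longrightarrow> x \<noteq> y \<Longrightarrow> \<exists>n. x \<in> U n \<and> y \<notin> U n"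
    using standard_borel_separating_sequence[OF assms] by metis
  have "{p \<in> space (M \<Otimes>\<^sub>M M). fst p = snd p} =
      space (M \<Otimes>\<^sub>M M) - (\<Union>n. U n \<times> (space M - U n))"
  proof (intro equalityI subsetI)
    fix p assume "p \<in> space (M \<Otimes>\<^sub>M M) - (\<Union>n. U n \<times> (space M - U n))"
    then show "p \<in> {p \<in> space (M \<Otimes>\<^sub>M M). fst p = snd p}"
      using sep[of "fst p" "snd p"] by (cases p) (auto simp: space_pair_measure)
  qed auto
  also have "\<dots> \<in> sets (M \<Otimes>\<^sub>M M)"
    using U by (intro sets.Diff sets.countable_UN) auto
  finally show ?thesis .
qed

lemma standard_borel_singleton:
  assumes "standard_borel M" "x \<in> space M"
  shows "{x} \<in> sets M"
proof -
  have "Pair x -` {p \<in> space (M \<Otimes>\<^sub>M M). fst p = snd p} \<in> sets M"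
    using standard_borel_diagonal[OF assms(1)] by (rule sets_Pair1)
  also have "Pair x -` {p \<in> space (M \<Otimes>\<^sub>M M). fst p = snd p} = {x}"
    using assms(2) by (auto simp: space_pair_measure)
  finally show ?thesis .
qed

lemma adjoin_point_generators:
  "insert {None} ((`) Some ` sets M) \<subseteq> Pow (insert None (Some ` space M))"
  using sets.sets_into_space by fastforce

lemma space_adjoin_point [simp]: "space (adjoin_point M) = insert None (Some ` space M)"
  unfolding adjoin_point_def using adjoin_point_generators by (rule space_measure_of)

lemma sets_adjoin_point:
  "sets (adjoin_point M) =
    sigma_sets (insert None (Some ` space M)) (insert {None} ((`) Some ` sets M))"
  unfolding adjoin_point_def using adjoin_point_generators by (rule sets_measure_of)

lemma None_in_sets_adjoin_point [measurable]: "{None} \<in> sets (adjoin_point M)"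
  unfolding sets_adjoin_point by blast

lemma Some_image_in_sets_adjoin_point [intro]: "Z \<in> sets M \<Longrightarrow> Some ` Z \<in> sets (adjoin_point M)"
  unfolding sets_adjoin_point by blast

lemma measurable_Some_adjoin_point [measurable]: "Some \<in> measurable M (adjoin_point M)"
  unfolding adjoin_point_def
proof (rule measurable_measure_of[OF adjoin_point_generators])
  show "Some \<in> space M \<rightarrow> insert None (Some ` space M)" by auto
  fix Y :: "'a option set" assume "Y \<in> insert {None} ((`) Some ` sets M)"
  then consider "Y = {None}" | Z where "Z \<in> sets M" "Y = Some ` Z" by blast
  then show "Some -` Y \<inter> space M \<in> sets M"
  proof cases
    case 1
    then have "Some -` Y \<inter> space M = {}" by auto
    then show ?thesis by simp
  next
    case 2
    then have "Some -` Y \<inter> space M = Z"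
      using sets.sets_into_space by auto
    then show ?thesis using 2 by simp
  qed
qed

lemma measurable_from_adjoin_point:
  assumes f: "(\<lambda>x. f (Some x)) \<in> measurable M N" and c: "f None \<in> space N"
  shows "f \<in> measurable (adjoin_point M) N"
proof (rule measurableI)
  show "f x \<in> space N" if "x \<in> space (adjoin_point M)" for x
    using that c measurable_space[OF f] by auto
  fix Y assume Y: "Y \<in> sets N"
  have "f -` Y \<inter> space (adjoin_point M) =
      (if f None \<in> Y then {None} else {}) \<union> Some ` ((\<lambda>x. f (Some x)) -` Y \<inter> space M)"
    by auto
  also have "\<dots> \<in> sets (adjoin_point M)"
    using measurable_sets[OF f Y] by (intro sets.Un) auto
  finally show "f -` Y \<inter> space (adjoin_point M) \<in> sets (adjoin_point M)" .
qed

text \<open>A retraction onto the original space, which sends the added point to an arbitrary point.\<close>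

definition point_of :: "'a measure \<Rightarrow> 'a option \<Rightarrow> 'a" where
  "point_of M z = (case z of None \<Rightarrow> (SOME x. x \<in> space M) | Some x \<Rightarrow> x)"

lemma point_of_Some [simp]: "point_of M (Some x) = x"
  by (simp add: point_of_def)

lemma measurable_point_of:
  assumes "space M \<noteq> {}"
  shows "point_of M \<in> measurable (adjoin_point M) M"
  using assms by (intro measurable_from_adjoin_point) (auto simp: point_of_def some_in_eq)

text \<open>
  A function on the original space is extended by 0 to the added point; \<open>M\<close> carries parameters.
\<close>

lemma borel_measurable_case_option_adjoin:
  fixes f :: "'b \<Rightarrow> 'a \<Rightarrow> ennreal"
  assumes ne: "space N \<noteq> {}"
    and f: "(\<lambda>(m, x). f m x) \<in> borel_measurable (M \<Otimes>\<^sub>M N)"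
    and g: "g \<in> measurable M (adjoin_point N)"
  shows "(\<lambda>m. case g m of None \<Rightarrow> 0 | Some x \<Rightarrow> f m x) \<in> borel_measurable M"
proof -
  note [measurable] = measurable_point_of[OF ne] f g
  have "(\<lambda>m. if g m \<in> {None} then 0 else f m (point_of N (g m))) \<in> borel_measurable M"
    by measurable
  then show ?thesis
    by (rule measurable_cong[THEN iffD1, rotated]) (auto split: option.split)
qed

lemma adjoin_point_diagonal:
  assumes "standard_borel M"
  shows "{p \<in> space (adjoin_point M \<Otimes>\<^sub>M adjoin_point M). fst p = snd p}
    \<in> sets (adjoin_point M \<Otimes>\<^sub>M adjoin_point M)"
proof -
  obtain U :: "nat \<Rightarrow> 'a set" where U: "\<And>n. U n \<in> sets M"
    and sep: "\<And>x y. x \<in> space M \<Longrightarrow> y \<in> space M \<Longrightarrow> x \<noteq> y \<Longrightarrow> \<exists>n. x \<in> U n \<and> y \<notin> U n"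
    using standard_borel_separating_sequence[OF assms] by metis
  define V where "V n = (case n of 0 \<Rightarrow> {None} | Suc 0 \<Rightarrow> Some ` space M | Suc (Suc n) \<Rightarrow> Some ` U n)" for n
  have V: "V n \<in> sets (adjoin_point M)" for n
    using U by (auto simp: V_def split: nat.split)
  have sepV: "\<exists>n. x \<in> V n \<and> y \<notin> V n"
    if "x \<in> space (adjoin_point M)" "y \<in> space (adjoin_point M)" "x \<noteq> y" for x y
  proof (cases x)
    case None then show ?thesis using that by (intro exI[of _ 0]) (auto simp: V_def)
  next
    case (Some a)
    show ?thesis
    proof (cases y)
      case None then show ?thesis using that Some by (intro exI[of _ "Suc 0"]) (auto simp: V_def)
    next
      case (Some b)
      have "a \<in> space M" "b \<in> space M" "a \<noteq> b" using that Some \<open>x = Some a\<close> by auto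
      then obtain n where "a \<in> U n" "b \<notin> U n" using sep by blast
      then show ?thesis using Some \<open>x = Some a\<close>
        by (intro exI[of _ "Suc (Suc n)"]) (auto simp: V_def)
    qed
  qed
  have "{p \<in> space (adjoin_point M \<Otimes>\<^sub>M adjoin_point M). fst p = snd p} =
      space (adjoin_point M \<Otimes>\<^sub>M adjoin_point M) - (\<Union>n. V n \<times> (space (adjoin_point M) - V n))"
  proof (intro equalityI subsetI)
    fix p assume "p \<in> space (adjoin_point M \<Otimes>\<^sub>M adjoin_point M) - (\<Union>n. V n \<times> (space (adjoin_point M) - V n))"
    then show "p \<in> {p \<in> space (adjoin_point M \<Otimes>\<^sub>M adjoin_point M). fst p = snd p}"
      using sepV[of "fst p" "snd p"] by (cases p) (auto simp del: space_adjoin_point simp: space_pair_measure)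
  qed auto
  also have "\<dots> \<in> sets (adjoin_point M \<Otimes>\<^sub>M adjoin_point M)"
    using V by (intro sets.Diff sets.countable_UN) (auto simp del: space_adjoin_point)
  finally show ?thesis .
qed

lemma measurable_eq_adjoin_point:
  assumes "standard_borel N"
    and f: "f \<in> measurable M (adjoin_point N)" and g: "g \<in> measurable M (adjoin_point N)"
  shows "{m \<in> space M. f m = g m} \<in> sets M"
proof -
  have "(\<lambda>m. (f m, g m)) -` {p \<in> space (adjoin_point N \<Otimes>\<^sub>M adjoin_point N). fst p = snd p} \<inter> space M \<in> sets M"
    using f g by (intro measurable_sets[OF _ adjoin_point_diagonal[OF assms(1)]]) measurable
  also have "(\<lambda>m. (f m, g m)) -` {p \<in> space (adjoin_point N \<Otimes>\<^sub>M adjoin_point N). fst p = snd p} \<inter> space M =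
      {m \<in> space M. f m = g m}"
    using measurable_space[OF f] measurable_space[OF g]
    by (auto simp: space_pair_measure simp del: space_adjoin_point)
  finally show ?thesis .
qed

section \<open>Exponential decay with a measurable rate\<close>

lemma set_integrable_bounded:
  fixes g :: "real \<Rightarrow> real"
  assumes "g \<in> borel_measurable borel" "\<And>s. 0 \<le> g s" "\<And>s. g s \<le> K"
  shows "set_integrable lborel {x..y} g"
  unfolding set_integrable_def
  by (rule integrableI_bounded_set_indicator[where B=K])
    (use assms in \<open>auto simp: abs_of_nonneg emeasure_lborel_Icc_eq\<close>)

lemma set_integral_Icc_combine:
  fixes g :: "real \<Rightarrow> real"
  assumes g [measurable]: "g \<in> borel_measurable borel" and b: "\<And>s. 0 \<le> g s" "\<And>s. g s \<le> K"
    and xyz: "x \<le> y" "y \<le> z"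
  shows "(LBINT v:{x..z}. g v) = (LBINT v:{x..y}. g v) + (LBINT v:{y..z}. g v)"
proof -
  note int = set_integrable_bounded[OF g b]
  have "(LBINT v:{x..z}. g v) = (LBINT v:{x..y} \<union> {y<..z}. g v)"
    using xyz by (simp add: ivl_disj_un)
  also have "\<dots> = (LBINT v:{x..y}. g v) + (LBINT v:{y<..z}. g v)"
    by (rule set_integral_Un) (auto intro: set_integrable_subset[OF int[of y z]] int)
  also have "(LBINT v:{y<..z}. g v) = (LBINT v:{y..z}. g v)"
    unfolding set_lebesgue_integral_def
    by (intro integral_cong_AE AE_mp[OF AE_lborel_singleton[of y] always_eventually])
      (auto split: split_indicator)
  finally show ?thesis .
qed

text \<open>
  The decay factor \<open>E\<close> solves \<open>E' = l E\<close> in integrated form.  As \<open>l\<close> is only measurable, \<open>E\<close> need not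
  be differentiable everywhere.  The difference of the two sides as a function of the endpoint is
  differentiable, however: it changes by at most a multiple of the squared length of an interval,
  so its derivative is 0.
\<close>

lemma exp_decay_integral:
  fixes l :: "real \<Rightarrow> real"
  assumes l [measurable]: "l \<in> borel_measurable borel"
    and l0: "\<And>s. 0 \<le> l s" and lK: "\<And>s. l s \<le> K"
    and ab: "a \<le> b" "b \<le> t"
  defines "E \<equiv> \<lambda>s. exp (- (LBINT v:{s..t}. l v))"
  shows "ennreal (E a) + (\<integral>\<^sup>+s\<in>{a..b}. ennreal (l s * E s) \<partial>lborel) = ennreal (E b)"
proof -
  have K0: "0 \<le> K" using l0[of 0] lK[of 0] by linarith
  have int: "set_integrable lborel {x..y} l" for x y
    using l l0 lK by (rule set_integrable_bounded)
  define L where "L x y = (LBINT v:{x..y}. l v)" for x y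
  have L0: "0 \<le> L x y" for x y
    unfolding L_def set_lebesgue_integral_def by (intro integral_nonneg_AE) (use l0 in auto)
  have LK: "L x y \<le> K * (y - x)" if "x \<le> y" for x y
  proof -
    have "L x y \<le> (LBINT v:{x..y}. K)"
      unfolding L_def using lK
      by (intro set_integral_mono int) (auto simp: set_integrable_def emeasure_lborel_Icc_eq)
    also have "\<dots> = K * (y - x)" using that by (simp add: set_integral_const)
    finally show ?thesis .
  qed
  have Ladd: "L x z = L x y + L y z" if "x \<le> y" "y \<le> z" for x y z
    unfolding L_def using l l0 lK that by (rule set_integral_Icc_combine)
  have EL: "E s = exp (- L s t)" for s by (simp add: E_def L_def)
  have Emono: "E x \<le> E y" if "x \<le> y" "y \<le> t" for x y
    unfolding EL using Ladd[OF that] L0[of x y] by simp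
  have E1: "E x \<le> 1" "0 \<le> E x" for x unfolding EL using L0[of x t] by auto
  have mE: "E \<in> borel_measurable borel"
    unfolding E_def set_lebesgue_integral_def atLeastAtMost_def atLeast_def atMost_def by measurable
  define g where "g s = l s * E s" for s
  have mg [measurable]: "g \<in> borel_measurable borel" unfolding g_def using mE by measurable
  have gK: "0 \<le> g s" "g s \<le> K" for s
    unfolding g_def using l0[of s] lK[of s] E1[of s] mult_mono[of "l s" K "E s" 1] K0 by auto
  have gint: "set_integrable lborel {x..y} g" for x y
    using mg gK by (rule set_integrable_bounded)
  define J where "J x y = (LBINT v:{x..y}. g v)" for x y
  have Jadd: "J x z = J x y + J y z" if "x \<le> y" "y \<le> z" for x y z
    unfolding J_def using mg gK that by (rule set_integral_Icc_combine)
  have Jb: "E x * L x y \<le> J x y" "J x y \<le> E y * L x y" if "x \<le> y" "y \<le> t" for x y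
  proof -
    have "E x * L x y = (LBINT v:{x..y}. E x * l v)" unfolding L_def by simp
    also have "\<dots> \<le> J x y"
      unfolding J_def g_def using that Emono[of x] l0
      by (intro set_integral_mono gint[unfolded g_def] set_integrable_mult_right int)
        (auto simp: mult.commute intro!: mult_right_mono)
    finally show "E x * L x y \<le> J x y" .
    have "J x y \<le> (LBINT v:{x..y}. E y * l v)"
      unfolding J_def g_def using that Emono l0
      by (intro set_integral_mono gint[unfolded g_def] set_integrable_mult_right int)
        (auto simp: mult.commute intro!: mult_right_mono)
    also have "\<dots> = E y * L x y" unfolding L_def by simp
    finally show "J x y \<le> E y * L x y" .
  qed
  have Eb: "E x * L x y \<le> E y - E x" "E y - E x \<le> E y * L x y" if "x \<le> y" "y \<le> t" for x y
  proof -
    have eq: "E x = E y * exp (- L x y)" "E y = E x * exp (L x y)"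
      unfolding EL Ladd[OF that] by (simp_all add: exp_add[symmetric] exp_minus field_simps exp_diff)
    have "1 + L x y \<le> exp (L x y)" "1 - L x y \<le> exp (- L x y)"
      using exp_ge_add_one_self[of "L x y"] exp_ge_add_one_self[of "- L x y"] by auto
    then have "E x * (1 + L x y) \<le> E y" "E y * (1 - L x y) \<le> E x"
      using E1(2) mult_left_mono eq by metis+
    then show "E x * L x y \<le> E y - E x" "E y - E x \<le> E y * L x y"
      by (auto simp: algebra_simps)
  qed
  \<comment> \<open>The error on an interval is of second order in its length.\<close>
  have err: "\<bar>(E y - E x) - J x y\<bar> \<le> K\<^sup>2 * (y - x)\<^sup>2" if "x \<le> y" "y \<le> t" for x y
  proof -
    have "\<bar>(E y - E x) - J x y\<bar> \<le> (E y - E x) * L x y"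
      using Jb[OF that] Eb[OF that] by (auto simp: algebra_simps)
    also have "\<dots> \<le> (E y * L x y) * L x y" using Eb[OF that] L0 by (intro mult_right_mono) auto
    also have "\<dots> \<le> (1 * L x y) * L x y" using E1 L0 by (intro mult_right_mono) auto
    also have "\<dots> = L x y * L x y" by simp
    also have "\<dots> \<le> (K * (y - x)) * (K * (y - x))"
      by (rule mult_mono[OF LK[OF that(1)] LK[OF that(1)]]) (use K0 L0[of x y] that in auto)
    finally show ?thesis by (simp only: power2_eq_square mult_ac)
  qed
  define F where "F s = E s - J a s" for s
  have FF: "\<bar>F y - F x\<bar> \<le> K\<^sup>2 * (y - x)\<^sup>2" if "a \<le> x" "x \<le> y" "y \<le> b" for x y
  proof -
    have "F y - F x = (E y - E x) - J x y" using Jadd[of a x y] that unfolding F_def by simp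
    then show ?thesis using err[of x y] that ab by simp
  qed
  then have FF': "\<bar>F y - F x\<bar> \<le> K\<^sup>2 * (y - x)\<^sup>2" if "x \<in> {a..b}" "y \<in> {a..b}" for x y
  proof (cases "x \<le> y")
    case False
    then have "\<bar>F x - F y\<bar> \<le> K\<^sup>2 * (x - y)\<^sup>2" using FF[of y x] that by auto
    then show ?thesis using abs_minus_commute[of "F x"] power2_commute[of x] by simp
  qed (use FF that in auto)
  have "F b = F a"
  proof (rule has_derivative_zero_unique[of "{a..b}" F b a])
    fix x assume x: "x \<in> {a..b}"
    show "(F has_derivative (\<lambda>h. 0)) (at x within {a..b})"
      unfolding has_derivative_within
    proof (intro conjI)
      have "((\<lambda>y. K\<^sup>2 * \<bar>y - x\<bar>) \<longlongrightarrow> K\<^sup>2 * \<bar>x - x\<bar>) (at x within {a..b})"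
        by (intro tendsto_intros)
      then have "((\<lambda>y. K\<^sup>2 * \<bar>y - x\<bar>) \<longlongrightarrow> 0) (at x within {a..b})" by simp
      then show "((\<lambda>y. (1 / norm (y - x)) *\<^sub>R (F y - (F x + 0))) \<longlongrightarrow> 0) (at x within {a..b})"
      proof (rule Lim_null_comparison[rotated])
        show "\<forall>\<^sub>F y in at x within {a..b}. norm ((1 / norm (y - x)) *\<^sub>R (F y - (F x + 0))) \<le> K\<^sup>2 * \<bar>y - x\<bar>"
          unfolding eventually_at_filter
        proof (rule always_eventually, intro allI impI)
          fix y assume y: "y \<noteq> x" "y \<in> {a..b}"
          have "\<bar>F y - F x\<bar> / \<bar>y - x\<bar> \<le> (K\<^sup>2 * (y - x)\<^sup>2) / \<bar>y - x\<bar>"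
            using FF'[OF x y(2)] by (intro divide_right_mono) auto
          also have "(y - x)\<^sup>2 = \<bar>y - x\<bar> * \<bar>y - x\<bar>" by (simp add: power2_eq_square)
          also have "K\<^sup>2 * (\<bar>y - x\<bar> * \<bar>y - x\<bar>) / \<bar>y - x\<bar> = K\<^sup>2 * \<bar>y - x\<bar>"
            using y(1) by (simp del: abs_mult_self_eq)
          finally show "norm ((1 / norm (y - x)) *\<^sub>R (F y - (F x + 0))) \<le> K\<^sup>2 * \<bar>y - x\<bar>"
            by (simp add: divide_inverse mult.commute abs_mult)
        qed
      qed
    qed simp
  qed (use ab in auto)
  moreover have "J a a = 0"
    using Jadd[of a a a] by simp
  ultimately have main: "E a + J a b = E b" by (simp add: F_def)
  have "(\<integral>\<^sup>+s\<in>{a..b}. ennreal (l s * E s) \<partial>lborel) = (\<integral>\<^sup>+s. ennreal (indicator {a..b} s * g s) \<partial>lborel)"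
    unfolding g_def by (intro nn_integral_cong) (auto split: split_indicator)
  also have "\<dots> = ennreal (J a b)"
    unfolding J_def set_lebesgue_integral_def
    using gint[of a b] gK(1) by (subst nn_integral_eq_integral) (auto simp: set_integrable_def)
  finally have "ennreal (E a) + (\<integral>\<^sup>+s\<in>{a..b}. ennreal (l s * E s) \<partial>lborel) = ennreal (E a) + ennreal (J a b)"
    by simp
  also have "\<dots> = ennreal (E a + J a b)"
  proof (rule ennreal_plus[symmetric])
    have "0 \<le> E a * L a b" using E1(2) L0 by (rule mult_nonneg_nonneg)
    then show "0 \<le> J a b" using Jb(1)[of a b] ab by linarith
  qed (use E1 in auto)
  finally show ?thesis using main by simp
qed

section \<open>Jump intensities as a kernel\<close>

lemma signed_measure_empty:
  assumes "signed_measure M m"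
  shows "m {} = 0"
proof -
  have "(\<lambda>n::nat. m {}) sums m (\<Union>n::nat. {})"
    using assms unfolding signed_measure_def
    by (elim allE[of _ "\<lambda>_. {}"]) (auto simp: disjoint_family_on_def)
  then have "(\<lambda>n::nat. m {}) \<longlonglongrightarrow> 0"
    by (intro summable_LIMSEQ_zero) (auto simp: summable_def)
  then show ?thesis by (simp add: LIMSEQ_const_iff)
qed

lemma signed_measure_Un:
  assumes m: "signed_measure M m" and A: "A \<in> sets M" and B: "B \<in> sets M" and "A \<inter> B = {}"
  shows "m (A \<union> B) = m A + m B"
proof -
  have "disjoint_family (binaryset A B)"
    using assms(4) by (auto simp: disjoint_family_on_def binaryset_def)
  moreover have "range (binaryset A B) \<subseteq> sets M"
    using A B by (auto simp: range_binaryset_eq)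
  ultimately have "(\<lambda>n. m (binaryset A B n)) sums m (\<Union>n. binaryset A B n)"
    using m unfolding signed_measure_def by blast
  moreover have "(\<lambda>n. m (binaryset A B n)) sums (m A + m B)"
    using signed_measure_empty[OF m] by (rule binaryset_sums)
  ultimately show ?thesis by (simp add: UN_binaryset_eq sums_unique2)
qed

context CTJMDP
begin

lemma singleton_sets: "x \<in> space X \<Longrightarrow> {x} \<in> sets X"
  using standard_borel_singleton[OF standard_borel_X] .

text \<open>
  The measure \<open>Z \<mapsto> q(x, a, Z - {x})\<close>; it is set to 0 for actions that are not available.
\<close>

definition jump_kernel :: "'x \<Rightarrow> 'a \<Rightarrow> 'x measure" where
  "jump_kernel x a = measure_of (space X) (sets X)
     (\<lambda>Z. if a \<in> Act x then ennreal (q x a (Z - {x})) else 0)"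

lemma sets_jump_kernel [simp, measurable_cong]: "sets (jump_kernel x a) = sets X"
  unfolding jump_kernel_def by (simp add: sets.space_closed sets.sigma_sets_eq)

lemma space_jump_kernel [simp]: "space (jump_kernel x a) = space X"
  by (rule sets_eq_imp_space_eq) simp

lemma emeasure_jump_kernel:
  assumes x: "x \<in> space X" and Z: "Z \<in> sets X"
  shows "emeasure (jump_kernel x a) Z = (if a \<in> Act x then ennreal (q x a (Z - {x})) else 0)"
proof (rule emeasure_measure_of[OF jump_kernel_def])
  show "sets X \<subseteq> Pow (space X)" by (rule sets.space_closed)
  show "Z \<in> sets (jump_kernel x a)" using Z by simp
  show "positive (sets (jump_kernel x a)) (\<lambda>Z. if a \<in> Act x then ennreal (q x a (Z - {x})) else 0)"
    using signed_measure_empty[OF q_signed[OF x]] by (auto simp: positive_def)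
  show "countably_additive (sets (jump_kernel x a)) (\<lambda>Z. if a \<in> Act x then ennreal (q x a (Z - {x})) else 0)"
  proof (rule countably_additiveI)
    fix D :: "nat \<Rightarrow> 'x set"
    assume D: "range D \<subseteq> sets (jump_kernel x a)" "disjoint_family D"
    show "(\<Sum>i. if a \<in> Act x then ennreal (q x a (D i - {x})) else 0) =
        (if a \<in> Act x then ennreal (q x a (\<Union> (range D) - {x})) else 0)"
    proof (cases "a \<in> Act x")
      case a: True
      have "(\<lambda>i. q x a (D i - {x})) sums q x a (\<Union>i. D i - {x})"
        using q_signed[OF x a] unfolding signed_measure_def
        by (elim allE[of _ "\<lambda>i. D i - {x}"])
          (use D singleton_sets[OF x] in \<open>auto simp: disjoint_family_on_def\<close>)
      moreover have "(\<Union>i. D i - {x}) = \<Union> (range D) - {x}" by auto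
      moreover have "0 \<le> q x a (D i - {x})" for i using q_nonneg[OF x a, of "D i"] D by auto
      ultimately show ?thesis using a
        by (simp add: suminf_ennreal2 sums_iff)
    qed simp
  qed
qed

text \<open>
  In \<open>q(x, a, Z - {x})\<close> the set depends on \<open>x\<close>.  Measurability is therefore shown for the sections of
  all measurable subsets of the product, by Dynkin's theorem.
\<close>

lemma measurable_q_sections:
  assumes "D \<in> sets (X \<Otimes>\<^sub>M X)"
  shows "(\<lambda>(x, a). q x a (Pair x -` D)) \<in>
    borel_measurable (restrict_space (X \<Otimes>\<^sub>M A) (action_graph X Act))" (is "?f D \<in> borel_measurable ?G")
proof -
  have sp: "space ?G = action_graph X Act"
    using Act_subset by (auto simp: space_restrict_space space_pair_measure action_graph_def)
  show ?thesis
    using Int_stable_pair_measure_generator[of X X] pair_measure_closed[of X X]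
      assms[unfolded sets_pair_measure]
  proof (induction rule: sigma_sets_induct_disjoint)
    case (basic D)
    then obtain a b where D: "D = a \<times> b" "a \<in> sets X" "b \<in> sets X" by auto
    have [measurable]: "fst \<in> measurable ?G X"
      by (intro measurable_restrict_space1) simp
    have "(\<lambda>p. indicator a (fst p) * (\<lambda>(x, a). q x a b) p) \<in> borel_measurable ?G"
      using q_measurable[OF D(3)] D(2) by measurable
    then show ?case
    proof (rule measurable_cong[THEN iffD1, rotated])
      fix p assume "p \<in> space ?G"
      then obtain x a' where p: "p = (x, a')" "x \<in> space X" "a' \<in> Act x"
        unfolding sp by (auto simp: action_graph_def)
      show "indicator a (fst p) * (\<lambda>(x, a). q x a b) p = ?f D p"
        using signed_measure_empty[OF q_signed[OF p(2,3)]] by (simp add: p(1) D(1) indicator_def)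
    qed
  next
    case empty
    show ?case
    proof (rule measurable_cong[THEN iffD1])
      fix p assume "p \<in> space ?G"
      then show "0 = ?f {} p"
        unfolding sp by (auto simp: action_graph_def signed_measure_empty[OF q_signed])
    qed simp
  next
    case (compl D)
    have "(\<lambda>p. - ?f D p) \<in> borel_measurable ?G" using compl by measurable
    then show ?case
    proof (rule measurable_cong[THEN iffD1, rotated])
      fix p assume "p \<in> space ?G"
      then obtain x a where p: "p = (x, a)" "x \<in> space X" "a \<in> Act x"
        unfolding sp by (auto simp: action_graph_def)
      have D: "D \<in> sets (X \<Otimes>\<^sub>M X)" using compl by (simp add: sets_pair_measure)
      have D1: "Pair x -` D \<in> sets X" using D by (rule sets_Pair1)
      then have sub: "Pair x -` D \<subseteq> space X" by (rule sets.sets_into_space)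
      have "q x a (Pair x -` D \<union> (space X - Pair x -` D)) =
          q x a (Pair x -` D) + q x a (space X - Pair x -` D)"
        using D1 by (intro signed_measure_Un[OF q_signed[OF p(2,3)]]) auto
      moreover have "Pair x -` D \<union> (space X - Pair x -` D) = space X" using sub by auto
      moreover have "Pair x -` (space X \<times> space X - D) = space X - Pair x -` D" using p by auto
      ultimately show "- ?f D p = ?f (space X \<times> space X - D) p"
        using q_space[OF p(2,3)] p(1) by simp
    qed
  next
    case (union D)
    have "(\<lambda>p. \<Sum>i. ?f (D i) p) \<in> borel_measurable ?G" using union by measurable
    then show ?case
    proof (rule measurable_cong[THEN iffD1, rotated])
      fix p assume "p \<in> space ?G"
      then obtain x a where p: "p = (x, a)" "x \<in> space X" "a \<in> Act x"
        unfolding sp by (auto simp: action_graph_def)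
      have D: "D i \<in> sets (X \<Otimes>\<^sub>M X)" for i using union by (auto simp: sets_pair_measure)
      have D1: "Pair x -` D i \<in> sets X" for i using D by (rule sets_Pair1)
      have "(\<lambda>i. q x a (Pair x -` D i)) sums q x a (\<Union>i. Pair x -` D i)"
        using q_signed[OF p(2,3)] unfolding signed_measure_def
        by (elim allE[of _ "\<lambda>i. Pair x -` D i"])
          (use D1 union(1) in \<open>auto simp: disjoint_family_on_def\<close>)
      moreover have "(\<Union>i. Pair x -` D i) = Pair x -` \<Union> (range D)" by auto
      ultimately show "(\<Sum>i. ?f (D i) p) = ?f (\<Union> (range D)) p"
        using p(1) by (simp add: sums_iff)
    qed
  qed
qed

lemma measurable_emeasure_jump_kernel:
  assumes Z: "Z \<in> sets X"
  shows "(\<lambda>(x, a). emeasure (jump_kernel x a) Z) \<in> borel_measurable (X \<Otimes>\<^sub>M A)"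
proof -
  let ?D = "(space X \<times> Z) - {p \<in> space (X \<Otimes>\<^sub>M X). fst p = snd p}"
  have D: "?D \<in> sets (X \<Otimes>\<^sub>M X)"
    using Z standard_borel_diagonal[OF standard_borel_X] by auto
  have sec: "Pair x -` ?D = Z - {x}" if "x \<in> space X" for x
    using that sets.sets_into_space[OF Z] by (auto simp: space_pair_measure)
  have "(\<lambda>p. ennreal ((\<lambda>(x, a). q x a (Pair x -` ?D)) p))
      \<in> borel_measurable (restrict_space (X \<Otimes>\<^sub>M A) (action_graph X Act))"
    using measurable_q_sections[OF D] by measurable
  then have "(\<lambda>p. ennreal ((\<lambda>(x, a). q x a (Pair x -` ?D)) p) * indicator (action_graph X Act) p)
      \<in> borel_measurable (X \<Otimes>\<^sub>M A)"
    using graph_measurable by (subst (asm) borel_measurable_restrict_space_iff_ennreal) auto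
  then show ?thesis
  proof (rule measurable_cong[THEN iffD1, rotated])
    fix p assume "p \<in> space (X \<Otimes>\<^sub>M A)"
    then have p: "fst p \<in> space X" by (auto simp: space_pair_measure)
    show "ennreal ((\<lambda>(x, a). q x a (Pair x -` ?D)) p) * indicator (action_graph X Act) p =
        (\<lambda>(x, a). emeasure (jump_kernel x a) Z) p"
      using p unfolding case_prod_beta sec[OF p] emeasure_jump_kernel[OF p Z]
      by (cases p) (simp add: action_graph_def indicator_def)
  qed
qed

lemma emeasure_jump_kernel_finite: "x \<in> space X \<Longrightarrow> emeasure (jump_kernel x a) (space X) < \<infinity>"
  by (simp add: emeasure_jump_kernel)

text \<open>
  The intensity divided by its total mass, and the zero measure if the mass vanishes.  The rates may
  be unbounded, and kernels in the sense of \<^const>\<open>subprob_algebra\<close> have mass at most 1.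
\<close>

definition jump_dist :: "'x \<times> 'a \<Rightarrow> 'x measure" where
  "jump_dist p = scale_measure (inverse (emeasure (jump_kernel (fst p) (snd p)) (space X))) (jump_kernel (fst p) (snd p))"

lemma measurable_jump_dist: "jump_dist \<in> measurable (X \<Otimes>\<^sub>M A) (subprob_algebra X)"
proof (rule measurable_subprob_algebra)
  fix p assume p: "p \<in> space (X \<Otimes>\<^sub>M A)"
  let ?r = "emeasure (jump_kernel (fst p) (snd p)) (space X)"
  show "subprob_space (jump_dist p)"
  proof (rule subprob_spaceI)
    have "?r < \<infinity>" using p by (intro emeasure_jump_kernel_finite) (auto simp: space_pair_measure)
    then have "inverse ?r * ?r \<le> 1"
      by (cases "?r = 0") (auto simp: mult.commute ennreal_divide_self divide_ennreal_def[symmetric])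
    then show "emeasure (jump_dist p) (space (jump_dist p)) \<le> 1"
      by (simp add: jump_dist_def space_scale_measure)
    show "space (jump_dist p) \<noteq> {}"
      using p by (auto simp: jump_dist_def space_scale_measure space_pair_measure)
  qed
  show "sets (jump_dist p) = sets X" by (simp add: jump_dist_def)
next
  fix Z assume Z: "Z \<in> sets X"
  have [measurable]: "(\<lambda>p. emeasure (jump_kernel (fst p) (snd p)) B) \<in> borel_measurable (X \<Otimes>\<^sub>M A)"
    if "B \<in> sets X" for B
    using measurable_emeasure_jump_kernel[OF that] by (simp add: case_prod_beta')
  show "(\<lambda>p. emeasure (jump_dist p) Z) \<in> borel_measurable (X \<Otimes>\<^sub>M A)"
    unfolding jump_dist_def using Z by simp measurable
qed

lemma nn_integral_jump_kernel:
  assumes x: "x \<in> space X" and f: "f \<in> borel_measurable X"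
  shows "(\<integral>\<^sup>+y. f y \<partial>jump_kernel x a) = emeasure (jump_kernel x a) (space X) * (\<integral>\<^sup>+y. f y \<partial>jump_dist (x, a))"
proof -
  let ?r = "emeasure (jump_kernel x a) (space X)"
  have "?r * (\<integral>\<^sup>+y. f y \<partial>jump_dist (x, a)) = ?r * (inverse ?r * (\<integral>\<^sup>+y. f y \<partial>jump_kernel x a))"
    unfolding jump_dist_def using f
    by (subst nn_integral_scale_measure) (auto cong: measurable_cong_sets)
  also have "\<dots> = (\<integral>\<^sup>+y. f y \<partial>jump_kernel x a)"
  proof (cases "?r = 0")
    case True
    then have "(\<integral>\<^sup>+y. f y \<partial>jump_kernel x a) = (\<integral>\<^sup>+y. 0 \<partial>jump_kernel x a)"
      by (intro nn_integral_cong_AE) (auto intro!: AE_I[where N="space X"])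
    then show ?thesis using True by simp
  next
    case False
    then show ?thesis using emeasure_jump_kernel_finite[OF x, of a]
      by (simp add: mult.assoc[symmetric] divide_ennreal_def[symmetric] ennreal_divide_self)
  qed
  finally show ?thesis by simp
qed

lemma measurable_nn_integral_jump_kernel:
  assumes f: "(\<lambda>(m, y). f m y) \<in> borel_measurable (M \<Otimes>\<^sub>M X)"
    and g: "g \<in> measurable M X" and h: "h \<in> measurable M A"
  shows "(\<lambda>m. \<integral>\<^sup>+y. f m y \<partial>jump_kernel (g m) (h m)) \<in> borel_measurable M"
proof -
  have gh: "(\<lambda>m. (g m, h m)) \<in> measurable M (X \<Otimes>\<^sub>M A)" using g h by measurable
  have 1: "(\<lambda>m. emeasure (jump_kernel (g m) (h m)) (space X)) \<in> borel_measurable M"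
    using measurable_compose[OF gh measurable_emeasure_jump_kernel[OF sets.top]] by simp
  have 2: "(\<lambda>m. \<integral>\<^sup>+y. f m y \<partial>jump_dist (g m, h m)) \<in> borel_measurable M"
    by (rule nn_integral_measurable_subprob_algebra2[OF f measurable_compose[OF gh measurable_jump_dist]])
  have "(\<lambda>m. emeasure (jump_kernel (g m) (h m)) (space X) * (\<integral>\<^sup>+y. f m y \<partial>jump_dist (g m, h m))) \<in> borel_measurable M"
    using 1 2 by measurable
  then show ?thesis
  proof (rule measurable_cong[THEN iffD1, rotated])
    fix m assume m: "m \<in> space M"
    have "f m \<in> borel_measurable X" using measurable_compose[OF measurable_Pair1'[OF m] f] by simp
    then show "emeasure (jump_kernel (g m) (h m)) (space X) * (\<integral>\<^sup>+y. f m y \<partial>jump_dist (g m, h m)) = (\<integral>\<^sup>+y. f m y \<partial>jump_kernel (g m) (h m))"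
      using nn_integral_jump_kernel[OF measurable_space[OF g m]] by simp
  qed
qed

lemma jump_kernel_le_max_jump_rate:
  assumes x: "x \<in> space X" and fin: "max_jump_rate X Act q x < \<infinity>"
  obtains K :: real where "0 \<le> K" "\<And>a. emeasure (jump_kernel x a) (space X) \<le> ennreal K"
proof -
  define K where "K = max 0 (real_of_ereal (max_jump_rate X Act q x))"
  have "ereal (q x a (space X - {x})) \<le> max_jump_rate X Act q x" if "a \<in> Act x" for a
    unfolding max_jump_rate_def using that
    by (intro SUP_upper2[of a]) (auto simp: jump_rate_def)
  then have "q x a (space X - {x}) \<le> K" if "a \<in> Act x" for a
    using that fin unfolding K_def by (cases "max_jump_rate X Act q x") force+
  then have "emeasure (jump_kernel x a) (space X) \<le> ennreal K" for a
    by (auto simp: emeasure_jump_kernel x intro: ennreal_leI)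
  moreover have "0 \<le> K" by (simp add: K_def)
  ultimately show ?thesis using that by blast
qed

end

section \<open>Trajectories\<close>

text \<open>The \<open>n\<close>-th jump time as a real number, with value 0 if it is infinite.\<close>

abbreviation rtime :: "'x trajectory \<Rightarrow> nat \<Rightarrow> real" where
  "rtime \<omega> n \<equiv> real_of_ereal (jump_time \<omega> n)"

text \<open>Pairs of a trajectory and a positive time.\<close>

abbreviation timed :: "'x measure \<Rightarrow> ('x trajectory \<times> real) measure" where
  "timed X \<equiv> trajectories X \<Otimes>\<^sub>M pos_reals"

text \<open>Triples of a jump time and the states before and after the jump.\<close>

abbreviation jumps :: "'x measure \<Rightarrow> ((real \<times> 'x) \<times> 'x) measure" where
  "jumps X \<equiv> (pos_reals \<Otimes>\<^sub>M X) \<Otimes>\<^sub>M X"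

context
  fixes X :: "'x measure" and \<omega> :: "'x trajectory"
  assumes \<omega>: "\<omega> \<in> space (trajectories X)"
begin

lemma trajectory_start: "fst \<omega> \<in> space X"
  using \<omega> by (auto simp: trajectories_def space_restrict_space space_pair_measure)

lemma jump_time_Suc_pos: "0 < jump_time \<omega> (Suc n)"
  using \<omega> by (auto simp: trajectories_def space_restrict_space space_pair_measure space_PiM PiE_iff mem_Times_iff)

lemma jump_time_nonneg: "0 \<le> jump_time \<omega> n"
  using jump_time_Suc_pos by (cases n) (auto intro: less_imp_le)

lemma trajectoryD:
  assumes "1 \<le> n"
  shows "jump_time \<omega> n < \<infinity> \<Longrightarrow> jump_state \<omega> n \<in> Some ` space X"
    and "jump_time \<omega> n < \<infinity> \<Longrightarrow> jump_time \<omega> n < jump_time \<omega> (Suc n)"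
    and "jump_time \<omega> n = \<infinity> \<Longrightarrow> jump_state \<omega> n = None"
    and "jump_time \<omega> n = \<infinity> \<Longrightarrow> jump_time \<omega> (Suc n) = \<infinity>"
  using \<omega> assms by (auto simp: trajectories_def space_restrict_space simp del: jump_time.simps jump_state.simps)

lemma jump_state_Some: "jump_time \<omega> n < \<infinity> \<Longrightarrow> jump_state \<omega> n \<in> Some ` space X"
  using trajectoryD(1)[of n] trajectory_start by (cases n) auto

lemma jump_time_less_Suc: "jump_time \<omega> n < \<infinity> \<Longrightarrow> jump_time \<omega> n < jump_time \<omega> (Suc n)"
  using trajectoryD(2)[of n] jump_time_Suc_pos[of 0] by (cases n) auto

lemma jump_time_le_Suc: "jump_time \<omega> n \<le> jump_time \<omega> (Suc n)"
proof (cases "jump_time \<omega> n < \<infinity>")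
  case True then show ?thesis using jump_time_less_Suc by (auto simp: less_imp_le)
next
  case False
  then show ?thesis using trajectoryD(4)[of n] by (cases n) auto
qed

lemma incseq_jump_time: "incseq (jump_time \<omega>)"
  using jump_time_le_Suc by (rule incseq_SucI)

lemma jump_time_mono: "m \<le> n \<Longrightarrow> jump_time \<omega> m \<le> jump_time \<omega> n"
  using incseq_jump_time by (auto simp: incseq_def)

lemma explosion_time_eq: "explosion_time \<omega> = (SUP n. jump_time \<omega> n)"
  unfolding explosion_time_def using LIMSEQ_SUP[OF incseq_jump_time] by (rule limI)

lemma jump_time_le_explosion: "jump_time \<omega> n \<le> explosion_time \<omega>"
  unfolding explosion_time_eq by (rule SUP_upper) simp

lemma jump_time_less_explosion: "jump_time \<omega> n < \<infinity> \<Longrightarrow> jump_time \<omega> n < explosion_time \<omega>"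
  using jump_time_less_Suc jump_time_le_explosion less_le_trans by blast

lemma sojourn_unique:
  assumes "jump_time \<omega> m \<le> ereal t" "ereal t < jump_time \<omega> (Suc m)"
    and "jump_time \<omega> n \<le> ereal t" "ereal t < jump_time \<omega> (Suc n)"
  shows "m = n"
proof (rule ccontr)
  assume "m \<noteq> n"
  then have "Suc m \<le> n \<or> Suc n \<le> m" by auto
  then show False using jump_time_mono[of "Suc m" n] jump_time_mono[of "Suc n" m] assms by auto
qed

lemma sojourn_before_unique:
  assumes "jump_time \<omega> m < ereal t" "ereal t \<le> jump_time \<omega> (Suc m)"
    and "jump_time \<omega> n < ereal t" "ereal t \<le> jump_time \<omega> (Suc n)"
  shows "m = n"
proof (rule ccontr)
  assume "m \<noteq> n"
  then have "Suc m \<le> n \<or> Suc n \<le> m" by auto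
  then show False using jump_time_mono[of "Suc m" n] jump_time_mono[of "Suc n" m] assms by auto
qed

lemma state_eq:
  assumes "jump_time \<omega> n \<le> ereal t" "ereal t < jump_time \<omega> (Suc n)"
  shows "state \<omega> t = jump_state \<omega> n"
proof -
  have "(THE n. jump_time \<omega> n \<le> ereal t \<and> ereal t < jump_time \<omega> (Suc n)) = n"
    using assms sojourn_unique by (intro the_equality) auto
  then show ?thesis using assms unfolding state_def by metis
qed

lemma state_before_eq:
  assumes "jump_time \<omega> n < ereal t" "ereal t \<le> jump_time \<omega> (Suc n)"
  shows "state_before \<omega> t = jump_state \<omega> n"
proof -
  have "(THE n. jump_time \<omega> n < ereal t \<and> ereal t \<le> jump_time \<omega> (Suc n)) = n"
    using assms sojourn_before_unique by (intro the_equality) auto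
  then show ?thesis using assms unfolding state_before_def by metis
qed

lemma sojourn_exists:
  assumes "0 \<le> t" "ereal t < explosion_time \<omega>"
  obtains n where "jump_time \<omega> n \<le> ereal t" "ereal t < jump_time \<omega> (Suc n)"
proof -
  obtain m where m: "ereal t < jump_time \<omega> m"
    using assms(2) unfolding explosion_time_eq by (auto simp: less_SUP_iff)
  define k where "k = (LEAST m. ereal t < jump_time \<omega> m)"
  have k: "ereal t < jump_time \<omega> k" unfolding k_def using m by (rule LeastI)
  then obtain n where n: "k = Suc n" using assms(1) by (cases k) auto
  have "\<not> ereal t < jump_time \<omega> n"
    using not_less_Least[of n "\<lambda>m. ereal t < jump_time \<omega> m"] n unfolding k_def by simp
  then show ?thesis using that[of n] k n by (auto simp: not_less)
qed

lemma sojourn_before_exists: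
  assumes "0 < t" "ereal t < explosion_time \<omega>"
  obtains n where "jump_time \<omega> n < ereal t" "ereal t \<le> jump_time \<omega> (Suc n)"
proof -
  obtain m where m: "ereal t < jump_time \<omega> m"
    using assms(2) unfolding explosion_time_eq by (auto simp: less_SUP_iff)
  define k where "k = (LEAST m. ereal t \<le> jump_time \<omega> m)"
  have k: "ereal t \<le> jump_time \<omega> k" unfolding k_def using less_imp_le[OF m] by (rule LeastI)
  then obtain n where n: "k = Suc n" using assms(1) by (cases k) auto
  have "\<not> ereal t \<le> jump_time \<omega> n"
    using not_less_Least[of n "\<lambda>m. ereal t \<le> jump_time \<omega> m"] n unfolding k_def by simp
  then show ?thesis using that[of n] k n by (auto simp: not_le)
qed

lemma sojourn_before_explosion:
  assumes "ereal t < jump_time \<omega> (Suc n) \<or> ereal t \<le> jump_time \<omega> (Suc n)"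
  shows "ereal t < explosion_time \<omega>"
proof (cases "jump_time \<omega> (Suc n) < \<infinity>")
  case True
  then show ?thesis using jump_time_less_explosion[OF True] assms by auto
next
  case False
  then have "explosion_time \<omega> = \<infinity>" using jump_time_le_explosion[of "Suc n"] by auto
  then show ?thesis by simp
qed

lemma state_None_iff:
  assumes "0 \<le> t"
  shows "state \<omega> t = None \<longleftrightarrow> explosion_time \<omega> \<le> ereal t"
proof (cases "ereal t < explosion_time \<omega>")
  case True
  then obtain n where n: "jump_time \<omega> n \<le> ereal t" "ereal t < jump_time \<omega> (Suc n)"
    using sojourn_exists[OF assms] by blast
  then have "jump_time \<omega> n < \<infinity>" by auto
  then show ?thesis using jump_state_Some[of n] state_eq[OF n] True by auto
next
  case False
  then have "\<not> (\<exists>n. jump_time \<omega> n \<le> ereal t \<and> ereal t < jump_time \<omega> (Suc n))"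
    using sojourn_before_explosion by blast
  then show ?thesis using False by (auto simp: state_def)
qed

end

lemma measurable_jump_time [measurable]: "(\<lambda>\<omega>. jump_time \<omega> n) \<in> borel_measurable (trajectories X)"
proof (cases n)
  case (Suc m)
  have 1: "(\<lambda>\<omega>. fst (snd \<omega> m)) \<in> measurable (X \<Otimes>\<^sub>M (\<Pi>\<^sub>M n\<in>UNIV. pos_ereals \<Otimes>\<^sub>M adjoin_point X)) pos_ereals"
    by measurable
  have "(\<lambda>\<omega>. fst (snd \<omega> m)) \<in> borel_measurable (X \<Otimes>\<^sub>M (\<Pi>\<^sub>M n\<in>UNIV. pos_ereals \<Otimes>\<^sub>M adjoin_point X))"
    using 1 by (rule measurable_compose[of _ _ pos_ereals "\<lambda>x. x", simplified])
      (auto intro: measurable_restrict_space1)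
  then show ?thesis
    unfolding trajectories_def Suc by (intro measurable_restrict_space1) simp
qed simp

lemma measurable_jump_state [measurable]:
  "(\<lambda>\<omega>. jump_state \<omega> n) \<in> measurable (trajectories X) (adjoin_point X)"
proof (cases n)
  case 0
  show ?thesis
    unfolding 0 jump_state.simps trajectories_def by (intro measurable_restrict_space1) measurable
next
  case (Suc m)
  show ?thesis
    unfolding Suc jump_state.simps trajectories_def by (intro measurable_restrict_space1) measurable
qed

lemma measurable_fst_trajectories [measurable]: "fst \<in> measurable (trajectories X) X"
  unfolding trajectories_def by (intro measurable_restrict_space1) simp

text \<open>The event that the \<open>n\<close>-th state is occupied at time \<open>s\<close>, that is, \<open>s \<in> [t\<^sub>n, t\<^bsub>n+1\<^esub>)\<close>.\<close>

definition sojourn :: "nat \<Rightarrow> 'x trajectory \<Rightarrow> real \<Rightarrow> bool" where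
  "sojourn n \<omega> s \<longleftrightarrow> jump_time \<omega> n \<le> ereal s \<and> ereal s < jump_time \<omega> (Suc n)"

text \<open>The \<open>n\<close>-th state, with an arbitrary value in the state space if the jump time is infinite.\<close>

definition nth_state :: "'x measure \<Rightarrow> nat \<Rightarrow> 'x trajectory \<Rightarrow> 'x" where
  "nth_state X n \<omega> = point_of X (jump_state \<omega> n)"

lemma measurable_sojourn [measurable]:
  "Measurable.pred (trajectories X \<Otimes>\<^sub>M borel) (\<lambda>p. sojourn n (fst p) (snd p))"
  unfolding sojourn_def by measurable

lemma space_trajectories_not_empty: "\<omega> \<in> space (trajectories X) \<Longrightarrow> space X \<noteq> {}"
  using trajectory_start by blast

text \<open>The value of \<open>f\<close> at the jump number \<open>n + 1\<close>, and its sum over the jumps with \<open>n \<in> I\<close>.\<close>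

abbreviation at_jump :: "'x measure \<Rightarrow> ((real \<times> 'x) \<times> 'x \<Rightarrow> ennreal) \<Rightarrow> 'x trajectory \<Rightarrow> nat \<Rightarrow> ennreal" where
  "at_jump X f \<omega> n \<equiv> f ((rtime \<omega> (Suc n), nth_state X n \<omega>), nth_state X (Suc n) \<omega>)"

abbreviation jump_sum :: "'x measure \<Rightarrow> nat set \<Rightarrow> ((real \<times> 'x) \<times> 'x \<Rightarrow> ennreal) \<Rightarrow> 'x trajectory \<Rightarrow> ennreal" where
  "jump_sum X I f \<omega> \<equiv> \<Sum>n. if n \<in> I \<and> jump_time \<omega> (Suc n) < \<infinity> then at_jump X f \<omega> n else 0"

lemma measurable_nth_state [measurable]: "nth_state X n \<in> measurable (trajectories X) X"
proof (cases "space X = {}")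
  case True
  then have "space (trajectories X) = {}" using space_trajectories_not_empty by blast
  then show ?thesis by (simp add: measurable_def space_empty)
next
  case False
  show ?thesis
    unfolding nth_state_def using measurable_jump_state measurable_point_of[OF False] by (rule measurable_compose)
qed

lemma nth_state_in_space: "\<omega> \<in> space (trajectories X) \<Longrightarrow> nth_state X n \<omega> \<in> space X"
  using measurable_nth_state by (rule measurable_space)

lemma jump_state_nth_state:
  assumes "\<omega> \<in> space (trajectories X)" "jump_time \<omega> n < \<infinity>"
  shows "jump_state \<omega> n = Some (nth_state X n \<omega>)"
  using jump_state_Some[OF assms] by (auto simp: nth_state_def)

lemma nth_state_0 [simp]: "nth_state X 0 \<omega> = fst \<omega>"
  by (simp add: nth_state_def)

lemma state_sojourn:
  assumes "\<omega> \<in> space (trajectories X)" "sojourn n \<omega> s"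
  shows "state \<omega> s = Some (nth_state X n \<omega>)"
proof -
  have "jump_time \<omega> n < \<infinity>" using assms(2) by (auto simp: sojourn_def)
  then show ?thesis
    using state_eq[OF assms(1), of n s] jump_state_nth_state[OF assms(1)] assms(2) by (auto simp: sojourn_def)
qed

text \<open>A sum over the sojourns has at most one nonzero term.\<close>

lemma suminf_sojourn:
  fixes g :: "nat \<Rightarrow> ennreal"
  assumes "\<omega> \<in> space (trajectories X)" "sojourn n \<omega> s"
  shows "(\<Sum>m. if sojourn m \<omega> s then g m else 0) = g n"
proof -
  have "(\<Sum>m. if sojourn m \<omega> s then g m else 0) = (\<Sum>m\<in>{n}. if sojourn m \<omega> s then g m else 0)"
    using sojourn_unique[OF assms(1), of n s] assms(2)
    by (intro suminf_finite) (auto simp: sojourn_def)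
  then show ?thesis using assms(2) by simp
qed

lemma sum_sojourn_eq_case_state:
  fixes g :: "'x \<Rightarrow> ennreal"
  assumes "\<omega> \<in> space (trajectories X)"
  shows "(\<Sum>m. if sojourn m \<omega> s then g (nth_state X m \<omega>) else 0) = (case state \<omega> s of None \<Rightarrow> 0 | Some x \<Rightarrow> g x)"
proof (cases "\<exists>n. sojourn n \<omega> s")
  case True
  then obtain n where "sojourn n \<omega> s" by blast
  then show ?thesis using suminf_sojourn[OF assms, of n s] state_sojourn[OF assms, of n s] by simp
next
  case False
  then have "state \<omega> s = None" by (auto simp: state_def sojourn_def)
  then show ?thesis using False by simp
qed

lemma measurable_state [measurable]:
  "(\<lambda>p. state (fst p) (snd p)) \<in> measurable (trajectories X \<Otimes>\<^sub>M borel) (adjoin_point X)"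
proof (rule measurableI)
  let ?M = "trajectories X \<Otimes>\<^sub>M (borel :: real measure)"
  have sp: "fst p \<in> space (trajectories X)" if "p \<in> space ?M" for p
    using that by (auto simp: space_pair_measure)
  fix p assume p: "p \<in> space ?M"
  show "state (fst p) (snd p) \<in> space (adjoin_point X)"
  proof (cases "\<exists>n. sojourn n (fst p) (snd p)")
    case True
    then show ?thesis using state_sojourn[OF sp[OF p]] nth_state_in_space[OF sp[OF p]] by auto
  next
    case False
    then have "state (fst p) (snd p) = None" by (auto simp: state_def sojourn_def)
    then show ?thesis by simp
  qed
next
  let ?M = "trajectories X \<Otimes>\<^sub>M (borel :: real measure)"
  fix Z assume Z: "Z \<in> sets (adjoin_point X)"
  have "(\<lambda>p. state (fst p) (snd p)) -` Z \<inter> space ?M =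
      {p \<in> space ?M. if \<exists>n. sojourn n (fst p) (snd p)
        then \<exists>n. sojourn n (fst p) (snd p) \<and> jump_state (fst p) n \<in> Z else None \<in> Z}"
  proof -
    have "state (fst p) (snd p) \<in> Z \<longleftrightarrow> (if \<exists>n. sojourn n (fst p) (snd p)
        then \<exists>n. sojourn n (fst p) (snd p) \<and> jump_state (fst p) n \<in> Z else None \<in> Z)"
      if p: "p \<in> space ?M" for p
    proof -
      have "fst p \<in> space (trajectories X)" using p by (auto simp: space_pair_measure)
      note * = state_eq[OF this] sojourn_unique[OF this]
      show ?thesis
      proof (cases "\<exists>n. sojourn n (fst p) (snd p)")
        case True
        then obtain n where n: "sojourn n (fst p) (snd p)" by blast
        then have "m = n" if "sojourn m (fst p) (snd p)" for m
          using *(2)[of m "snd p" n] that unfolding sojourn_def by blast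
        moreover have "state (fst p) (snd p) = jump_state (fst p) n"
          using *(1) n unfolding sojourn_def by blast
        ultimately show ?thesis using n by metis
      next
        case False
        then have "state (fst p) (snd p) = None" by (auto simp: state_def sojourn_def)
        then show ?thesis using False by simp
      qed
    qed
    then show ?thesis unfolding vimage_def by blast
  qed
  also have "\<dots> \<in> sets ?M" using Z by measurable
  finally show "(\<lambda>p. state (fst p) (snd p)) -` Z \<inter> space ?M \<in> sets ?M" .
qed

lemma measurable_state_fixed [measurable]:
  "(\<lambda>\<omega>. state \<omega> s) \<in> measurable (trajectories X) (adjoin_point X)"
  using measurable_compose[OF measurable_Pair2' measurable_state, of s] by simp

section \<open>Policies as kernels\<close>

text \<open>
  The \<open>n\<close>-th state is the state before \<open>s\<close>, that is, \<open>s \<in> (t\<^sub>n, t\<^bsub>n+1\<^esub>]\<close>.  On this interval a policy acts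
  through its \<open>n\<close>-th transition probability.
\<close>

definition pre_sojourn :: "nat \<Rightarrow> 'x trajectory \<Rightarrow> real \<Rightarrow> bool" where
  "pre_sojourn n \<omega> s \<longleftrightarrow> jump_time \<omega> n < ereal s \<and> ereal s \<le> jump_time \<omega> (Suc n)"

lemma measurable_pos_reals_id [measurable (raw)]: "f \<in> measurable M pos_reals \<Longrightarrow> f \<in> borel_measurable M"
  by (rule measurable_compose[of _ _ pos_reals "\<lambda>x. x", simplified])
    (auto intro: measurable_restrict_space1)

lemma measurable_pre_sojourn [measurable]:
  "Measurable.pred (timed X) (\<lambda>p. pre_sojourn n (fst p) (snd p))"
  unfolding pre_sojourn_def by measurable

text \<open>
  A jointly measurable representation of the action distributions before the explosion.  The values
  of \<open>\<kappa>\<close> from the explosion on are irrelevant.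
\<close>

definition policy_kernel ::
    "'x measure \<Rightarrow> 'a measure \<Rightarrow> ('x trajectory \<Rightarrow> real \<Rightarrow> 'a option measure) \<Rightarrow>
     ('x trajectory \<times> real \<Rightarrow> 'a measure) \<Rightarrow> bool" where
  "policy_kernel X A \<pi> \<kappa> \<longleftrightarrow>
     \<kappa> \<in> measurable (timed X) (subprob_algebra A) \<and>
     (\<forall>\<omega> \<in> space (trajectories X). \<forall>s>0. ereal s < explosion_time \<omega> \<longrightarrow>
        \<pi> \<omega> s = distr (\<kappa> (\<omega>, s)) (adjoin_point A) Some)"

lemma piecewise_kernel:
  fixes K :: "nat \<Rightarrow> 'b \<Rightarrow> 'a measure"
  assumes S: "\<And>n. S n \<in> sets M"
    and disj: "\<And>m n p. p \<in> S m \<Longrightarrow> p \<in> S n \<Longrightarrow> m = n"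
    and K: "\<And>n. K n \<in> measurable (restrict_space M (S n)) (subprob_algebra A)"
    and ne: "space M \<noteq> {} \<Longrightarrow> space A \<noteq> {}"
  obtains \<kappa> where "\<kappa> \<in> measurable M (subprob_algebra A)"
    and "\<And>n p. p \<in> S n \<Longrightarrow> \<kappa> p = K n p"
proof -
  define \<kappa> where "\<kappa> p = (if \<exists>n. p \<in> S n then K (THE n. p \<in> S n) p else null_measure A)" for p
  have eq: "\<kappa> p = K n p" if "p \<in> S n" for n p
  proof -
    have "(THE n. p \<in> S n) = n" using disj that by blast
    then show ?thesis using that unfolding \<kappa>_def by auto
  qed
  have "\<kappa> \<in> measurable M (subprob_algebra A)"
  proof (rule measurable_piecewise_restrict)
    let ?C = "insert (space M - (\<Union>n. S n)) (range S)"
    show "countable ?C" by auto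
    show "space M \<subseteq> \<Union> ?C" by auto
    fix \<Omega> assume \<Omega>: "\<Omega> \<in> ?C"
    have "\<Omega> \<in> sets M" using \<Omega> S by auto
    then show "\<Omega> \<inter> space M \<in> sets M" by auto
    show "\<kappa> \<in> measurable (restrict_space M \<Omega>) (subprob_algebra A)"
    proof (cases "\<Omega> = space M - (\<Union>n. S n)")
      case True
      show ?thesis
      proof (cases "space M = {}")
        case True
        then show ?thesis by (auto simp: measurable_def space_restrict_space)
      next
        case False
        then have "(\<lambda>p. null_measure A) \<in> measurable (restrict_space M \<Omega>) (subprob_algebra A)"
          using ne by (intro measurable_const) simp
        then show ?thesis
          by (rule measurable_cong[THEN iffD1, rotated])
            (auto simp: \<kappa>_def True space_restrict_space)
      qed
    next
      case False
      then obtain n where n: "\<Omega> = S n" using \<Omega> by auto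
      show ?thesis unfolding n using K[of n]
        by (rule measurable_cong[THEN iffD1, rotated]) (auto simp: eq space_restrict_space)
    qed
  qed
  then show ?thesis using eq that by blast
qed

lemma pre_sojourn_unique:
  "\<omega> \<in> space (trajectories X) \<Longrightarrow> pre_sojourn m \<omega> s \<Longrightarrow> pre_sojourn n \<omega> s \<Longrightarrow> m = n"
  unfolding pre_sojourn_def using sojourn_before_unique[of \<omega> X m s n] by blast

lemma finite_jump_time_if_pre_sojourn:
  assumes "\<omega> \<in> space (trajectories X)" "pre_sojourn n \<omega> s" "i \<le> n"
  shows "jump_time \<omega> i < \<infinity>"
  using jump_time_mono[OF assms(1,3)] assms(2) by (auto simp: pre_sojourn_def)

text \<open>The set of the pairs for which the \<open>n\<close>-th state is the state before the given time.\<close>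

definition pre_sojourn_set :: "'x measure \<Rightarrow> nat \<Rightarrow> ('x trajectory \<times> real) set" where
  "pre_sojourn_set X n = {p \<in> space (timed X). pre_sojourn n (fst p) (snd p)}"

lemma pre_sojourn_set_sets: "pre_sojourn_set X n \<in> sets (timed X)"
  unfolding pre_sojourn_set_def by measurable

lemma measurable_history:
  "(\<lambda>p. (history n (fst p), snd p - rtime (fst p) n))
    \<in> measurable (restrict_space (timed X) (pre_sojourn_set X n))
        (histories X n \<Otimes>\<^sub>M pos_reals)" (is "_ \<in> measurable ?R _")
proof (rule measurable_Pair)
  have sp: "fst p \<in> space (trajectories X)" "pre_sojourn n (fst p) (snd p)" if "p \<in> space ?R" for p
    using that by (auto simp: space_restrict_space pre_sojourn_set_def space_pair_measure)
  have [measurable]: "fst \<in> measurable ?R (trajectories X)" "snd \<in> measurable ?R pos_reals"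
    by (intro measurable_restrict_space1; simp)+
  have fin: "jump_time (fst p) i < \<infinity>" if "p \<in> space ?R" "i \<le> n" for p i
    using finite_jump_time_if_pre_sojourn[OF sp[OF that(1)] that(2)] .
  show "(\<lambda>p. history n (fst p)) \<in> measurable ?R (histories X n)"
    unfolding history_def histories_def
  proof (rule measurable_Pair)
    show "(\<lambda>p. fst (fst p)) \<in> measurable ?R X" by measurable
    show "(\<lambda>p. \<lambda>i\<in>{..<n}. (rtime (fst p) (Suc i), the (jump_state (fst p) (Suc i))))
        \<in> measurable ?R (\<Pi>\<^sub>M i\<in>{..<n}. pos_reals \<Otimes>\<^sub>M X)"
    proof (rule measurable_restrict)
      fix i assume i: "i \<in> {..<n}"
      show "(\<lambda>p. (rtime (fst p) (Suc i), the (jump_state (fst p) (Suc i))))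
        \<in> measurable ?R (pos_reals \<Otimes>\<^sub>M X)"
      proof (rule measurable_Pair)
        show "(\<lambda>p. rtime (fst p) (Suc i)) \<in> measurable ?R pos_reals"
        proof (rule measurable_restrict_space2)
          show "(\<lambda>p. rtime (fst p) (Suc i)) \<in> borel_measurable ?R" by measurable
          show "(\<lambda>p. rtime (fst p) (Suc i)) \<in> space ?R \<rightarrow> {0<..}"
          proof
            fix p assume p: "p \<in> space ?R"
            have "0 < jump_time (fst p) (Suc i)" "jump_time (fst p) (Suc i) < \<infinity>"
              using jump_time_Suc_pos[OF sp(1)[OF p]] fin[OF p, of "Suc i"] i by auto
            then show "rtime (fst p) (Suc i) \<in> {0<..}"
              by (cases "jump_time (fst p) (Suc i)") auto
          qed
        qed
        have "(\<lambda>p. nth_state X (Suc i) (fst p)) \<in> measurable ?R X" by measurable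
        then show "(\<lambda>p. the (jump_state (fst p) (Suc i))) \<in> measurable ?R X"
        proof (rule measurable_cong[THEN iffD1, rotated])
          fix p assume p: "p \<in> space ?R"
          show "nth_state X (Suc i) (fst p) = the (jump_state (fst p) (Suc i))"
            using jump_state_nth_state[OF sp(1)[OF p] fin[OF p], of "Suc i"] i by (simp del: jump_state.simps)
        qed
      qed
    qed
  qed
  show "(\<lambda>p. snd p - rtime (fst p) n) \<in> measurable ?R pos_reals"
  proof (rule measurable_restrict_space2)
    show "(\<lambda>p. snd p - rtime (fst p) n) \<in> borel_measurable ?R" by measurable
    show "(\<lambda>p. snd p - rtime (fst p) n) \<in> space ?R \<rightarrow> {0<..}"
    proof
      fix p assume p: "p \<in> space ?R"
      have "jump_time (fst p) n < ereal (snd p)" "0 \<le> jump_time (fst p) n"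
        using sp(2)[OF p] jump_time_nonneg[OF sp(1)[OF p]] by (auto simp: pre_sojourn_def)
      then show "snd p - rtime (fst p) n \<in> {0<..}"
        by (cases "jump_time (fst p) n") auto
    qed
  qed
qed

context CTJMDP
begin

lemma space_A_not_empty: "space X \<noteq> {} \<Longrightarrow> space A \<noteq> {}"
  using Act_subset Act_nonempty by blast

lemma space_A_not_empty_trajectories: "space (timed X) \<noteq> {} \<Longrightarrow> space A \<noteq> {}"
  by (rule space_A_not_empty) (auto simp: space_pair_measure dest: space_trajectories_not_empty)

lemma policy_kernel_exists:
  assumes "policy X A Act \<pi>"
  obtains \<kappa> where "policy_kernel X A \<pi> \<kappa>"
proof -
  obtain K where K: "\<And>n. K n \<in> measurable (histories X n \<Otimes>\<^sub>M pos_reals) (prob_algebra A)"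
    and \<pi>: "\<And>\<omega> t n. \<lbrakk>\<omega> \<in> space (trajectories X); t > 0;
           jump_time \<omega> n < ereal t; ereal t \<le> jump_time \<omega> (Suc n); ereal t < explosion_time \<omega>\<rbrakk> \<Longrightarrow>
           \<pi> \<omega> t = distr (K n (history n \<omega>, t - rtime \<omega> n)) (adjoin_point A) Some"
    using assms unfolding policy_def by metis
  obtain \<kappa> where \<kappa>: "\<kappa> \<in> measurable (timed X) (subprob_algebra A)"
    "\<And>n p. p \<in> pre_sojourn_set X n \<Longrightarrow>
      \<kappa> p = K n (history n (fst p), snd p - rtime (fst p) n)"
  proof (rule piecewise_kernel[OF pre_sojourn_set_sets _ _ space_A_not_empty_trajectories])
    show "m = n" if "p \<in> pre_sojourn_set X m" "p \<in> pre_sojourn_set X n" for m n and p :: "'x trajectory \<times> real"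
      using that pre_sojourn_unique[of "fst p" X m "snd p" n]
      by (auto simp: pre_sojourn_set_def space_pair_measure)
    show "(\<lambda>p. K n (history n (fst p), snd p - rtime (fst p) n))
        \<in> measurable (restrict_space (timed X) (pre_sojourn_set X n)) (subprob_algebra A)" for n
      using measurable_compose[OF measurable_history measurable_prob_algebraD[OF K]] .
  qed (assumption, rule that)
  have "\<pi> \<omega> s = distr (\<kappa> (\<omega>, s)) (adjoin_point A) Some"
    if \<omega>: "\<omega> \<in> space (trajectories X)" and s: "s > 0" "ereal s < explosion_time \<omega>" for \<omega> s
  proof -
    obtain n where n: "jump_time \<omega> n < ereal s" "ereal s \<le> jump_time \<omega> (Suc n)"
      using sojourn_before_exists[OF \<omega> s] by blast
    then have "(\<omega>, s) \<in> pre_sojourn_set X n"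
      using \<omega> s by (auto simp: pre_sojourn_set_def pre_sojourn_def space_pair_measure space_restrict_space)
    then show ?thesis using \<kappa>(2) \<pi>[OF \<omega> s(1) n s(2)] by simp
  qed
  then show ?thesis using \<kappa>(1) that unfolding policy_kernel_def by blast
qed

lemma markov_policy_kernel_exists:
  assumes "markov_policy X A Act \<phi> \<phi>'"
  obtains \<kappa> where "policy_kernel X A \<phi> \<kappa>"
    "\<And>\<omega> s n. \<omega> \<in> space (trajectories X) \<Longrightarrow> 0 < s \<Longrightarrow> pre_sojourn n \<omega> s \<Longrightarrow> \<kappa> (\<omega>, s) = \<phi>' (nth_state X n \<omega>, s)"
proof -
  have \<phi>': "\<phi>' \<in> measurable (X \<Otimes>\<^sub>M pos_reals) (prob_algebra A)"
    and \<phi>: "\<And>\<omega> t. \<lbrakk>\<omega> \<in> space (trajectories X); t > 0; ereal t < explosion_time \<omega>\<rbrakk> \<Longrightarrow>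
        \<phi> \<omega> t = distr (\<phi>' (the (state_before \<omega> t), t)) (adjoin_point A) Some"
    using assms unfolding markov_policy_def by auto
  obtain \<kappa> where \<kappa>: "\<kappa> \<in> measurable (timed X) (subprob_algebra A)"
    "\<And>n p. p \<in> pre_sojourn_set X n \<Longrightarrow> \<kappa> p = \<phi>' (nth_state X n (fst p), snd p)"
  proof (rule piecewise_kernel[OF pre_sojourn_set_sets _ _ space_A_not_empty_trajectories])
    show "m = n" if "p \<in> pre_sojourn_set X m" "p \<in> pre_sojourn_set X n" for m n and p :: "'x trajectory \<times> real"
      using that pre_sojourn_unique[of "fst p" X m "snd p" n]
      by (auto simp: pre_sojourn_set_def space_pair_measure)
    show "(\<lambda>p. \<phi>' (nth_state X n (fst p), snd p))
        \<in> measurable (restrict_space (timed X) (pre_sojourn_set X n)) (subprob_algebra A)" for n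
      by (intro measurable_restrict_space1 measurable_compose[OF _ measurable_prob_algebraD[OF \<phi>']]) measurable
  qed (assumption, rule that)
  have *: "(\<omega>, s) \<in> pre_sojourn_set X n"
    if "\<omega> \<in> space (trajectories X)" "s > 0" "pre_sojourn n \<omega> s" for \<omega> s n
    using that by (auto simp: pre_sojourn_set_def space_pair_measure space_restrict_space)
  have "\<phi> \<omega> s = distr (\<kappa> (\<omega>, s)) (adjoin_point A) Some"
    if \<omega>: "\<omega> \<in> space (trajectories X)" and s: "s > 0" "ereal s < explosion_time \<omega>" for \<omega> s
  proof -
    obtain n where n: "jump_time \<omega> n < ereal s" "ereal s \<le> jump_time \<omega> (Suc n)"
      using sojourn_before_exists[OF \<omega> s] by blast
    then have ps: "pre_sojourn n \<omega> s" by (simp add: pre_sojourn_def)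
    have "the (state_before \<omega> s) = nth_state X n \<omega>"
      using state_before_eq[OF \<omega> n] jump_state_nth_state[OF \<omega> finite_jump_time_if_pre_sojourn[OF \<omega> ps order_refl]] by simp
    then show ?thesis using \<kappa>(2)[OF *[OF \<omega> s(1) ps]] \<phi>[OF \<omega> s] by simp
  qed
  moreover have "\<kappa> (\<omega>, s) = \<phi>' (nth_state X n \<omega>, s)"
    if "\<omega> \<in> space (trajectories X)" "0 < s" "pre_sojourn n \<omega> s" for \<omega> s n
    using \<kappa>(2)[OF *[OF that]] by simp
  ultimately show ?thesis using \<kappa>(1) that unfolding policy_kernel_def by blast
qed

text \<open>The integral of \<open>f\<close> against the jump intensity from \<open>z\<close> averaged over actions.\<close>

definition intens :: "'a measure \<Rightarrow> 'x \<Rightarrow> ('x \<Rightarrow> ennreal) \<Rightarrow> ennreal" where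
  "intens k z f = (\<integral>\<^sup>+a. \<integral>\<^sup>+y. f y \<partial>jump_kernel z a \<partial>k)"

text \<open>The integrand may depend on the time \<open>s\<close> and on the state \<open>z\<close> before the jump.\<close>

abbreviation intens_at :: "'a measure \<Rightarrow> real \<Rightarrow> ((real \<times> 'x) \<times> 'x \<Rightarrow> ennreal) \<Rightarrow> 'x \<Rightarrow> ennreal" where
  "intens_at k s f z \<equiv> intens k z (\<lambda>y. f ((s, z), y))"

lemma measurable_intens:
  assumes f: "(\<lambda>(m, y). f m y) \<in> borel_measurable (M \<Otimes>\<^sub>M X)"
    and K: "K \<in> measurable M (subprob_algebra A)" and g: "g \<in> measurable M X"
  shows "(\<lambda>m. intens (K m) (g m) (f m)) \<in> borel_measurable M"
  unfolding intens_def
proof (rule nn_integral_measurable_subprob_algebra2[OF _ K])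
  have "(\<lambda>p. \<integral>\<^sup>+y. f (fst p) y \<partial>jump_kernel (g (fst p)) (snd p)) \<in> borel_measurable (M \<Otimes>\<^sub>M A)"
  proof (rule measurable_nn_integral_jump_kernel)
    have "(\<lambda>p. (\<lambda>(m, y). f m y) (fst (fst p), snd p)) \<in> borel_measurable ((M \<Otimes>\<^sub>M A) \<Otimes>\<^sub>M X)"
      by (rule measurable_compose[OF _ f]) measurable
    then show "(\<lambda>(m, y). f (fst m) y) \<in> borel_measurable ((M \<Otimes>\<^sub>M A) \<Otimes>\<^sub>M X)"
      by (simp add: case_prod_beta')
    show "(\<lambda>p. g (fst p)) \<in> measurable (M \<Otimes>\<^sub>M A) X" using g by measurable
  qed simp
  then show "(\<lambda>(m, a). \<integral>\<^sup>+y. f m y \<partial>jump_kernel (g m) a) \<in> borel_measurable (M \<Otimes>\<^sub>M A)"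
    by (simp add: case_prod_beta')
qed

lemma measurable_intens_inner:
  assumes "f \<in> borel_measurable X" "z \<in> space X" "sets k = sets A"
  shows "(\<lambda>a. \<integral>\<^sup>+y. f y \<partial>jump_kernel z a) \<in> borel_measurable k"
proof -
  have "(\<lambda>a. \<integral>\<^sup>+y. f y \<partial>jump_kernel z a) \<in> borel_measurable A"
    using assms by (intro measurable_nn_integral_jump_kernel) (auto simp: case_prod_beta')
  then show ?thesis using assms(3) by (simp cong: measurable_cong_sets)
qed

lemma intens_cong: "(\<And>y. y \<in> space X \<Longrightarrow> f y = g y) \<Longrightarrow> intens k z f = intens k z g"
  unfolding intens_def by (intro nn_integral_cong) simp

lemma intens_mono: "(\<And>y. y \<in> space X \<Longrightarrow> f y \<le> g y) \<Longrightarrow> intens k z f \<le> intens k z g"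
  unfolding intens_def by (intro nn_integral_mono) simp

lemma intens_cmult:
  assumes "f \<in> borel_measurable X" "z \<in> space X" "sets k = sets A"
  shows "intens k z (\<lambda>y. c * f y) = c * intens k z f"
proof -
  have "(\<integral>\<^sup>+y. c * f y \<partial>jump_kernel z a) = c * (\<integral>\<^sup>+y. f y \<partial>jump_kernel z a)" for a
    using assms by (intro nn_integral_cmult) simp
  then show ?thesis unfolding intens_def using measurable_intens_inner[OF assms]
    by (simp add: nn_integral_cmult)
qed

lemma intens_add:
  assumes "f \<in> borel_measurable X" "g \<in> borel_measurable X" "z \<in> space X" "sets k = sets A"
  shows "intens k z (\<lambda>y. f y + g y) = intens k z f + intens k z g"
proof -
  have "(\<integral>\<^sup>+y. f y + g y \<partial>jump_kernel z a) = (\<integral>\<^sup>+y. f y \<partial>jump_kernel z a) + (\<integral>\<^sup>+y. g y \<partial>jump_kernel z a)" for a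
    using assms by (intro nn_integral_add) auto
  then show ?thesis unfolding intens_def
    using measurable_intens_inner[OF assms(1,3,4)] measurable_intens_inner[OF assms(2,3,4)]
    by (simp add: nn_integral_add)
qed

lemma intens_SUP:
  assumes f: "\<And>i. f i \<in> borel_measurable X" and inc: "incseq f" and z: "z \<in> space X" and k: "sets k = sets A"
  shows "intens k z (\<lambda>y. SUP i. f i y) = (SUP i. intens k z (f i))"
proof -
  have "(\<integral>\<^sup>+y. (SUP i. f i y) \<partial>jump_kernel z a) = (SUP i. \<integral>\<^sup>+y. f i y \<partial>jump_kernel z a)" for a
    using f inc by (intro nn_integral_monotone_convergence_SUP) auto
  moreover have "(\<integral>\<^sup>+a. (SUP i. \<integral>\<^sup>+y. f i y \<partial>jump_kernel z a) \<partial>k) = (SUP i. \<integral>\<^sup>+a. \<integral>\<^sup>+y. f i y \<partial>jump_kernel z a \<partial>k)"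
    using inc f z k by (intro nn_integral_monotone_convergence_SUP measurable_intens_inner)
      (auto simp: incseq_def le_fun_def intro!: nn_integral_mono)
  ultimately show ?thesis unfolding intens_def by simp
qed

lemma intens_indicator: "D \<in> sets X \<Longrightarrow> intens k z (indicator D) = (\<integral>\<^sup>+a. emeasure (jump_kernel z a) D \<partial>k)"
  unfolding intens_def by simp

lemma intens_suminf:
  assumes f: "\<And>i. f i \<in> borel_measurable X" and z: "z \<in> space X" and k: "sets k = sets A"
  shows "intens k z (\<lambda>y. \<Sum>i. f i y) = (\<Sum>i. intens k z (f i))"
proof -
  have "(\<integral>\<^sup>+y. (\<Sum>i. f i y) \<partial>jump_kernel z a) = (\<Sum>i. \<integral>\<^sup>+y. f i y \<partial>jump_kernel z a)" for a
    using f by (intro nn_integral_suminf) auto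
  then show ?thesis unfolding intens_def
    using measurable_intens_inner[OF f z k] by (simp add: nn_integral_suminf)
qed

lemma action_mean_distr:
  assumes f: "(\<lambda>a. f (Some z, Some a) * indicator (Act z) a) \<in> borel_measurable A"
    and k: "sets k = sets A"
  shows "action_mean Act f (Some z) (distr k (adjoin_point A) Some) =
    (\<integral>\<^sup>+a. f (Some z, Some a) * indicator (Act z) a \<partial>k)"
proof -
  have 1: "indicator (Some ` Act z) (Some a) = (indicator (Act z) a :: ennreal)" for a
    by (auto simp: indicator_def)
  have 2: "(\<lambda>a. f (Some z, a) * indicator (Some ` Act z) a) \<in> borel_measurable (adjoin_point A)"
    using f by (intro measurable_from_adjoin_point) (auto simp: 1)
  have 3: "Some \<in> measurable k (adjoin_point A)"
    using measurable_Some_adjoin_point[of A] k by (simp cong: measurable_cong_sets)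
  show ?thesis
    unfolding action_mean_def actions.simps by (simp add: nn_integral_distr[OF 3] 2 1)
qed

text \<open>
  The set \<open>Z - {z}\<close> in the intensity and the restriction to available actions are absorbed by \<open>jump_kernel\<close>.
\<close>

lemma action_mean_jump:
  assumes z: "z \<in> space X" and k: "sets k = sets A" and D: "D \<in> sets X"
  shows "action_mean Act (\<lambda>(_, a). ennreal (q z (the a) (D - {z}))) (Some z) (distr k (adjoin_point A) Some)
    = intens k z (indicator D)"
proof -
  have eq: "ennreal (q z a (D - {z})) * indicator (Act z) a = emeasure (jump_kernel z a) D" for a
    by (simp add: emeasure_jump_kernel z D indicator_def)
  have "(\<lambda>a. emeasure (jump_kernel z a) D) \<in> borel_measurable A"
    using measurable_compose[OF measurable_Pair1'[OF z] measurable_emeasure_jump_kernel[OF D]] by simp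
  then show ?thesis
    using action_mean_distr[of "\<lambda>(_, a). ennreal (q z (the a) (D - {z}))" z k] k
    by (simp add: eq intens_indicator D)
qed

end

section \<open>Predictable processes\<close>

lemma space_state_filtration [simp]: "space (state_filtration X t) = space (trajectories X)"
  unfolding state_filtration_def by (rule space_measure_of) blast

lemma sets_state_filtration:
  "sets (state_filtration X t) = sigma_sets (space (trajectories X))
     {(\<lambda>\<omega>. state \<omega> s) -` Z \<inter> space (trajectories X) |s Z.
          0 \<le> s \<and> s \<le> t \<and> Z \<in> sets (adjoin_point X)}"
  unfolding state_filtration_def by (rule sets_measure_of) blast

lemma measurable_state_filtration:
  assumes "0 \<le> s" "s \<le> t"
  shows "(\<lambda>\<omega>. state \<omega> s) \<in> measurable (state_filtration X t) (adjoin_point X)"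
proof (rule measurableI)
  show "state \<omega> s \<in> space (adjoin_point X)" if "\<omega> \<in> space (state_filtration X t)" for \<omega>
    using measurable_space[OF measurable_state_fixed] that by simp
  fix Z assume "Z \<in> sets (adjoin_point X)"
  then show "(\<lambda>\<omega>. state \<omega> s) -` Z \<inter> space (state_filtration X t) \<in> sets (state_filtration X t)"
    unfolding sets_state_filtration using assms by auto
qed

lemma state_filtration_mono:
  assumes "s \<le> t" "F \<in> sets (state_filtration X s)"
  shows "F \<in> sets (state_filtration X t)"
proof -
  have "sets (state_filtration X s) \<subseteq> sets (state_filtration X t)"
    unfolding sets_state_filtration using assms(1) by (intro sigma_sets_mono') force
  then show ?thesis using assms(2) by blast
qed

lemma predictable_generators:
  "{F \<times> {s<..t} |F s t. 0 \<le> s \<and> s < t \<and> F \<in> sets (state_filtration X s)}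
    \<subseteq> Pow (space (trajectories X) \<times> {0<..})"
proof -
  have "F \<subseteq> space (trajectories X)" if "F \<in> sets (state_filtration X s)" for F s
    using sets.sets_into_space[OF that] by simp
  then show ?thesis by fastforce
qed

lemma space_predictable_sets [simp]: "space (predictable_sets X) = space (trajectories X) \<times> {0<..}"
  unfolding predictable_sets_def using predictable_generators by (rule space_measure_of)

lemma sets_predictable_sets:
  "sets (predictable_sets X) = sigma_sets (space (trajectories X) \<times> {0<..})
     {F \<times> {s<..t} |F s t. 0 \<le> s \<and> s < t \<and> F \<in> sets (state_filtration X s)}"
  unfolding predictable_sets_def using predictable_generators by (rule sets_measure_of)

lemma predictable_rectangle:
  "0 \<le> s \<Longrightarrow> s < t \<Longrightarrow> F \<in> sets (state_filtration X s) \<Longrightarrow> F \<times> {s<..t} \<in> sets (predictable_sets X)"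
  unfolding sets_predictable_sets by (rule sigma_sets.Basic) blast

lemma predictable_rectangle_unbounded:
  assumes "0 \<le> s" "F \<in> sets (state_filtration X s)"
  shows "F \<times> {s<..} \<in> sets (predictable_sets X)"
proof -
  have "F \<times> {s<..} = (\<Union>k::nat. F \<times> {s<..s + real (Suc k)})"
  proof (intro equalityI subsetI)
    fix p assume p: "p \<in> F \<times> {s<..}"
    obtain k where "snd p - s < real k" using reals_Archimedean2 by blast
    then show "p \<in> (\<Union>k::nat. F \<times> {s<..s + real (Suc k)})" using p by (auto intro!: exI[of _ k])
  qed auto
  also have "\<dots> \<in> sets (predictable_sets X)"
    using assms by (intro sets.countable_UN) (auto intro!: predictable_rectangle)
  finally show ?thesis .
qed

lemma measurable_Pair_predictable:
  assumes "\<omega> \<in> space (trajectories X)"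
  shows "Pair \<omega> \<in> measurable pos_reals (predictable_sets X)"
  unfolding predictable_sets_def
proof (rule measurable_measure_of[OF predictable_generators])
  show "Pair \<omega> \<in> space pos_reals \<rightarrow> space (trajectories X) \<times> {0<..}"
    using assms by (auto simp: space_restrict_space)
  fix Y assume "Y \<in> {F \<times> {s<..t} |F s t. 0 \<le> s \<and> s < t \<and> F \<in> sets (state_filtration X s)}"
  then obtain F and s t :: real where Y: "Y = F \<times> {s<..t}" by blast
  have "Pair \<omega> -` Y \<inter> space pos_reals = (if \<omega> \<in> F then {s<..t} \<inter> {0<..} else {})"
    by (auto simp: Y space_restrict_space)
  then show "Pair \<omega> -` Y \<inter> space pos_reals \<in> sets pos_reals"
    by (auto simp: sets_restrict_space)
qed

lemma measurable_snd_predictable: "snd \<in> measurable (predictable_sets X) pos_reals"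
proof (rule measurable_restrict_space2)
  show "snd \<in> space (predictable_sets X) \<rightarrow> {0<..}" by auto
  show "snd \<in> borel_measurable (predictable_sets X)"
  proof (rule borel_measurableI_le)
    fix a :: real
    have "{p \<in> space (predictable_sets X). snd p \<le> a} =
        (if 0 < a then space (trajectories X) \<times> {0<..a} else {})" by auto
    also have "\<dots> \<in> sets (predictable_sets X)"
      using predictable_rectangle[of 0 a "space (trajectories X)" X] sets.top[of "state_filtration X 0"] by auto
    finally show "{p \<in> space (predictable_sets X). snd p \<le> a} \<in> sets (predictable_sets X)" .
  qed
qed

text \<open>
  The largest multiple of \<open>1 / (n + 1)\<close> strictly before \<open>s\<close>.  Sampling the state there gives
  predictable processes that converge to the state before \<open>s\<close>.
\<close>

definition grid :: "nat \<Rightarrow> real \<Rightarrow> real" where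
  "grid n s = real_of_int (\<lceil>real (Suc n) * s\<rceil> - 1) / real (Suc n)"

lemma grid_less: "grid n s < s"
proof -
  have "real_of_int (\<lceil>real (Suc n) * s\<rceil> - 1) < s * real (Suc n)"
    using ceiling_correct[of "real (Suc n) * s"] by (simp add: mult.commute)
  then show ?thesis unfolding grid_def by (subst divide_less_eq) simp
qed

lemma grid_ge: "s - 1 / real (Suc n) \<le> grid n s"
proof -
  have "(real (Suc n) * s - 1) / real (Suc n) \<le> grid n s"
    unfolding grid_def by (intro divide_right_mono) auto
  moreover have "(real (Suc n) * s - 1) / real (Suc n) = s - 1 / real (Suc n)"
    by (simp add: diff_divide_distrib)
  ultimately show ?thesis by simp
qed

lemma grid_eq_iff:
  "grid n s = real k / real (Suc n) \<longleftrightarrow> real k / real (Suc n) < s \<and> s \<le> real (Suc k) / real (Suc n)"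
proof -
  have "grid n s = real k / real (Suc n) \<longleftrightarrow> real_of_int (\<lceil>real (Suc n) * s\<rceil> - 1) = real k"
    unfolding grid_def by (simp del: of_nat_Suc of_int_diff)
  also have "\<dots> \<longleftrightarrow> \<lceil>real (Suc n) * s\<rceil> = int k + 1" by linarith
  also have "\<dots> \<longleftrightarrow> real k < real (Suc n) * s \<and> real (Suc n) * s \<le> real (Suc k)"
    by (simp add: ceiling_eq_iff add.commute)
  finally show ?thesis by (simp add: divide_less_eq le_divide_eq mult.commute del: of_nat_Suc)
qed

lemma grid_nonneg_form:
  assumes "0 < s"
  obtains k where "grid n s = real k / real (Suc n)"
proof -
  have "0 < real (Suc n) * s" using assms by simp
  then have "0 \<le> \<lceil>real (Suc n) * s\<rceil> - 1" by linarith
  then obtain k where "\<lceil>real (Suc n) * s\<rceil> - 1 = int k" using nonneg_int_cases by blast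
  then show ?thesis using that[of k] unfolding grid_def by simp
qed

lemma measurable_state_grid:
  "(\<lambda>p. state (fst p) (grid n (snd p))) \<in> measurable (predictable_sets X) (adjoin_point X)"
proof (rule measurableI)
  show "state (fst p) (grid n (snd p)) \<in> space (adjoin_point X)" if "p \<in> space (predictable_sets X)" for p
    using measurable_space[OF measurable_state_fixed, of "fst p" X] that
    by (auto simp del: space_adjoin_point)
  fix Z assume Z: "Z \<in> sets (adjoin_point X)"
  let ?t = "\<lambda>k. real k / real (Suc n)"
  let ?F = "\<lambda>k. (\<lambda>\<omega>. state \<omega> (?t k)) -` Z \<inter> space (trajectories X)"
  have "(\<lambda>p. state (fst p) (grid n (snd p))) -` Z \<inter> space (predictable_sets X) =
      (\<Union>k. ?F k \<times> {?t k<..?t (Suc k)})"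
  proof (intro equalityI subsetI)
    fix p assume p: "p \<in> (\<lambda>p. state (fst p) (grid n (snd p))) -` Z \<inter> space (predictable_sets X)"
    then have "0 < snd p" by auto
    then obtain k where k: "grid n (snd p) = ?t k" using grid_nonneg_form by blast
    then have "?t k < snd p" "snd p \<le> ?t (Suc k)" using grid_eq_iff[of n "snd p" k] by auto
    then show "p \<in> (\<Union>k. ?F k \<times> {?t k<..?t (Suc k)})" using p k by (cases p) auto
  next
    fix p assume "p \<in> (\<Union>k. ?F k \<times> {?t k<..?t (Suc k)})"
    then obtain k where k: "fst p \<in> ?F k" "?t k < snd p" "snd p \<le> ?t (Suc k)" by auto
    have "0 \<le> ?t k" by simp
    then have "0 < snd p" using k(2) by linarith
    moreover have "grid n (snd p) = ?t k" using grid_eq_iff k by blast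
    ultimately show "p \<in> (\<lambda>p. state (fst p) (grid n (snd p))) -` Z \<inter> space (predictable_sets X)"
      using k by (cases p) auto
  qed
  also have "\<dots> \<in> sets (predictable_sets X)"
  proof (intro sets.countable_UN image_subsetI)
    fix k
    have "?F k \<in> sets (state_filtration X (?t k))"
      using measurable_sets[OF measurable_state_filtration[of "?t k" "?t k"] Z] by simp
    then show "?F k \<times> {?t k<..?t (Suc k)} \<in> sets (predictable_sets X)"
      by (intro predictable_rectangle divide_strict_right_mono) auto
  qed
  finally show "(\<lambda>p. state (fst p) (grid n (snd p))) -` Z \<inter> space (predictable_sets X)
      \<in> sets (predictable_sets X)" .
qed

lemma state_grid_eventually:
  assumes \<omega>: "\<omega> \<in> space (trajectories X)" and m: "pre_sojourn m \<omega> s"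
  shows "\<forall>\<^sub>F n in sequentially. state \<omega> (grid n s) = Some (nth_state X m \<omega>)"
proof -
  have "0 \<le> jump_time \<omega> m" "jump_time \<omega> m < ereal s"
    using jump_time_nonneg[OF \<omega>] m by (auto simp: pre_sojourn_def)
  then obtain r where r: "jump_time \<omega> m = ereal r" "r < s"
    by (cases "jump_time \<omega> m") auto
  have "(\<lambda>n. s - 1 / real (Suc n)) \<longlonglongrightarrow> s - 0"
    by (intro tendsto_intros LIMSEQ_inverse_real_of_nat[unfolded inverse_eq_divide])
  then have "\<forall>\<^sub>F n in sequentially. r < s - 1 / real (Suc n)"
    using r(2) by (intro order_tendstoD(1)) auto
  then show ?thesis
  proof (rule eventually_mono)
    fix n assume "r < s - 1 / real (Suc n)"
    then have "r \<le> grid n s" using grid_ge[of s n] by linarith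
    moreover have "ereal (grid n s) < jump_time \<omega> (Suc m)"
      using grid_less[of n s] m less_le_trans[of "ereal (grid n s)" "ereal s"] by (auto simp: pre_sojourn_def)
    ultimately have "sojourn m \<omega> (grid n s)" unfolding sojourn_def r(1) by auto
    then show "state \<omega> (grid n s) = Some (nth_state X m \<omega>)" by (rule state_sojourn[OF \<omega>])
  qed
qed

text \<open>
  A predictable version of \<open>f ((s, \<xi>\<^bsub>s-\<^esub>), x)\<close>.  The state before \<open>s\<close> itself is not predictable at an
  explosion that is approached by jumps without change of state; there the limit below may differ.
\<close>

definition prev_val :: "((real \<times> 'x) \<times> 'x \<Rightarrow> ennreal) \<Rightarrow> ('x trajectory \<times> real) \<times> 'x \<Rightarrow> ennreal" where
  "prev_val f p = liminf (\<lambda>n. case state (fst (fst p)) (grid n (snd (fst p))) of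
     None \<Rightarrow> 0 | Some z \<Rightarrow> f ((snd (fst p), z), snd p))"

lemma measurable_prev_val:
  assumes f: "f \<in> borel_measurable (jumps X)" and ne: "space X \<noteq> {}"
  shows "prev_val f \<in> borel_measurable (predictable_sets X \<Otimes>\<^sub>M X)"
  unfolding prev_val_def
proof (rule borel_measurable_liminf)
  fix n
  note [measurable] = measurable_state_grid measurable_snd_predictable f
  show "(\<lambda>p. case state (fst (fst p)) (grid n (snd (fst p))) of
     None \<Rightarrow> 0 | Some z \<Rightarrow> f ((snd (fst p), z), snd p)) \<in> borel_measurable (predictable_sets X \<Otimes>\<^sub>M X)"
  proof (rule borel_measurable_case_option_adjoin[OF ne])
    show "(\<lambda>(p, z). f ((snd (fst p), z), snd p)) \<in> borel_measurable ((predictable_sets X \<Otimes>\<^sub>M X) \<Otimes>\<^sub>M X)"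
      unfolding case_prod_beta' by measurable
    show "(\<lambda>p. state (fst (fst p)) (grid n (snd (fst p)))) \<in> measurable (predictable_sets X \<Otimes>\<^sub>M X) (adjoin_point X)"
      using measurable_compose[OF measurable_fst measurable_state_grid] .
  qed
qed

lemma prev_val_eq:
  assumes "\<omega> \<in> space (trajectories X)" "pre_sojourn m \<omega> s"
  shows "prev_val f ((\<omega>, s), x) = f ((s, nth_state X m \<omega>), x)"
proof -
  have "\<forall>\<^sub>F n in sequentially. (case state \<omega> (grid n s) of None \<Rightarrow> 0 | Some z \<Rightarrow> f ((s, z), x)) = f ((s, nth_state X m \<omega>), x)"
    using state_grid_eventually[OF assms] by (rule eventually_mono) simp
  then have "(\<lambda>n. case state \<omega> (grid n s) of None \<Rightarrow> 0 | Some z \<Rightarrow> f ((s, z), x)) \<longlonglongrightarrow> f ((s, nth_state X m \<omega>), x)"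
    by (rule tendsto_eventually)
  then have "liminf (\<lambda>n. case state \<omega> (grid n s) of None \<Rightarrow> 0 | Some z \<Rightarrow> f ((s, z), x)) = f ((s, nth_state X m \<omega>), x)"
    by (rule lim_imp_Liminf[OF trivial_limit_sequentially])
  then show ?thesis unfolding prev_val_def fst_conv snd_conv .
qed

text \<open>
  The predictable event that at least \<open>n\<close> changes of the state are visible before \<open>s\<close>.
\<close>

primrec changes :: "nat \<Rightarrow> 'x trajectory \<Rightarrow> real \<Rightarrow> bool" where
  "changes 0 \<omega> s \<longleftrightarrow> True"
| "changes (Suc n) \<omega> s \<longleftrightarrow> (\<exists>r\<in>\<rat>. \<exists>r'\<in>\<rat>. 0 \<le> r \<and> r < r' \<and> r' < s \<and> changes n \<omega> r \<and> state \<omega> r \<noteq> state \<omega> r')"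

lemma change_measurable:
  assumes X: "standard_borel X" and r: "0 \<le> r" "r < r'"
    and F: "{\<omega> \<in> space (trajectories X). changes n \<omega> r} \<in> sets (state_filtration X r)"
  shows "{\<omega> \<in> space (trajectories X). changes n \<omega> r \<and> state \<omega> r \<noteq> state \<omega> r'} \<in> sets (state_filtration X r')"
    (is "?C \<in> _")
proof -
  have "{\<omega> \<in> space (state_filtration X r'). state \<omega> r = state \<omega> r'} \<in> sets (state_filtration X r')" (is "?E \<in> _")
    using r by (intro measurable_eq_adjoin_point[OF X] measurable_state_filtration) auto
  from sets.Diff[OF state_filtration_mono[OF less_imp_le[OF r(2)] F] this]
  have "{\<omega> \<in> space (trajectories X). changes n \<omega> r} - ?E \<in> sets (state_filtration X r')" .
  also have "{\<omega> \<in> space (trajectories X). changes n \<omega> r} - ?E = ?C" by auto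
  finally show ?thesis .
qed

lemma countable_rational_pairs: "countable {(r :: real, r'). r \<in> \<rat> \<and> r' \<in> \<rat> \<and> P r r'}"
  by (rule countable_subset[of _ "\<rat> \<times> \<rat>"]) (auto intro: countable_SIGMA countable_rat)

lemma changes_measurable:
  assumes X: "standard_borel X"
  shows "{\<omega> \<in> space (trajectories X). changes n \<omega> t} \<in> sets (state_filtration X t)"
proof (induction n arbitrary: t)
  case 0
  then show ?case using sets.top[of "state_filtration X t"] by simp
next
  case (Suc n)
  let ?I = "{(r :: real, r'). r \<in> \<rat> \<and> r' \<in> \<rat> \<and> (0 \<le> r \<and> r < r' \<and> r' < t)}"
  let ?F = "\<lambda>r r'. {\<omega> \<in> space (trajectories X). changes n \<omega> r \<and> state \<omega> r \<noteq> state \<omega> r'}"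
  have "{\<omega> \<in> space (trajectories X). changes (Suc n) \<omega> t} = (\<Union>(r, r')\<in>?I. ?F r r')" by auto
  also have "\<dots> \<in> sets (state_filtration X t)"
  proof (rule sets.countable_UN''[OF countable_rational_pairs])
    fix p assume "p \<in> ?I"
    then obtain r r' where p: "p = (r, r')" "0 \<le> r" "r < r'" "r' < t" by auto
    show "(case p of (r, r') \<Rightarrow> ?F r r') \<in> sets (state_filtration X t)"
      using state_filtration_mono[OF less_imp_le[OF p(4)] change_measurable[OF X p(2,3) Suc]] by (simp add: p(1))
  qed
  finally show ?case .
qed

lemma changes_predictable:
  assumes X: "standard_borel X"
  shows "{p \<in> space (predictable_sets X). changes n (fst p) (snd p)} \<in> sets (predictable_sets X)"
proof (cases n)
  case 0
  then show ?thesis using sets.top[of "predictable_sets X"] by simp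
next
  case (Suc m)
  let ?I = "{(r :: real, r'). r \<in> \<rat> \<and> r' \<in> \<rat> \<and> (0 \<le> r \<and> r < r')}"
  let ?F = "\<lambda>r r'. {\<omega> \<in> space (trajectories X). changes m \<omega> r \<and> state \<omega> r \<noteq> state \<omega> r'}"
  have "{p \<in> space (predictable_sets X). changes n (fst p) (snd p)} = (\<Union>(r, r')\<in>?I. ?F r r' \<times> {r'<..})"
    by (fastforce simp: Suc)
  also have "\<dots> \<in> sets (predictable_sets X)"
  proof (rule sets.countable_UN''[OF countable_rational_pairs])
    fix p assume "p \<in> ?I"
    then obtain r r' where p: "p = (r, r')" "0 \<le> r" "r < r'" by auto
    show "(case p of (r, r') \<Rightarrow> ?F r r' \<times> {r'<..}) \<in> sets (predictable_sets X)"
      using predictable_rectangle_unbounded[OF _ change_measurable[OF X p(2,3) changes_measurable[OF X]]] p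
      by simp
  qed
  finally show ?thesis .
qed

lemma changes_imp_jump_time_le:
  assumes \<omega>: "\<omega> \<in> space (trajectories X)"
  shows "0 \<le> s \<Longrightarrow> changes n \<omega> s \<Longrightarrow> jump_time \<omega> n \<le> ereal s \<and> (0 < n \<longrightarrow> jump_time \<omega> n < ereal s)"
proof (induction n arbitrary: s)
  case (Suc n)
  then obtain r r' where r: "0 \<le> r" "r < r'" "r' < s" "changes n \<omega> r" "state \<omega> r \<noteq> state \<omega> r'" by auto
  then have t: "jump_time \<omega> n \<le> ereal r" using Suc by blast
  have "jump_time \<omega> (Suc n) < ereal s"
  proof (rule ccontr)
    assume "\<not> jump_time \<omega> (Suc n) < ereal s"
    then have "ereal s \<le> jump_time \<omega> (Suc n)" by simp
    then have "ereal r < jump_time \<omega> (Suc n)" "ereal r' < jump_time \<omega> (Suc n)"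
      using r by (auto intro: less_le_trans[of _ "ereal s"] simp del: jump_time.simps)
    moreover have "jump_time \<omega> n \<le> ereal r'" using t r by (auto intro: order_trans)
    ultimately have "sojourn n \<omega> r" "sojourn n \<omega> r'" using t by (auto simp: sojourn_def)
    then show False using state_sojourn[OF \<omega>] r(5) by metis
  qed
  then show ?case by simp
qed simp

lemma changes_if_jump_time_less:
  assumes \<omega>: "\<omega> \<in> space (trajectories X)"
    and good: "\<And>n. jump_time \<omega> (Suc n) < \<infinity> \<Longrightarrow> nth_state X n \<omega> \<noteq> nth_state X (Suc n) \<omega>"
  shows "jump_time \<omega> n < ereal s \<Longrightarrow> changes n \<omega> s"
proof (induction n arbitrary: s)
  case (Suc n)
  have fin: "jump_time \<omega> (Suc n) < \<infinity>" using Suc(2) by (cases "jump_time \<omega> (Suc n)") auto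
  have le: "jump_time \<omega> n \<le> jump_time \<omega> (Suc n)" by (rule jump_time_le_Suc[OF \<omega>])
  then have fin': "jump_time \<omega> n < \<infinity>" using fin by (rule le_less_trans)
  obtain a where a: "jump_time \<omega> n = ereal a" "0 \<le> a"
    using fin' jump_time_nonneg[OF \<omega>, of n] by (cases "jump_time \<omega> n") auto
  obtain b where b: "jump_time \<omega> (Suc n) = ereal b"
    using fin jump_time_nonneg[OF \<omega>, of "Suc n"] by (cases "jump_time \<omega> (Suc n)") auto
  have ab: "a < b" using jump_time_less_Suc[OF \<omega> fin'] a b by simp
  have bs: "b < s" using Suc(2) b by simp
  have "ereal b < min (ereal s) (jump_time \<omega> (Suc (Suc n)))"
    using jump_time_less_Suc[OF \<omega> fin] b bs by simp
  then obtain c where c: "ereal b < ereal c" "ereal c < min (ereal s) (jump_time \<omega> (Suc (Suc n)))"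
    using ereal_dense2 by blast
  obtain r where r: "r \<in> \<rat>" "a < r" "r < b" using Rats_dense_in_real[OF ab] by blast
  obtain r' where r': "r' \<in> \<rat>" "b < r'" "r' < c" using Rats_dense_in_real[of b c] c by auto
  have "sojourn n \<omega> r" using r a b by (simp add: sojourn_def del: jump_time.simps)
  moreover have "ereal r' < jump_time \<omega> (Suc (Suc n))"
    using r'(3) c(2) less_trans[of "ereal r'" "ereal c"] by (simp del: jump_time.simps)
  then have "sojourn (Suc n) \<omega> r'" using r' b by (simp add: sojourn_def del: jump_time.simps)
  ultimately have "state \<omega> r \<noteq> state \<omega> r'" using state_sojourn[OF \<omega>] good[OF fin] by auto
  moreover have "changes n \<omega> r" using Suc(1)[of r] r a by simp
  moreover have "r' < s" using r'(3) c(2) by simp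
  ultimately show ?case
    unfolding changes.simps using r r' a(2) by (intro bexI[OF _ r(1)] bexI[OF _ r'(1)]) auto
qed simp

text \<open>
  If every jump changes the state, the visible changes before \<open>s\<close> count the jumps before \<open>s\<close>.
\<close>

lemma changes_iff:
  assumes \<omega>: "\<omega> \<in> space (trajectories X)"
    and good: "\<And>n. jump_time \<omega> (Suc n) < \<infinity> \<Longrightarrow> nth_state X n \<omega> \<noteq> nth_state X (Suc n) \<omega>"
    and s: "0 < s" "pre_sojourn m \<omega> s"
  shows "changes n \<omega> s \<longleftrightarrow> n \<le> m"
proof
  assume c: "changes n \<omega> s"
  show "n \<le> m"
  proof (rule ccontr)
    assume "\<not> n \<le> m"
    then have "0 < n" "Suc m \<le> n" by auto
    then have "jump_time \<omega> (Suc m) < ereal s"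
      using changes_imp_jump_time_le[OF \<omega> less_imp_le[OF s(1)] c] jump_time_mono[OF \<omega>, of "Suc m" n] by auto
    then show False using s(2) by (auto simp: pre_sojourn_def)
  qed
next
  assume "n \<le> m"
  then have "jump_time \<omega> n < ereal s"
    using jump_time_mono[OF \<omega>, of n m] s(2) by (auto simp: pre_sojourn_def)
  then show "changes n \<omega> s" using changes_if_jump_time_less[OF \<omega> good] by blast
qed

section \<open>The compensation formula\<close>

text \<open>Lebesgue measure on the positive reals.\<close>

definition pos_lborel :: "real measure" where
  "pos_lborel = restrict_space lborel {0<..}"

lemma sets_pos_lborel [simp, measurable_cong]: "sets pos_lborel = sets pos_reals"
  unfolding pos_lborel_def by (rule sets_restrict_space_cong) simp

lemma space_pos_lborel [simp]: "space pos_lborel = {0<..}"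
  by (simp add: pos_lborel_def space_restrict_space)

lemma space_pos_reals [simp]: "space pos_reals = {0<..}"
  by (simp add: space_restrict_space)

lemma nn_integral_pos_lborel: "(\<integral>\<^sup>+s. f s \<partial>pos_lborel) = (\<integral>\<^sup>+s\<in>{0<..}. f s \<partial>lborel)"
  unfolding pos_lborel_def by (rule nn_integral_restrict_space) simp

lemma sigma_finite_pos_lborel: "sigma_finite_measure pos_lborel"
  unfolding pos_lborel_def
  by (rule sigma_finite_measure_restrict_space) (auto simp: lborel.sigma_finite_measure_axioms)

lemma AE_pos_lborel_countable:
  assumes "countable N"
  shows "AE s in pos_lborel. s \<notin> N"
proof -
  have "AE s in lborel. s \<notin> N"
    using countable_imp_null_set_lborel[OF assms] by (rule AE_not_in)
  then show ?thesis unfolding pos_lborel_def by (subst AE_restrict_space_iff) auto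
qed

lemma AE_not_jump_time:
  assumes "\<omega> \<in> space (trajectories X)"
  shows "AE s in pos_lborel. \<forall>n. sojourn n \<omega> s \<longrightarrow> pre_sojourn n \<omega> s"
proof -
  have "AE s in pos_lborel. s \<notin> range (\<lambda>n. rtime \<omega> n)"
    by (rule AE_pos_lborel_countable) auto
  then show ?thesis
  proof (rule eventually_mono)
    fix s assume s: "s \<notin> range (\<lambda>n. rtime \<omega> n)"
    then have "jump_time \<omega> n \<noteq> ereal s" for n
      by (metis rangeI real_of_ereal.simps(1))
    then show "\<forall>n. sojourn n \<omega> s \<longrightarrow> pre_sojourn n \<omega> s"
      unfolding sojourn_def pre_sojourn_def by (auto simp: less_le)
  qed
qed

lemma nn_integral_jump_measure:
  assumes \<omega>: "\<omega> \<in> space (trajectories X)" and W: "W \<in> borel_measurable (pos_reals \<Otimes>\<^sub>M X)"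
  shows "(\<integral>\<^sup>+p. W p \<partial>jump_measure X \<omega>) =
    (\<Sum>n. if jump_time \<omega> (Suc n) < \<infinity> then W (rtime \<omega> (Suc n), nth_state X (Suc n) \<omega>) else 0)"
proof -
  let ?C = "{n. 1 \<le> n \<and> jump_time \<omega> n < \<infinity>}" and ?D = "{n. jump_time \<omega> (Suc n) < \<infinity>}"
  let ?g = "\<lambda>n. (rtime \<omega> n, the (jump_state \<omega> n))"
  have g: "?g \<in> measurable (count_space ?C) (pos_reals \<Otimes>\<^sub>M X)"
  proof -
    have "?g n \<in> space (pos_reals \<Otimes>\<^sub>M X)" if n: "n \<in> ?C" for n
    proof -
      obtain m where m: "n = Suc m" using n by (cases n) auto
      have "0 < jump_time \<omega> n" unfolding m by (rule jump_time_Suc_pos[OF \<omega>])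
      then have "0 < rtime \<omega> n" using n by (cases "jump_time \<omega> n") auto
      moreover have "the (jump_state \<omega> n) \<in> space X" using jump_state_Some[OF \<omega>, of n] n by force
      ultimately show ?thesis by (auto simp: space_pair_measure)
    qed
    then show ?thesis by simp
  qed
  have "(\<integral>\<^sup>+p. W p \<partial>jump_measure X \<omega>) = (\<integral>\<^sup>+n. W (?g n) \<partial>count_space ?C)"
    unfolding jump_measure_def by (rule nn_integral_distr[OF g]) (simp add: W)
  also have "\<dots> = (\<integral>\<^sup>+n. W (?g (Suc n)) \<partial>count_space ?D)"
  proof (rule nn_integral_bij_count_space[symmetric])
    show "bij_betw Suc ?D ?C"
      by (auto simp: bij_betw_def image_iff simp del: jump_time.simps) (metis Suc_le_D One_nat_def)
  qed
  also have "\<dots> = (\<integral>\<^sup>+n. W (?g (Suc n)) * indicator ?D n \<partial>count_space UNIV)"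
    by (rule nn_integral_count_space_indicator) simp
  also have "\<dots> = (\<Sum>n. W (?g (Suc n)) * indicator ?D n)"
    by (rule nn_integral_count_space_nat)
  also have "\<dots> = (\<Sum>n. if jump_time \<omega> (Suc n) < \<infinity> then W (rtime \<omega> (Suc n), nth_state X (Suc n) \<omega>) else 0)"
    using jump_state_nth_state[OF \<omega>] by (intro suminf_cong) (auto simp: indicator_def simp del: jump_time.simps jump_state.simps)
  finally show ?thesis .
qed

lemma measurable_state_pos_reals:
  "(\<lambda>p. state (fst p) (snd p)) \<in> measurable (timed X) (adjoin_point X)"
proof -
  have "(\<lambda>p. (fst p, snd p)) \<in> measurable (timed X) (trajectories X \<Otimes>\<^sub>M borel)"
    by measurable
  from measurable_compose[OF this measurable_state] show ?thesis by simp
qed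

lemma state_in_space: "\<omega> \<in> space (trajectories X) \<Longrightarrow> state \<omega> s = Some z \<Longrightarrow> z \<in> space X"
  using measurable_space[OF measurable_state_fixed, of \<omega> X s] by auto

context CTJMDP
begin

context
  fixes \<pi> \<kappa>
  assumes \<kappa>: "policy_kernel X A \<pi> \<kappa>"
begin

lemma policy_kernelD:
  "\<kappa> \<in> measurable (timed X) (subprob_algebra A)"
  "\<omega> \<in> space (trajectories X) \<Longrightarrow> 0 < s \<Longrightarrow> ereal s < explosion_time \<omega> \<Longrightarrow>
    \<pi> \<omega> s = distr (\<kappa> (\<omega>, s)) (adjoin_point A) Some"
  using \<kappa> unfolding policy_kernel_def by auto

lemma measurable_policy_kernel_section:
  assumes "\<omega> \<in> space (trajectories X)"
  shows "(\<lambda>s. \<kappa> (\<omega>, s)) \<in> measurable pos_reals (subprob_algebra A)"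
  using measurable_compose[OF measurable_Pair1'[OF assms] policy_kernelD(1)] .

lemma sets_policy_kernel: "\<omega> \<in> space (trajectories X) \<Longrightarrow> 0 < s \<Longrightarrow> sets (\<kappa> (\<omega>, s)) = sets A"
  using sets_kernel[OF policy_kernelD(1)] by (auto simp: space_pair_measure)

text \<open>The integral of \<open>f\<close> against the jump intensity of the process at time \<open>s\<close>.\<close>

definition flow :: "'x trajectory \<Rightarrow> real \<Rightarrow> ('x \<Rightarrow> ennreal) \<Rightarrow> ennreal" where
  "flow \<omega> s f = (case state \<omega> s of None \<Rightarrow> 0 | Some z \<Rightarrow> intens (\<kappa> (\<omega>, s)) z f)"

lemma measurable_flow:
  assumes \<omega>: "\<omega> \<in> space (trajectories X)"
    and W: "(\<lambda>(s, y). W s y) \<in> borel_measurable (pos_reals \<Otimes>\<^sub>M X)"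
  shows "(\<lambda>s. flow \<omega> s (W s)) \<in> borel_measurable pos_reals"
  unfolding flow_def
proof (rule borel_measurable_case_option_adjoin[OF space_trajectories_not_empty[OF \<omega>]])
  show "state \<omega> \<in> measurable pos_reals (adjoin_point X)"
    using measurable_compose[OF measurable_Pair1'[OF \<omega>] measurable_state_pos_reals] by simp
  note [measurable] = measurable_policy_kernel_section[OF \<omega>] W
  have "(\<lambda>p. intens (\<kappa> (\<omega>, fst p)) (snd p) (W (fst p))) \<in> borel_measurable (pos_reals \<Otimes>\<^sub>M X)"
  proof (rule measurable_intens)
    have "(\<lambda>p. (\<lambda>(s, y). W s y) (fst (fst p), snd p)) \<in> borel_measurable (jumps X)"
      by (rule measurable_compose[OF _ W]) measurable
    then show "(\<lambda>(p, y). W (fst p) y) \<in> borel_measurable (jumps X)"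
      by (simp add: case_prod_beta')
    show "(\<lambda>p. \<kappa> (\<omega>, fst p)) \<in> measurable (pos_reals \<Otimes>\<^sub>M X) (subprob_algebra A)" by measurable
  qed measurable
  then show "(\<lambda>(s, z). intens (\<kappa> (\<omega>, s)) z (W s)) \<in> borel_measurable (pos_reals \<Otimes>\<^sub>M X)"
    by (simp add: case_prod_beta')
qed

lemma sets_intensity_measure [simp]: "sets (intensity_measure X Act q \<pi> \<omega>) = sets (pos_reals \<Otimes>\<^sub>M X)"
  unfolding intensity_measure_def by (simp add: sets.space_closed sets.sigma_sets_eq)

text \<open>
  The set function in the definition of \<^const>\<open>intensity_measure\<close> has to be shown countably additive;
  otherwise \<^const>\<open>measure_of\<close> yields the zero measure.
\<close>

lemma emeasure_intensity_measure:
  assumes \<omega>: "\<omega> \<in> space (trajectories X)" and D: "D \<in> sets (pos_reals \<Otimes>\<^sub>M X)"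
  shows "emeasure (intensity_measure X Act q \<pi> \<omega>) D = (\<integral>\<^sup>+s. flow \<omega> s (indicator (Pair s -` D)) \<partial>pos_lborel)"
proof -
  let ?m = "\<lambda>D. \<integral>\<^sup>+s\<in>{0<..}. (case state \<omega> s of None \<Rightarrow> 0 | Some z \<Rightarrow>
      action_mean Act (\<lambda>(_, a). ennreal (q z (the a) (Pair s -` D - {z}))) (Some z) (\<pi> \<omega> s)) \<partial>lborel"
  have eq: "?m D = (\<integral>\<^sup>+s. flow \<omega> s (indicator (Pair s -` D)) \<partial>pos_lborel)"
    if D: "D \<in> sets (pos_reals \<Otimes>\<^sub>M X)" for D
  proof -
    have "?m D = (\<integral>\<^sup>+s. (case state \<omega> s of None \<Rightarrow> 0 | Some z \<Rightarrow>
      action_mean Act (\<lambda>(_, a). ennreal (q z (the a) (Pair s -` D - {z}))) (Some z) (\<pi> \<omega> s)) \<partial>pos_lborel)"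
      by (rule nn_integral_pos_lborel[symmetric])
    also have "\<dots> = (\<integral>\<^sup>+s. flow \<omega> s (indicator (Pair s -` D)) \<partial>pos_lborel)"
    proof (rule nn_integral_cong)
      fix s assume "s \<in> space pos_lborel"
      then have s: "0 < s" by simp
      show "(case state \<omega> s of None \<Rightarrow> 0 | Some z \<Rightarrow>
          action_mean Act (\<lambda>(_, a). ennreal (q z (the a) (Pair s -` D - {z}))) (Some z) (\<pi> \<omega> s)) =
          flow \<omega> s (indicator (Pair s -` D))"
      proof (cases "state \<omega> s")
        case None then show ?thesis by (simp add: flow_def)
      next
        case (Some z)
        then have "ereal s < explosion_time \<omega>"
          using state_None_iff[OF \<omega>, of s] s by (auto simp: not_le)
        then have "\<pi> \<omega> s = distr (\<kappa> (\<omega>, s)) (adjoin_point A) Some" using policy_kernelD(2)[OF \<omega> s] by blast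
        then show ?thesis
          using action_mean_jump[OF state_in_space[OF \<omega> Some] sets_policy_kernel[OF \<omega> s] sets_Pair1[OF D]] Some
          by (simp add: flow_def)
      qed
    qed
    finally show ?thesis .
  qed
  have "emeasure (intensity_measure X Act q \<pi> \<omega>) D = ?m D"
  proof (rule emeasure_measure_of[OF intensity_measure_def])
    show "sets (pos_reals \<Otimes>\<^sub>M X) \<subseteq> Pow (space (pos_reals \<Otimes>\<^sub>M X))" by (rule sets.space_closed)
    show "D \<in> sets (intensity_measure X Act q \<pi> \<omega>)" using D by simp
    have [simp]: "flow \<omega> s (indicator {}) = 0" for s
      by (simp add: flow_def intens_def split: option.split)
    show "positive (sets (intensity_measure X Act q \<pi> \<omega>)) ?m"
      unfolding positive_def eq[OF sets.empty_sets] by simp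
    show "countably_additive (sets (intensity_measure X Act q \<pi> \<omega>)) ?m"
    proof (rule countably_additiveI)
      fix E :: "nat \<Rightarrow> (real \<times> 'x) set"
      assume "range E \<subseteq> sets (intensity_measure X Act q \<pi> \<omega>)" and disj: "disjoint_family E"
        and "\<Union> (range E) \<in> sets (intensity_measure X Act q \<pi> \<omega>)"
      then have E: "E i \<in> sets (pos_reals \<Otimes>\<^sub>M X)" and U: "\<Union> (range E) \<in> sets (pos_reals \<Otimes>\<^sub>M X)" for i by auto
      have meas: "(\<lambda>s. flow \<omega> s (indicator (Pair s -` E i))) \<in> borel_measurable pos_lborel" for i
      proof -
        have "(\<lambda>(s, y). indicator (Pair s -` E i) y :: ennreal) = indicator (E i)"
          by (auto simp: fun_eq_iff indicator_def)
        then have "(\<lambda>s. flow \<omega> s (indicator (Pair s -` E i))) \<in> borel_measurable pos_reals"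
          using E by (intro measurable_flow[OF \<omega>]) simp
        then show ?thesis by simp
      qed
      have "(\<Sum>i. ?m (E i)) = (\<Sum>i. \<integral>\<^sup>+s. flow \<omega> s (indicator (Pair s -` E i)) \<partial>pos_lborel)"
        using eq[OF E] by simp
      also have "\<dots> = (\<integral>\<^sup>+s. (\<Sum>i. flow \<omega> s (indicator (Pair s -` E i))) \<partial>pos_lborel)"
        using meas by (rule nn_integral_suminf[symmetric])
      also have "\<dots> = (\<integral>\<^sup>+s. flow \<omega> s (indicator (Pair s -` \<Union> (range E))) \<partial>pos_lborel)"
      proof (rule nn_integral_cong)
        fix s assume "s \<in> space pos_lborel"
        then have s: "0 < s" by simp
        show "(\<Sum>i. flow \<omega> s (indicator (Pair s -` E i))) = flow \<omega> s (indicator (Pair s -` \<Union> (range E)))"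
        proof (cases "state \<omega> s")
          case None then show ?thesis by (simp add: flow_def)
        next
          case (Some z)
          have "disjoint_family (\<lambda>i. Pair s -` E i)" using disj by (auto simp: disjoint_family_on_def)
          then have "(\<Sum>i. indicator (Pair s -` E i) y) = (indicator (\<Union>i. Pair s -` E i) y :: ennreal)" for y
            by (rule suminf_indicator)
          moreover have "(\<Union>i. Pair s -` E i) = Pair s -` \<Union> (range E)" by auto
          ultimately have ind: "indicator (Pair s -` \<Union> (range E)) = (\<lambda>y. \<Sum>i. indicator (Pair s -` E i) y :: ennreal)" by auto
          have "intens (\<kappa> (\<omega>, s)) z (\<lambda>y. \<Sum>i. indicator (Pair s -` E i) y) = (\<Sum>i. intens (\<kappa> (\<omega>, s)) z (indicator (Pair s -` E i)))"
            using sets_Pair1[OF E] by (intro intens_suminf state_in_space[OF \<omega> Some] sets_policy_kernel[OF \<omega> s]) simp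
          then show ?thesis unfolding flow_def Some ind by simp
        qed
      qed
      finally show "(\<Sum>i. ?m (E i)) = ?m (\<Union> (range E))" using eq[OF U] by simp
    qed
  qed
  then show ?thesis using eq[OF D] by simp
qed

lemma nn_integral_intensity_measure:
  assumes \<omega>: "\<omega> \<in> space (trajectories X)" and W: "W \<in> borel_measurable (pos_reals \<Otimes>\<^sub>M X)"
  shows "(\<integral>\<^sup>+p. W p \<partial>intensity_measure X Act q \<pi> \<omega>) = (\<integral>\<^sup>+s. flow \<omega> s (\<lambda>y. W (s, y)) \<partial>pos_lborel)"
proof -
  let ?\<nu> = "intensity_measure X Act q \<pi> \<omega>"
  have sec: "(\<lambda>y. f (s, y)) \<in> borel_measurable X" if "f \<in> borel_measurable ?\<nu>" "0 < s" for f :: "real \<times> 'x \<Rightarrow> ennreal" and s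
    using that measurable_compose[OF measurable_Pair1'[of s pos_reals X]] by (auto cong: measurable_cong_sets)
  have mf: "(\<lambda>s. flow \<omega> s (\<lambda>y. f (s, y))) \<in> borel_measurable pos_lborel" if "f \<in> borel_measurable ?\<nu>" for f
  proof -
    have "(\<lambda>s. flow \<omega> s (\<lambda>y. f (s, y))) \<in> borel_measurable pos_reals"
      using that by (intro measurable_flow[OF \<omega>]) (simp cong: measurable_cong_sets)
    then show ?thesis by simp
  qed
  have "W \<in> borel_measurable ?\<nu>" using W by (simp cong: measurable_cong_sets)
  then show ?thesis
  proof (induction rule: borel_measurable_induct)
    case (cong f g)
    have "(\<integral>\<^sup>+p. f p \<partial>?\<nu>) = (\<integral>\<^sup>+p. g p \<partial>?\<nu>)" using cong by (intro nn_integral_cong) auto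
    moreover have "flow \<omega> s (\<lambda>y. f (s, y)) = flow \<omega> s (\<lambda>y. g (s, y))" if "0 < s" for s
    proof -
      have "space ?\<nu> = space (pos_reals \<Otimes>\<^sub>M X)" by (rule sets_eq_imp_space_eq) simp
      then have "f (s, y) = g (s, y)" if "y \<in> space X" for y
        using cong(3)[of "(s, y)"] that \<open>0 < s\<close> by (simp add: space_pair_measure)
      then show ?thesis unfolding flow_def by (auto split: option.split intro!: intens_cong)
    qed
    then have "(\<integral>\<^sup>+s. flow \<omega> s (\<lambda>y. f (s, y)) \<partial>pos_lborel) = (\<integral>\<^sup>+s. flow \<omega> s (\<lambda>y. g (s, y)) \<partial>pos_lborel)"
      by (intro nn_integral_cong) simp
    ultimately show ?case using cong(4) by simp
  next
    case (set D)
    have "(\<lambda>y. indicator D (s, y)) = (indicator (Pair s -` D) :: 'x \<Rightarrow> ennreal)" for s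
      by (auto simp: indicator_def fun_eq_iff)
    then show ?case using set emeasure_intensity_measure[OF \<omega>, of D] by simp
  next
    case (mult f c)
    have "(\<integral>\<^sup>+p. c * f p \<partial>?\<nu>) = c * (\<integral>\<^sup>+s. flow \<omega> s (\<lambda>y. f (s, y)) \<partial>pos_lborel)"
      using mult by (simp add: nn_integral_cmult)
    also have "\<dots> = (\<integral>\<^sup>+s. c * flow \<omega> s (\<lambda>y. f (s, y)) \<partial>pos_lborel)"
      using mf[OF mult(2)] by (simp add: nn_integral_cmult)
    also have "\<dots> = (\<integral>\<^sup>+s. flow \<omega> s (\<lambda>y. c * f (s, y)) \<partial>pos_lborel)"
      using sec[OF mult(2)] state_in_space[OF \<omega>] sets_policy_kernel[OF \<omega>]
      by (intro nn_integral_cong) (auto simp: flow_def intens_cmult split: option.split)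
    finally show ?case .
  next
    case (add f g)
    have "(\<integral>\<^sup>+p. g p + f p \<partial>?\<nu>) = (\<integral>\<^sup>+s. flow \<omega> s (\<lambda>y. g (s, y)) \<partial>pos_lborel) + (\<integral>\<^sup>+s. flow \<omega> s (\<lambda>y. f (s, y)) \<partial>pos_lborel)"
      using add by (simp add: nn_integral_add)
    also have "\<dots> = (\<integral>\<^sup>+s. flow \<omega> s (\<lambda>y. g (s, y)) + flow \<omega> s (\<lambda>y. f (s, y)) \<partial>pos_lborel)"
      using mf[of f] mf[of g] add by (simp add: nn_integral_add)
    also have "\<dots> = (\<integral>\<^sup>+s. flow \<omega> s (\<lambda>y. g (s, y) + f (s, y)) \<partial>pos_lborel)"
      using sec[of f] sec[of g] add state_in_space[OF \<omega>] sets_policy_kernel[OF \<omega>]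
      by (intro nn_integral_cong) (auto simp: flow_def intens_add split: option.split)
    finally show ?case .
  next
    case (seq F)
    have "(\<integral>\<^sup>+p. (SUP i. F i) p \<partial>?\<nu>) = (SUP i. \<integral>\<^sup>+p. F i p \<partial>?\<nu>)"
      unfolding SUP_apply using seq by (intro nn_integral_monotone_convergence_SUP) auto
    also have "\<dots> = (SUP i. \<integral>\<^sup>+s. flow \<omega> s (\<lambda>y. F i (s, y)) \<partial>pos_lborel)" using seq by simp
    also have "\<dots> = (\<integral>\<^sup>+s. (SUP i. flow \<omega> s (\<lambda>y. F i (s, y))) \<partial>pos_lborel)"
    proof (rule nn_integral_monotone_convergence_SUP[symmetric])
      show "incseq (\<lambda>i s. flow \<omega> s (\<lambda>y. F i (s, y)))"
        using \<open>incseq F\<close> by (auto simp: incseq_def le_fun_def flow_def split: option.split intro!: intens_mono)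
    qed (use mf seq in auto)
    also have "\<dots> = (\<integral>\<^sup>+s. flow \<omega> s (\<lambda>y. (SUP i. F i) (s, y)) \<partial>pos_lborel)"
    proof (rule nn_integral_cong)
      fix s assume "s \<in> space pos_lborel"
      then have s: "0 < s" by simp
      show "(SUP i. flow \<omega> s (\<lambda>y. F i (s, y))) = flow \<omega> s (\<lambda>y. (SUP i. F i) (s, y))"
      proof (cases "state \<omega> s")
        case None then show ?thesis by (simp add: flow_def)
      next
        case (Some z)
        have "incseq (\<lambda>i y. F i (s, y))" using \<open>incseq F\<close> by (auto simp: incseq_def le_fun_def)
        then have "intens (\<kappa> (\<omega>, s)) z (\<lambda>y. SUP i. F i (s, y)) = (SUP i. intens (\<kappa> (\<omega>, s)) z (\<lambda>y. F i (s, y)))"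
          using sec[OF seq(1) s] by (intro intens_SUP state_in_space[OF \<omega> Some] sets_policy_kernel[OF \<omega> s]) auto
        then show ?thesis unfolding flow_def Some SUP_apply by simp
      qed
    qed
    finally show ?case .
  qed
qed

end

lemma space_process_law:
  assumes "process_law X Act q \<gamma> \<pi> P"
  shows "sets P = sets (trajectories X)" "space P = space (trajectories X)" "prob_space P"
    "space (trajectories X) \<noteq> {}" "space X \<noteq> {}"
proof -
  show 1: "sets P = sets (trajectories X)" "prob_space P"
    using assms by (auto simp: process_law_def space_prob_algebra)
  then show 2: "space P = space (trajectories X)" using sets_eq_imp_space_eq by blast
  then show 3: "space (trajectories X) \<noteq> {}" using prob_space.not_empty[OF 1(2)] by simp
  show "space X \<noteq> {}" using 3 space_trajectories_not_empty by blast
qed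

lemma measurable_process_law:
  "process_law X Act q \<gamma> \<pi> P \<Longrightarrow> measurable P M = measurable (trajectories X) M"
  using space_process_law(1) by (intro measurable_cong_sets) auto

lemma nn_integral_cong_law:
  assumes "process_law X Act q \<gamma> \<pi> P" "\<And>\<omega>. \<omega> \<in> space (trajectories X) \<Longrightarrow> f \<omega> = g \<omega>"
  shows "(\<integral>\<^sup>+\<omega>. f \<omega> \<partial>P) = (\<integral>\<^sup>+\<omega>. g \<omega> \<partial>P)"
  using assms space_process_law(2) by (intro nn_integral_cong) auto

lemma AE_trajectory: "process_law X Act q \<gamma> \<pi> P \<Longrightarrow> AE \<omega> in P. \<omega> \<in> space (trajectories X)"
  using space_process_law(2) by (intro AE_I2) simp

text \<open>
  Jumps are compensated by their intensities, for integrands that depend on the time, on the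
  states before and after the jump and, through the weight \<open>w\<close>, on the past.
\<close>

lemma compensation:
  assumes P: "process_law X Act q \<gamma> \<pi> P" and \<kappa>: "policy_kernel X A \<pi> \<kappa>"
    and w: "w \<in> borel_measurable (predictable_sets X)"
    and f: "f \<in> borel_measurable (jumps X)"
  shows "(\<integral>\<^sup>+\<omega>. (\<Sum>n. if jump_time \<omega> (Suc n) < \<infinity> then
        w (\<omega>, rtime \<omega> (Suc n)) *
        at_jump X f \<omega> n else 0) \<partial>P) =
    (\<integral>\<^sup>+\<omega>. \<integral>\<^sup>+s. (\<Sum>n. if sojourn n \<omega> s then w (\<omega>, s) * intens_at (\<kappa> (\<omega>, s)) s f (nth_state X n \<omega>) else 0) \<partial>pos_lborel \<partial>P)"
proof -
  note sp = space_process_law[OF P]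
  define W where "W p = w (fst p) * prev_val f p" for p
  have W: "W \<in> borel_measurable (predictable_sets X \<Otimes>\<^sub>M X)"
    unfolding W_def using measurable_prev_val[OF f sp(5)] w by measurable
  have Wsec: "(\<lambda>(s, x). W ((\<omega>, s), x)) \<in> borel_measurable (pos_reals \<Otimes>\<^sub>M X)" if "\<omega> \<in> space (trajectories X)" for \<omega>
  proof -
    have "(\<lambda>p. W ((\<omega>, fst p), snd p)) \<in> borel_measurable (pos_reals \<Otimes>\<^sub>M X)"
      using measurable_Pair_predictable[OF that]
      by (intro measurable_compose[OF _ W] measurable_Pair) (auto intro: measurable_compose[OF measurable_fst])
    then show ?thesis by (simp add: case_prod_beta')
  qed
  have "(\<integral>\<^sup>+\<omega>. \<integral>\<^sup>+(s, x). W ((\<omega>, s), x) \<partial>jump_measure X \<omega> \<partial>P) =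
        (\<integral>\<^sup>+\<omega>. \<integral>\<^sup>+(s, x). W ((\<omega>, s), x) \<partial>intensity_measure X Act q \<pi> \<omega> \<partial>P)"
    using P W unfolding process_law_def compensates_def by blast
  also have "(\<integral>\<^sup>+\<omega>. \<integral>\<^sup>+(s, x). W ((\<omega>, s), x) \<partial>jump_measure X \<omega> \<partial>P) =
    (\<integral>\<^sup>+\<omega>. (\<Sum>n. if jump_time \<omega> (Suc n) < \<infinity> then
        w (\<omega>, rtime \<omega> (Suc n)) *
        at_jump X f \<omega> n else 0) \<partial>P)"
  proof (rule nn_integral_cong)
    fix \<omega> assume "\<omega> \<in> space P"
    then have \<omega>: "\<omega> \<in> space (trajectories X)" using sp by simp
    have "prev_val f ((\<omega>, rtime \<omega> (Suc n)), y) =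
        f ((rtime \<omega> (Suc n), nth_state X n \<omega>), y)" if fin: "jump_time \<omega> (Suc n) < \<infinity>" for n y
    proof (rule prev_val_eq[OF \<omega>])
      have e: "ereal (rtime \<omega> (Suc n)) = jump_time \<omega> (Suc n)"
        using jump_time_nonneg[OF \<omega>, of "Suc n"] fin by (cases "jump_time \<omega> (Suc n)") auto
      have "jump_time \<omega> n < \<infinity>" using jump_time_le_Suc[OF \<omega>] fin by (rule le_less_trans)
      then show "pre_sojourn n \<omega> (rtime \<omega> (Suc n))"
        unfolding pre_sojourn_def e using jump_time_less_Suc[OF \<omega>] by simp
    qed
    then show "(\<integral>\<^sup>+(s, x). W ((\<omega>, s), x) \<partial>jump_measure X \<omega>) =
      (\<Sum>n. if jump_time \<omega> (Suc n) < \<infinity> then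
        w (\<omega>, rtime \<omega> (Suc n)) *
        at_jump X f \<omega> n else 0)"
      unfolding nn_integral_jump_measure[OF \<omega> Wsec[OF \<omega>]]
      by (intro suminf_cong) (simp add: W_def del: jump_time.simps)
  qed
  also have "(\<integral>\<^sup>+\<omega>. \<integral>\<^sup>+(s, x). W ((\<omega>, s), x) \<partial>intensity_measure X Act q \<pi> \<omega> \<partial>P) =
    (\<integral>\<^sup>+\<omega>. \<integral>\<^sup>+s. (\<Sum>n. if sojourn n \<omega> s then w (\<omega>, s) * intens_at (\<kappa> (\<omega>, s)) s f (nth_state X n \<omega>) else 0) \<partial>pos_lborel \<partial>P)"
  proof (rule nn_integral_cong)
    fix \<omega> assume "\<omega> \<in> space P"
    then have \<omega>: "\<omega> \<in> space (trajectories X)" using sp by simp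
    have "(\<integral>\<^sup>+(s, x). W ((\<omega>, s), x) \<partial>intensity_measure X Act q \<pi> \<omega>) =
        (\<integral>\<^sup>+s. flow \<kappa> \<omega> s (\<lambda>y. W ((\<omega>, s), y)) \<partial>pos_lborel)"
      using nn_integral_intensity_measure[OF \<kappa> \<omega> Wsec[OF \<omega>]] by simp
    also have "\<dots> = (\<integral>\<^sup>+s. (\<Sum>n. if sojourn n \<omega> s then w (\<omega>, s) * intens_at (\<kappa> (\<omega>, s)) s f (nth_state X n \<omega>) else 0) \<partial>pos_lborel)"
    proof (rule nn_integral_cong_AE)
      have "AE s in pos_lborel. 0 < s" by (rule AE_I2) simp
      with AE_not_jump_time[OF \<omega>]
      show "AE s in pos_lborel. flow \<kappa> \<omega> s (\<lambda>y. W ((\<omega>, s), y)) = (\<Sum>n. if sojourn n \<omega> s then w (\<omega>, s) * intens_at (\<kappa> (\<omega>, s)) s f (nth_state X n \<omega>) else 0)"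
      proof eventually_elim
        case (elim s)
        show ?case
        proof (cases "\<exists>n. sojourn n \<omega> s")
          case True
          then obtain n where n: "sojourn n \<omega> s" by blast
          have fs: "(\<lambda>y. f ((s, nth_state X n \<omega>), y)) \<in> borel_measurable X"
            using elim(2) nth_state_in_space[OF \<omega>]
            by (intro measurable_compose[OF measurable_Pair1' f]) (simp add: space_pair_measure)
          have "W ((\<omega>, s), y) = w (\<omega>, s) * f ((s, nth_state X n \<omega>), y)" for y
            using prev_val_eq[OF \<omega>, of n s] n elim(1) by (simp add: W_def)
          then have "flow \<kappa> \<omega> s (\<lambda>y. W ((\<omega>, s), y)) = intens (\<kappa> (\<omega>, s)) (nth_state X n \<omega>) (\<lambda>y. w (\<omega>, s) * f ((s, nth_state X n \<omega>), y))"
            unfolding flow_def[OF \<kappa>] state_sojourn[OF \<omega> n] by simp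
          also have "\<dots> = w (\<omega>, s) * intens_at (\<kappa> (\<omega>, s)) s f (nth_state X n \<omega>)"
            by (rule intens_cmult[OF fs nth_state_in_space[OF \<omega>] sets_policy_kernel[OF \<kappa> \<omega> elim(2)]])
          finally show ?thesis using suminf_sojourn[OF \<omega> n] by simp
        next
          case False
          then have "state \<omega> s = None" by (auto simp: state_def sojourn_def)
          then show ?thesis using False by (simp add: flow_def[OF \<kappa>])
        qed
      qed
    qed
    finally show "(\<integral>\<^sup>+(s, x). W ((\<omega>, s), x) \<partial>intensity_measure X Act q \<pi> \<omega>) =
      (\<integral>\<^sup>+s. (\<Sum>n. if sojourn n \<omega> s then w (\<omega>, s) * intens_at (\<kappa> (\<omega>, s)) s f (nth_state X n \<omega>) else 0) \<partial>pos_lborel)" .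
  qed
  finally show ?thesis .
qed

end

section \<open>Null events and joint laws of state and action\<close>

lemma measurable_jump_fun:
  assumes f: "f \<in> borel_measurable (jumps X)"
  shows "(\<lambda>\<omega>. if jump_time \<omega> (Suc n) < \<infinity> then
      at_jump X f \<omega> n else (0 :: ennreal))
    \<in> borel_measurable (trajectories X)"
proof -
  define t where "t \<omega> = (if jump_time \<omega> (Suc n) < \<infinity> then rtime \<omega> (Suc n) else 1)"
    for \<omega> :: "'a trajectory"
  have t: "t \<in> measurable (trajectories X) pos_reals"
  proof (rule measurable_restrict_space2)
    show "t \<in> borel_measurable (trajectories X)" unfolding t_def by (simp del: jump_time.simps)
    show "t \<in> space (trajectories X) \<rightarrow> {0<..}"
    proof
      fix \<omega> :: "'a trajectory" assume "\<omega> \<in> space (trajectories X)"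
      from jump_time_Suc_pos[OF this, of n] show "t \<omega> \<in> {0<..}"
        unfolding t_def by (cases "jump_time \<omega> (Suc n)") (auto simp del: jump_time.simps)
    qed
  qed
  have "(\<lambda>\<omega>. if jump_time \<omega> (Suc n) < \<infinity> then f ((t \<omega>, nth_state X n \<omega>), nth_state X (Suc n) \<omega>) else 0)
    \<in> borel_measurable (trajectories X)"
    using t f by (simp del: jump_time.simps)
  then show ?thesis by (simp add: t_def if_distrib cong: if_cong del: jump_time.simps)
qed

lemma jump_time_eq_real:
  assumes "\<omega> \<in> space (trajectories X)" "jump_time \<omega> n < \<infinity>"
  shows "ereal (rtime \<omega> n) = jump_time \<omega> n"
  using jump_time_nonneg[OF assms(1), of n] assms(2) by (cases "jump_time \<omega> n") auto

lemma pre_sojourn_jump_time: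
  assumes "\<omega> \<in> space (trajectories X)" "jump_time \<omega> (Suc n) < \<infinity>"
  shows "0 < rtime \<omega> (Suc n)"
    and "pre_sojourn n \<omega> (rtime \<omega> (Suc n))"
proof -
  have "0 < ereal (rtime \<omega> (Suc n))"
    unfolding jump_time_eq_real[OF assms] by (rule jump_time_Suc_pos[OF assms(1)])
  then show "0 < rtime \<omega> (Suc n)" by simp
  have "jump_time \<omega> n < \<infinity>" using jump_time_le_Suc[OF assms(1)] assms(2) by (rule le_less_trans)
  then show "pre_sojourn n \<omega> (rtime \<omega> (Suc n))"
    unfolding pre_sojourn_def jump_time_eq_real[OF assms] using jump_time_less_Suc[OF assms(1)] by simp
qed

context CTJMDP
begin

lemma AE_no_jump_if_null_intensity:
  assumes P: "process_law X Act q \<gamma> \<pi> P" and \<kappa>: "policy_kernel X A \<pi> \<kappa>"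
    and f: "f \<in> borel_measurable (jumps X)"
    and null: "\<And>\<omega>. \<omega> \<in> space (trajectories X) \<Longrightarrow>
      AE s in pos_lborel. \<forall>n. intens_at (\<kappa> (\<omega>, s)) s f (nth_state X n \<omega>) = 0"
  shows "AE \<omega> in P. \<forall>n. jump_time \<omega> (Suc n) < \<infinity> \<longrightarrow> at_jump X f \<omega> n = 0"
proof -
  note sp = space_process_law[OF P]
  have one: "(\<lambda>_. 1) \<in> borel_measurable (predictable_sets X)" by simp
  have "(\<integral>\<^sup>+\<omega>. (\<Sum>n. if jump_time \<omega> (Suc n) < \<infinity> then at_jump X f \<omega> n else 0) \<partial>P) =
      (\<integral>\<^sup>+\<omega>. \<integral>\<^sup>+s. (\<Sum>n. if sojourn n \<omega> s then intens_at (\<kappa> (\<omega>, s)) s f (nth_state X n \<omega>) else 0) \<partial>pos_lborel \<partial>P)"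
    using compensation[OF P \<kappa> one f] unfolding mult_1_left .
  also have "\<dots> = (\<integral>\<^sup>+\<omega>. \<integral>\<^sup>+s. 0 \<partial>pos_lborel \<partial>P)"
  proof (rule nn_integral_cong, rule nn_integral_cong_AE)
    fix \<omega> assume "\<omega> \<in> space P"
    from null[OF this[unfolded sp(2)]]
    show "AE s in pos_lborel. (\<Sum>n. if sojourn n \<omega> s then intens_at (\<kappa> (\<omega>, s)) s f (nth_state X n \<omega>) else 0) = 0"
      by (rule eventually_mono) (simp cong: if_cong)
  qed
  also have "\<dots> = 0" by simp
  finally have "AE \<omega> in P. (\<Sum>n. if jump_time \<omega> (Suc n) < \<infinity> then at_jump X f \<omega> n else 0) = 0"
    using measurable_jump_fun[OF f] sp(1)
    by (subst (asm) nn_integral_0_iff_AE) (auto cong: measurable_cong_sets simp del: jump_time.simps)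
  then show ?thesis
  proof (rule eventually_mono, intro allI impI)
    fix \<omega> n assume *: "(\<Sum>n. if jump_time \<omega> (Suc n) < \<infinity> then at_jump X f \<omega> n else 0) = 0"
      and n: "jump_time \<omega> (Suc n) < \<infinity>"
    have "(if jump_time \<omega> (Suc n) < \<infinity> then at_jump X f \<omega> n else 0) = 0"
      using * by (subst (asm) suminf_eq_zero_iff) (auto simp del: jump_time.simps)
    then show "at_jump X f \<omega> n = 0" using n by (simp del: jump_time.simps)
  qed
qed

text \<open>
  The intensity does not charge the current state, so almost surely every jump changes the state.
\<close>

lemma AE_jump_visible:
  assumes P: "process_law X Act q \<gamma> \<pi> P" and \<kappa>: "policy_kernel X A \<pi> \<kappa>"
  shows "AE \<omega> in P. \<forall>n. jump_time \<omega> (Suc n) < \<infinity> \<longrightarrow> nth_state X n \<omega> \<noteq> nth_state X (Suc n) \<omega>"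
proof -
  define f :: "(real \<times> 'x) \<times> 'x \<Rightarrow> ennreal" where "f = (\<lambda>p. indicator {p \<in> space (X \<Otimes>\<^sub>M X). fst p = snd p} (snd (fst p), snd p))"
  note [measurable] = standard_borel_diagonal[OF standard_borel_X]
  have f: "f \<in> borel_measurable (jumps X)"
    unfolding f_def by measurable
  have z: "intens_at k s f z = 0" if "z \<in> space X" for k z s
  proof -
    have "intens_at k s f z = intens k z (indicator {z})"
      using that by (intro intens_cong) (auto simp: f_def space_pair_measure indicator_def)
    also have "\<dots> = 0"
      using that by (simp add: intens_indicator singleton_sets emeasure_jump_kernel signed_measure_empty[OF q_signed] cong: if_cong)
    finally show ?thesis .
  qed
  have null: "AE \<omega> in P. \<forall>n. jump_time \<omega> (Suc n) < \<infinity> \<longrightarrow> at_jump X f \<omega> n = 0"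
    by (rule AE_no_jump_if_null_intensity[OF P \<kappa> f]) (simp add: z nth_state_in_space)
  from AE_trajectory[OF P] null show ?thesis
  proof eventually_elim
    case (elim \<omega>)
    have "nth_state X n \<omega> = nth_state X (Suc n) \<omega> \<Longrightarrow> at_jump X f \<omega> n = 1" for n
      using nth_state_in_space[OF elim(1)] by (simp add: f_def space_pair_measure)
    then show ?case using elim(2) by fastforce
  qed
qed

text \<open>
  At a fixed time the state and the state before that time agree almost surely.  This matters for
  Markov policies, which choose actions by the state before.
\<close>

lemma AE_no_jump_at_fixed_time:
  assumes P: "process_law X Act q \<gamma> \<pi> P" and \<kappa>: "policy_kernel X A \<pi> \<kappa>" and t: "0 < t"
  shows "AE \<omega> in P. \<forall>n. sojourn n \<omega> t \<longrightarrow> pre_sojourn n \<omega> t"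
proof -
  define f :: "(real \<times> 'x) \<times> 'x \<Rightarrow> ennreal" where "f = (\<lambda>p. indicator {t} (fst (fst p)))"
  have f: "f \<in> borel_measurable (jumps X)"
    unfolding f_def by measurable
  have "AE s in pos_lborel. \<forall>n. intens_at (\<kappa> (\<omega>, s)) s f (nth_state X n \<omega>) = 0" for \<omega>
    using AE_pos_lborel_countable[of "{t}"] by (rule eventually_mono) (auto simp: f_def intens_def)
  from AE_no_jump_if_null_intensity[OF P \<kappa> f this] show ?thesis
  proof (rule eventually_mono)
    fix \<omega> assume *: "\<forall>n. jump_time \<omega> (Suc n) < \<infinity> \<longrightarrow> at_jump X f \<omega> n = 0"
    have "jump_time \<omega> n \<noteq> ereal t" for n
      using t *[rule_format, of "n - 1"] by (cases n) (auto simp: f_def simp del: jump_time.simps(2))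
    then show "\<forall>n. sojourn n \<omega> t \<longrightarrow> pre_sojourn n \<omega> t" by (auto simp: sojourn_def pre_sojourn_def less_le)
  qed
qed

text \<open>
  For a trajectory \<open>\<omega>\<close>, the law of the pair of its state at time \<open>s\<close> and an action drawn from \<open>k \<omega>\<close>;
  the zero measure from the explosion on.
\<close>

definition state_action_kernel :: "real \<Rightarrow> ('x trajectory \<Rightarrow> 'a measure) \<Rightarrow> 'x trajectory \<Rightarrow> ('x \<times> 'a) measure" where
  "state_action_kernel s k \<omega> = (case state \<omega> s of None \<Rightarrow> null_measure (X \<Otimes>\<^sub>M A)
     | Some z \<Rightarrow> distr (k \<omega>) (X \<Otimes>\<^sub>M A) (Pair z))"

lemma measurable_state_action_kernel:
  assumes k: "k \<in> measurable (trajectories X) (subprob_algebra A)" and ne: "space X \<noteq> {}"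
  shows "state_action_kernel s k \<in> measurable (trajectories X) (subprob_algebra (X \<Otimes>\<^sub>M A))"
proof -
  note [measurable] = measurable_point_of[OF ne] k
  have "(\<lambda>\<omega>. null_measure (X \<Otimes>\<^sub>M A)) \<in> measurable (trajectories X) (subprob_algebra (X \<Otimes>\<^sub>M A))"
    using ne space_A_not_empty by (intro measurable_const) (auto simp: space_pair_measure)
  moreover have "(\<lambda>\<omega>. distr (k \<omega>) (X \<Otimes>\<^sub>M A) (\<lambda>a. (point_of X (state \<omega> s), a)))
      \<in> measurable (trajectories X) (subprob_algebra (X \<Otimes>\<^sub>M A))"
    by (rule measurable_distr2[where M=A]) measurable
  moreover have "{\<omega> \<in> space (trajectories X). state \<omega> s \<in> {None}} \<in> sets (trajectories X)" by measurable
  ultimately have "(\<lambda>\<omega>. if state \<omega> s \<in> {None} then null_measure (X \<Otimes>\<^sub>M A)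
      else distr (k \<omega>) (X \<Otimes>\<^sub>M A) (\<lambda>a. (point_of X (state \<omega> s), a)))
      \<in> measurable (trajectories X) (subprob_algebra (X \<Otimes>\<^sub>M A))"
    by (rule measurable_If)
  then show ?thesis
    by (rule measurable_cong[THEN iffD1, rotated]) (auto simp: state_action_kernel_def split: option.split)
qed

lemma nn_integral_state_action_kernel:
  assumes \<omega>: "\<omega> \<in> space (trajectories X)" and k: "sets (k \<omega>) = sets A" and g: "g \<in> borel_measurable (X \<Otimes>\<^sub>M A)"
  shows "(\<integral>\<^sup>+p. g p \<partial>state_action_kernel s k \<omega>) =
    (case state \<omega> s of None \<Rightarrow> 0 | Some z \<Rightarrow> \<integral>\<^sup>+a. g (z, a) \<partial>k \<omega>)"
proof (cases "state \<omega> s")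
  case (Some z)
  have "Pair z \<in> measurable (k \<omega>) (X \<Otimes>\<^sub>M A)"
    using measurable_Pair1'[OF state_in_space[OF \<omega> Some], of A] k by (simp cong: measurable_cong_sets)
  then show ?thesis using g by (simp add: state_action_kernel_def Some nn_integral_distr)
qed (simp add: state_action_kernel_def)

text \<open>
  The joint law of state and action is determined by its values on rectangles.
\<close>

lemma state_action_laws_eqI:
  assumes P: "process_law X Act q \<gamma> \<pi> P"
    and k: "k \<in> measurable (trajectories X) (subprob_algebra A)"
    and k': "k' \<in> measurable (trajectories X) (subprob_algebra A)"
    and eq: "\<And>Z B. Z \<in> sets X \<Longrightarrow> B \<in> sets A \<Longrightarrow>
      (\<integral>\<^sup>+\<omega>. indicator (Some ` Z) (state \<omega> s) * emeasure (k \<omega>) B \<partial>P) =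
      (\<integral>\<^sup>+\<omega>. indicator (Some ` Z) (state \<omega> s) * emeasure (k' \<omega>) B \<partial>P)"
    and g: "g \<in> borel_measurable (X \<Otimes>\<^sub>M A)"
  shows "(\<integral>\<^sup>+\<omega>. (case state \<omega> s of None \<Rightarrow> 0 | Some z \<Rightarrow> \<integral>\<^sup>+a. g (z, a) \<partial>k \<omega>) \<partial>P) =
    (\<integral>\<^sup>+\<omega>. (case state \<omega> s of None \<Rightarrow> 0 | Some z \<Rightarrow> \<integral>\<^sup>+a. g (z, a) \<partial>k' \<omega>) \<partial>P)"
proof -
  note sp = space_process_law[OF P]
  interpret prob_space P by (rule sp(3))
  have neP: "space P \<noteq> {}" using sp by simp
  have K: "state_action_kernel s j \<in> measurable P (subprob_algebra (X \<Otimes>\<^sub>M A))"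
    if "j \<in> measurable (trajectories X) (subprob_algebra A)" for j
    using measurable_state_action_kernel[OF that sp(5)] sp(1) by (simp cong: measurable_cong_sets)
  have setsk: "sets (j \<omega>) = sets A" if "j \<in> measurable (trajectories X) (subprob_algebra A)" "\<omega> \<in> space (trajectories X)" for j \<omega>
    using sets_kernel[OF that] .
  have int: "(\<integral>\<^sup>+p. h p \<partial>(P \<bind> state_action_kernel s j)) =
      (\<integral>\<^sup>+\<omega>. (case state \<omega> s of None \<Rightarrow> 0 | Some z \<Rightarrow> \<integral>\<^sup>+a. h (z, a) \<partial>j \<omega>) \<partial>P)"
    if "j \<in> measurable (trajectories X) (subprob_algebra A)" "h \<in> borel_measurable (X \<Otimes>\<^sub>M A)" for j h
    using nn_integral_bind[OF that(2) K[OF that(1)]] sp(2) setsk[OF that(1)]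
    by (simp add: nn_integral_state_action_kernel that cong: nn_integral_cong_simp)
  have rect: "emeasure (P \<bind> state_action_kernel s j) (Z \<times> B) =
      (\<integral>\<^sup>+\<omega>. indicator (Some ` Z) (state \<omega> s) * emeasure (j \<omega>) B \<partial>P)"
    if j: "j \<in> measurable (trajectories X) (subprob_algebra A)" and Z: "Z \<in> sets X" and B: "B \<in> sets A" for j Z B
  proof -
    have sb: "sets (P \<bind> state_action_kernel s j) = sets (X \<Otimes>\<^sub>M A)"
      using sets_kernel[OF K[OF j]] neP by (intro sets_bind) auto
    have "emeasure (P \<bind> state_action_kernel s j) (Z \<times> B) = (\<integral>\<^sup>+p. indicator (Z \<times> B) p \<partial>(P \<bind> state_action_kernel s j))"
      using Z B sb by simp
    also have "\<dots> = (\<integral>\<^sup>+\<omega>. (case state \<omega> s of None \<Rightarrow> 0 | Some z \<Rightarrow> \<integral>\<^sup>+a. indicator (Z \<times> B) (z, a) \<partial>j \<omega>) \<partial>P)"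
      using Z B by (intro int[OF j]) simp
    also have "\<dots> = (\<integral>\<^sup>+\<omega>. indicator (Some ` Z) (state \<omega> s) * emeasure (j \<omega>) B \<partial>P)"
    proof (rule nn_integral_cong)
      fix \<omega> assume "\<omega> \<in> space P"
      then have "sets (j \<omega>) = sets A" using setsk[OF j] sp(2) by simp
      then have "(\<integral>\<^sup>+a. indicator (Z \<times> B) (z, a) \<partial>j \<omega>) = indicator Z z * emeasure (j \<omega>) B" for z
        using B by (simp add: indicator_times nn_integral_cmult)
      then show "(case state \<omega> s of None \<Rightarrow> 0 | Some z \<Rightarrow> \<integral>\<^sup>+a. indicator (Z \<times> B) (z, a) \<partial>j \<omega>) =
          indicator (Some ` Z) (state \<omega> s) * emeasure (j \<omega>) B"
        by (auto split: option.split simp: indicator_def)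
    qed
    finally show ?thesis .
  qed
  have "P \<bind> state_action_kernel s k = P \<bind> state_action_kernel s k'"
  proof (rule measure_eqI_generator_eq[OF Int_stable_pair_measure_generator[of X A], where \<Omega>="space X \<times> space A" and A="\<lambda>_. space X \<times> space A"])
    show "{a \<times> b |a b. a \<in> sets X \<and> b \<in> sets A} \<subseteq> Pow (space X \<times> space A)"
      by (rule pair_measure_closed)
    show "sets (P \<bind> state_action_kernel s k) = sigma_sets (space X \<times> space A) {a \<times> b |a b. a \<in> sets X \<and> b \<in> sets A}"
      "sets (P \<bind> state_action_kernel s k') = sigma_sets (space X \<times> space A) {a \<times> b |a b. a \<in> sets X \<and> b \<in> sets A}"
      using sets_kernel[OF K[OF k]] sets_kernel[OF K[OF k']] neP
      by (subst sets_bind[where N="X \<Otimes>\<^sub>M A"]; auto simp: sets_pair_measure)+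
    show "range (\<lambda>_. space X \<times> space A) \<subseteq> {a \<times> b |a b. a \<in> sets X \<and> b \<in> sets A}" by blast
    show "(\<Union>i::nat. space X \<times> space A) = space X \<times> space A" by simp
    fix i :: nat
    show "emeasure (P \<bind> state_action_kernel s k) (space X \<times> space A) \<noteq> \<infinity>"
    proof -
      have "subprob_space (P \<bind> state_action_kernel s k)"
        using K[OF k] M_in_subprob by (intro subprob_space_bind[where N="X \<Otimes>\<^sub>M A"]) (simp_all add: subprob_space_axioms)
      then show ?thesis using subprob_space.emeasure_subprob_space_less_top by (metis infinity_ennreal_def)
    qed
  next
    fix D assume "D \<in> {a \<times> b |a b. a \<in> sets X \<and> b \<in> sets A}"
    then obtain Z B where "D = Z \<times> B" "Z \<in> sets X" "B \<in> sets A" by blast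
    then show "emeasure (P \<bind> state_action_kernel s k) D = emeasure (P \<bind> state_action_kernel s k') D"
      using rect[OF k] rect[OF k'] eq by simp
  qed
  then show ?thesis using int[OF k g] int[OF k' g] by simp
qed

end

section \<open>Balance of jumps under a Markov kernel\<close>

text \<open>
  A model with a Markov kernel \<open>\<phi>'\<close>, by which the action is chosen at a given state and time.  Nothing is
  assumed about its concentration on available actions, as unavailable actions have intensity 0.
\<close>

locale CTJMDP_kernel = CTJMDP X A Act q
  for X :: "'x measure" and A :: "'a measure" and Act q +
  fixes \<phi>' :: "'x \<times> real \<Rightarrow> 'a measure"
  assumes \<phi>': "\<phi>' \<in> measurable (X \<Otimes>\<^sub>M pos_reals) (prob_algebra A)"
    and finite_rate: "x \<in> space X \<Longrightarrow> max_jump_rate X Act q x < \<infinity>"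
begin

lemma measurable_markov_kernel: "\<phi>' \<in> measurable (X \<Otimes>\<^sub>M pos_reals) (subprob_algebra A)"
  using \<phi>' by (rule measurable_prob_algebraD)

lemma markov_kernel:
  assumes "z \<in> space X" "0 < s"
  shows "sets (\<phi>' (z, s)) = sets A" "prob_space (\<phi>' (z, s))"
  using measurable_space[OF \<phi>', of "(z, s)"] assms by (auto simp: space_pair_measure space_prob_algebra)

text \<open>The integral of \<open>f\<close> against the jump intensity from \<open>z\<close> at time \<open>s\<close> under the Markov kernel.\<close>

definition markov_int :: "real \<Rightarrow> 'x \<Rightarrow> ('x \<Rightarrow> ennreal) \<Rightarrow> ennreal" where
  "markov_int s z f = intens (\<phi>' (z, s)) z f"

text \<open>As for \<open>intens_at\<close>, and the sum over the current visit if its index is in \<open>I\<close>.\<close>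

abbreviation markov_int_at :: "real \<Rightarrow> ((real \<times> 'x) \<times> 'x \<Rightarrow> ennreal) \<Rightarrow> 'x \<Rightarrow> ennreal" where
  "markov_int_at s f z \<equiv> markov_int s z (\<lambda>y. f ((s, z), y))"

abbreviation markov_int_sum :: "nat set \<Rightarrow> ((real \<times> 'x) \<times> 'x \<Rightarrow> ennreal) \<Rightarrow> 'x trajectory \<Rightarrow> real \<Rightarrow> ennreal" where
  "markov_int_sum I f \<omega> s \<equiv> \<Sum>n. if n \<in> I \<and> sojourn n \<omega> s then markov_int_at s f (nth_state X n \<omega>) else 0"

lemma measurable_markov_int:
  assumes f: "(\<lambda>(m, y). f m y) \<in> borel_measurable (M \<Otimes>\<^sub>M X)"
    and t: "t \<in> measurable M pos_reals" and g: "g \<in> measurable M X"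
  shows "(\<lambda>m. markov_int (t m) (g m) (f m)) \<in> borel_measurable M"
  unfolding markov_int_def
  by (rule measurable_intens[OF f _ g], rule measurable_compose[OF _ measurable_markov_kernel])
    (use t g in measurable)

text \<open>
  In expectation, and as far as the jumps out of visits with index in \<open>I\<close> are concerned, the process
  has the intensities of the Markov kernel.
\<close>

definition jump_balance :: "'x trajectory measure \<Rightarrow> nat set \<Rightarrow> bool" where
  "jump_balance P I \<longleftrightarrow> (\<forall>f \<in> borel_measurable (jumps X).
    (\<integral>\<^sup>+\<omega>. jump_sum X I f \<omega> \<partial>P) =
    (\<integral>\<^sup>+s. \<integral>\<^sup>+\<omega>. markov_int_sum I f \<omega> s \<partial>P \<partial>pos_lborel))"

text \<open>
  An action drawn from \<open>\<kappa>\<close> at time \<open>s\<close> has, given the state at time \<open>s\<close> alone, the distribution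
  prescribed by the Markov kernel.
\<close>

definition markov_marginals :: "'x trajectory measure \<Rightarrow> ('x trajectory \<times> real \<Rightarrow> 'a measure) \<Rightarrow> bool" where
  "markov_marginals P \<kappa> \<longleftrightarrow> (\<forall>s>0. \<forall>g \<in> borel_measurable (X \<Otimes>\<^sub>M A).
    (\<integral>\<^sup>+\<omega>. (case state \<omega> s of None \<Rightarrow> 0 | Some z \<Rightarrow> \<integral>\<^sup>+a. g (z, a) \<partial>\<kappa> (\<omega>, s)) \<partial>P) =
    (\<integral>\<^sup>+\<omega>. (case state \<omega> s of None \<Rightarrow> 0 | Some z \<Rightarrow> \<integral>\<^sup>+a. g (z, a) \<partial>\<phi>' (z, s)) \<partial>P))"

lemma Fubini_trajectories:
  assumes P: "process_law X Act q \<gamma> \<pi> P"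
    and h: "(\<lambda>(\<omega>, s). h \<omega> s) \<in> borel_measurable (timed X)"
  shows "(\<integral>\<^sup>+\<omega>. \<integral>\<^sup>+s. h \<omega> s \<partial>pos_lborel \<partial>P) = (\<integral>\<^sup>+s. \<integral>\<^sup>+\<omega>. h \<omega> s \<partial>P \<partial>pos_lborel)"
proof -
  note sp = space_process_law[OF P]
  interpret P: prob_space P by (rule sp(3))
  interpret L: sigma_finite_measure pos_lborel by (rule sigma_finite_pos_lborel)
  interpret pair_sigma_finite P pos_lborel ..
  have "sets (P \<Otimes>\<^sub>M pos_lborel) = sets (timed X)"
    using sp(1) by (intro sets_pair_measure_cong) auto
  then have "case_prod h \<in> borel_measurable (P \<Otimes>\<^sub>M pos_lborel)"
    using h by (simp cong: measurable_cong_sets)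
  then show ?thesis using Fubini' by simp
qed

lemma measurable_sojourn_sum:
  assumes "\<And>n. h n \<in> borel_measurable (timed X)"
  shows "(\<lambda>p. \<Sum>n. if n \<in> I \<and> sojourn n (fst p) (snd p) then h n p else (0 :: ennreal))
    \<in> borel_measurable (timed X)"
proof -
  note [measurable] = assms
  have "Measurable.pred (timed X) (\<lambda>p. sojourn n (fst p) (snd p))" for n
    unfolding sojourn_def by measurable
  note [measurable] = this
  show ?thesis by measurable
qed

lemma measurable_markov_int_nth_state:
  assumes f: "f \<in> borel_measurable (jumps X)"
  shows "(\<lambda>p. markov_int (snd p) (nth_state X n (fst p)) (\<lambda>y. f ((snd p, nth_state X n (fst p)), y)))
    \<in> borel_measurable (timed X)"
proof (rule measurable_markov_int)
  have "(\<lambda>p. f ((snd (fst p), nth_state X n (fst (fst p))), snd p))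
      \<in> borel_measurable ((timed X) \<Otimes>\<^sub>M X)"
    by (rule measurable_compose[OF _ f]) measurable
  then show "(\<lambda>(p, y). f ((snd p, nth_state X n (fst p)), y)) \<in> borel_measurable ((timed X) \<Otimes>\<^sub>M X)"
    by (simp add: case_prod_beta')
qed measurable

text \<open>
  The balance of all jumps needs only the joint law of state and action at each single time.
\<close>

lemma jump_balance_UNIV:
  assumes P: "process_law X Act q \<gamma> \<pi> P" and \<kappa>: "policy_kernel X A \<pi> \<kappa>"
    and marg: "markov_marginals P \<kappa>"
  shows "jump_balance P UNIV"
  unfolding jump_balance_def
proof
  fix f :: "(real \<times> 'x) \<times> 'x \<Rightarrow> ennreal" assume f: "f \<in> borel_measurable (jumps X)"
  note sp = space_process_law[OF P]
  have one: "(\<lambda>_. 1) \<in> borel_measurable (predictable_sets X)" by simp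
  have meas: "(\<lambda>p. \<Sum>n. if sojourn n (fst p) (snd p) then
        intens (\<kappa> p) (nth_state X n (fst p)) (\<lambda>y. f ((snd p, nth_state X n (fst p)), y)) else 0)
      \<in> borel_measurable (timed X)"
  proof -
    have "(\<lambda>p. intens (\<kappa> p) (nth_state X n (fst p)) (\<lambda>y. f ((snd p, nth_state X n (fst p)), y)))
      \<in> borel_measurable (timed X)" for n
    proof (rule measurable_intens)
      have "(\<lambda>p. f ((snd (fst p), nth_state X n (fst (fst p))), snd p))
          \<in> borel_measurable ((timed X) \<Otimes>\<^sub>M X)"
        by (rule measurable_compose[OF _ f]) measurable
      then show "(\<lambda>(p, y). f ((snd p, nth_state X n (fst p)), y)) \<in> borel_measurable ((timed X) \<Otimes>\<^sub>M X)"
        by (simp add: case_prod_beta')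
      show "\<kappa> \<in> measurable (timed X) (subprob_algebra A)"
        by (rule policy_kernelD[OF \<kappa>])
    qed measurable
    from measurable_sojourn_sum[OF this, of UNIV] show ?thesis by simp
  qed
  have "(\<integral>\<^sup>+\<omega>. (\<Sum>n. if jump_time \<omega> (Suc n) < \<infinity> then at_jump X f \<omega> n else 0) \<partial>P) =
      (\<integral>\<^sup>+\<omega>. \<integral>\<^sup>+s. (\<Sum>n. if sojourn n \<omega> s then intens_at (\<kappa> (\<omega>, s)) s f (nth_state X n \<omega>) else 0) \<partial>pos_lborel \<partial>P)"
    using compensation[OF P \<kappa> one f] unfolding mult_1_left .
  also have "\<dots> = (\<integral>\<^sup>+s. \<integral>\<^sup>+\<omega>. (\<Sum>n. if sojourn n \<omega> s then intens_at (\<kappa> (\<omega>, s)) s f (nth_state X n \<omega>) else 0) \<partial>P \<partial>pos_lborel)"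
    using meas by (intro Fubini_trajectories[OF P]) (simp add: case_prod_beta' cong: if_cong)
  also have "\<dots> = (\<integral>\<^sup>+s. \<integral>\<^sup>+\<omega>. (\<Sum>n. if sojourn n \<omega> s then
        markov_int_at s f (nth_state X n \<omega>) else 0) \<partial>P \<partial>pos_lborel)"
  proof (rule nn_integral_cong)
    fix s assume "s \<in> space pos_lborel"
    then have s: "0 < s" by simp
    let ?g = "\<lambda>p. \<integral>\<^sup>+y. f ((s, fst p), y) \<partial>jump_kernel (fst p) (snd p)"
    have g: "?g \<in> borel_measurable (X \<Otimes>\<^sub>M A)"
    proof (rule measurable_nn_integral_jump_kernel)
      have "(\<lambda>p. f ((s, fst (fst p)), snd p)) \<in> borel_measurable ((X \<Otimes>\<^sub>M A) \<Otimes>\<^sub>M X)"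
        using s by (intro measurable_compose[OF _ f]) simp
      then show "(\<lambda>(p, y). f ((s, fst p), y)) \<in> borel_measurable ((X \<Otimes>\<^sub>M A) \<Otimes>\<^sub>M X)"
        by (simp add: case_prod_beta')
    qed measurable
    have "(\<integral>\<^sup>+\<omega>. (\<Sum>n. if sojourn n \<omega> s then intens_at (\<kappa> (\<omega>, s)) s f (nth_state X n \<omega>) else 0) \<partial>P) =
      (\<integral>\<^sup>+\<omega>. (case state \<omega> s of None \<Rightarrow> 0 | Some z \<Rightarrow> \<integral>\<^sup>+a. ?g (z, a) \<partial>\<kappa> (\<omega>, s)) \<partial>P)"
    proof (rule nn_integral_cong_law[OF P])
      fix \<omega> assume \<omega>: "\<omega> \<in> space (trajectories X)"
      show "(\<Sum>n. if sojourn n \<omega> s then intens_at (\<kappa> (\<omega>, s)) s f (nth_state X n \<omega>) else 0) =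
        (case state \<omega> s of None \<Rightarrow> 0 | Some z \<Rightarrow> \<integral>\<^sup>+a. ?g (z, a) \<partial>\<kappa> (\<omega>, s))"
        using sum_sojourn_eq_case_state[OF \<omega>, of s "\<lambda>z. intens (\<kappa> (\<omega>, s)) z (\<lambda>y. f ((s, z), y))"]
        unfolding intens_def fst_conv snd_conv .
    qed
    also have "\<dots> = (\<integral>\<^sup>+\<omega>. (case state \<omega> s of None \<Rightarrow> 0 | Some z \<Rightarrow> \<integral>\<^sup>+a. ?g (z, a) \<partial>\<phi>' (z, s)) \<partial>P)"
      by (rule marg[unfolded markov_marginals_def, rule_format, OF s g])
    also have "\<dots> = (\<integral>\<^sup>+\<omega>. (\<Sum>n. if sojourn n \<omega> s then
        markov_int_at s f (nth_state X n \<omega>) else 0) \<partial>P)"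
    proof (rule nn_integral_cong_law[OF P])
      fix \<omega> assume \<omega>: "\<omega> \<in> space (trajectories X)"
      show "(case state \<omega> s of None \<Rightarrow> 0 | Some z \<Rightarrow> \<integral>\<^sup>+a. ?g (z, a) \<partial>\<phi>' (z, s)) =
        (\<Sum>n. if sojourn n \<omega> s then markov_int_at s f (nth_state X n \<omega>) else 0)"
        using sum_sojourn_eq_case_state[OF \<omega>, of s "\<lambda>z. markov_int s z (\<lambda>y. f ((s, z), y))", symmetric]
        unfolding markov_int_def intens_def fst_conv snd_conv .
    qed
    finally show "(\<integral>\<^sup>+\<omega>. (\<Sum>n. if sojourn n \<omega> s then intens_at (\<kappa> (\<omega>, s)) s f (nth_state X n \<omega>) else 0) \<partial>P) =
      (\<integral>\<^sup>+\<omega>. (\<Sum>n. if sojourn n \<omega> s then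
        markov_int_at s f (nth_state X n \<omega>) else 0) \<partial>P)" .
  qed
  finally show "(\<integral>\<^sup>+\<omega>. jump_sum X UNIV f \<omega> \<partial>P) =
    (\<integral>\<^sup>+s. \<integral>\<^sup>+\<omega>. markov_int_sum UNIV f \<omega> s \<partial>P \<partial>pos_lborel)"
    by (simp only: UNIV_I simp_thms)
qed

text \<open>
  Under a policy that is Markov with this kernel, the action distribution is a function of the time
  and the state before along every path, so the balance also holds for the first \<open>N\<close> jumps alone.
\<close>

lemma jump_balance_markov:
  assumes P: "process_law X Act q \<gamma> \<phi> P" and \<kappa>: "policy_kernel X A \<phi> \<kappa>"
    and \<kappa>\<phi>: "\<And>\<omega> s n. \<omega> \<in> space (trajectories X) \<Longrightarrow> 0 < s \<Longrightarrow> pre_sojourn n \<omega> s \<Longrightarrow> \<kappa> (\<omega>, s) = \<phi>' (nth_state X n \<omega>, s)"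
  shows "jump_balance P {..<N}"
  unfolding jump_balance_def
proof
  fix f :: "(real \<times> 'x) \<times> 'x \<Rightarrow> ennreal" assume f: "f \<in> borel_measurable (jumps X)"
  note sp = space_process_law[OF P]
  \<comment> \<open>The predictable weight that selects the times up to the \<open>N\<close>-th jump.\<close>
  define w :: "'x trajectory \<times> real \<Rightarrow> ennreal" where
    "w = indicator (space (predictable_sets X) - {p \<in> space (predictable_sets X). changes N (fst p) (snd p)})"
  have w: "w \<in> borel_measurable (predictable_sets X)"
    unfolding w_def
    by (intro borel_measurable_indicator sets.Diff sets.top changes_predictable[OF standard_borel_X])
  have weq: "w (\<omega>, s) = (if n < N then 1 else 0)"
    if \<omega>: "\<omega> \<in> space (trajectories X)"
      and good: "\<forall>n. jump_time \<omega> (Suc n) < \<infinity> \<longrightarrow> nth_state X n \<omega> \<noteq> nth_state X (Suc n) \<omega>"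
      and s: "0 < s" "pre_sojourn n \<omega> s" for \<omega> s n
    using changes_iff[OF \<omega> _ s, of N] good \<omega> s(1) by (auto simp: w_def indicator_def)
  note AEP = AE_trajectory[OF P]
  have "(\<integral>\<^sup>+\<omega>. jump_sum X {..<N} f \<omega> \<partial>P) =
      (\<integral>\<^sup>+\<omega>. (\<Sum>n. if jump_time \<omega> (Suc n) < \<infinity> then
        w (\<omega>, rtime \<omega> (Suc n)) *
        at_jump X f \<omega> n else 0) \<partial>P)"
  proof (rule nn_integral_cong_AE)
    show "AE \<omega> in P. jump_sum X {..<N} f \<omega> =
      (\<Sum>n. if jump_time \<omega> (Suc n) < \<infinity> then w (\<omega>, rtime \<omega> (Suc n)) *
        at_jump X f \<omega> n else 0)"
      using AE_jump_visible[OF P \<kappa>] AEP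
    proof eventually_elim
      case (elim \<omega>)
      show ?case
      proof (rule suminf_cong)
        fix n
        show "(if n \<in> {..<N} \<and> jump_time \<omega> (Suc n) < \<infinity> then
            at_jump X f \<omega> n else 0) =
          (if jump_time \<omega> (Suc n) < \<infinity> then w (\<omega>, rtime \<omega> (Suc n)) *
            at_jump X f \<omega> n else 0)"
        proof (cases "jump_time \<omega> (Suc n) < \<infinity>")
          case True
          then show ?thesis
            unfolding weq[OF elim(2,1) pre_sojourn_jump_time[OF elim(2) True]] by (simp del: jump_time.simps)
        qed (simp del: jump_time.simps)
      qed
    qed
  qed
  also have "\<dots> = (\<integral>\<^sup>+\<omega>. \<integral>\<^sup>+s. (\<Sum>n. if sojourn n \<omega> s then w (\<omega>, s) * intens_at (\<kappa> (\<omega>, s)) s f (nth_state X n \<omega>) else 0) \<partial>pos_lborel \<partial>P)"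
    by (rule compensation[OF P \<kappa> w f])
  also have "\<dots> = (\<integral>\<^sup>+\<omega>. \<integral>\<^sup>+s. markov_int_sum {..<N} f \<omega> s \<partial>pos_lborel \<partial>P)"
  proof (rule nn_integral_cong_AE)
    show "AE \<omega> in P. (\<integral>\<^sup>+s. (\<Sum>n. if sojourn n \<omega> s then w (\<omega>, s) * intens_at (\<kappa> (\<omega>, s)) s f (nth_state X n \<omega>) else 0) \<partial>pos_lborel) =
      (\<integral>\<^sup>+s. markov_int_sum {..<N} f \<omega> s \<partial>pos_lborel)"
      using AE_jump_visible[OF P \<kappa>] AEP
    proof eventually_elim
      case (elim \<omega>)
      show ?case
      proof (rule nn_integral_cong_AE)
        have "AE s in pos_lborel. 0 < s" by (rule AE_I2) simp
        with AE_not_jump_time[OF elim(2)]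
        show "AE s in pos_lborel. (\<Sum>n. if sojourn n \<omega> s then w (\<omega>, s) * intens_at (\<kappa> (\<omega>, s)) s f (nth_state X n \<omega>) else 0) =
          markov_int_sum {..<N} f \<omega> s"
        proof eventually_elim
          fix s assume s: "\<forall>n. sojourn n \<omega> s \<longrightarrow> pre_sojourn n \<omega> s" "0 < s"
          show "(\<Sum>n. if sojourn n \<omega> s then w (\<omega>, s) * intens_at (\<kappa> (\<omega>, s)) s f (nth_state X n \<omega>) else 0) =
          markov_int_sum {..<N} f \<omega> s"
          proof (rule suminf_cong)
            fix n
            show "(if sojourn n \<omega> s then
                w (\<omega>, s) * intens_at (\<kappa> (\<omega>, s)) s f (nth_state X n \<omega>) else 0) =
              (if n \<in> {..<N} \<and> sojourn n \<omega> s then markov_int_at s f (nth_state X n \<omega>) else 0)"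
            proof (cases "sojourn n \<omega> s")
              case True
              then have ps: "pre_sojourn n \<omega> s" using s(1) by blast
              show ?thesis
                unfolding weq[OF elim(2,1) s(2) ps] \<kappa>\<phi>[OF elim(2) s(2) ps] markov_int_def using True by simp
            qed simp
          qed
        qed
      qed
    qed
  qed
  also have "\<dots> = (\<integral>\<^sup>+s. \<integral>\<^sup>+\<omega>. markov_int_sum {..<N} f \<omega> s \<partial>P \<partial>pos_lborel)"
    using measurable_sojourn_sum[OF measurable_markov_int_nth_state[OF f], of "{..<N}"]
    by (intro Fubini_trajectories[OF P]) (simp add: case_prod_beta')
  finally show "(\<integral>\<^sup>+\<omega>. jump_sum X {..<N} f \<omega> \<partial>P) =
    (\<integral>\<^sup>+s. \<integral>\<^sup>+\<omega>. markov_int_sum {..<N} f \<omega> s \<partial>P \<partial>pos_lborel)" .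
qed

lemma markov_marginals_markov:
  assumes P: "process_law X Act q \<gamma> \<phi> P" and \<kappa>: "policy_kernel X A \<phi> \<kappa>"
    and \<kappa>\<phi>: "\<And>\<omega> s n. \<omega> \<in> space (trajectories X) \<Longrightarrow> 0 < s \<Longrightarrow> pre_sojourn n \<omega> s \<Longrightarrow> \<kappa> (\<omega>, s) = \<phi>' (nth_state X n \<omega>, s)"
  shows "markov_marginals P \<kappa>"
  unfolding markov_marginals_def
proof (intro allI impI ballI)
  fix s :: real and g :: "'x \<times> 'a \<Rightarrow> ennreal" assume s: "0 < s" and "g \<in> borel_measurable (X \<Otimes>\<^sub>M A)"
  note sp = space_process_law[OF P]
  note AEP = AE_trajectory[OF P]
  show "(\<integral>\<^sup>+\<omega>. (case state \<omega> s of None \<Rightarrow> 0 | Some z \<Rightarrow> \<integral>\<^sup>+a. g (z, a) \<partial>\<kappa> (\<omega>, s)) \<partial>P) =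
    (\<integral>\<^sup>+\<omega>. (case state \<omega> s of None \<Rightarrow> 0 | Some z \<Rightarrow> \<integral>\<^sup>+a. g (z, a) \<partial>\<phi>' (z, s)) \<partial>P)"
  proof (rule nn_integral_cong_AE)
    show "AE \<omega> in P. (case state \<omega> s of None \<Rightarrow> 0 | Some z \<Rightarrow> \<integral>\<^sup>+a. g (z, a) \<partial>\<kappa> (\<omega>, s)) =
        (case state \<omega> s of None \<Rightarrow> 0 | Some z \<Rightarrow> \<integral>\<^sup>+a. g (z, a) \<partial>\<phi>' (z, s))"
      using AE_no_jump_at_fixed_time[OF P \<kappa> s] AEP
    proof eventually_elim
      case (elim \<omega>)
      show ?case
      proof (cases "\<exists>n. sojourn n \<omega> s")
        case True
        then obtain n where n: "sojourn n \<omega> s" by blast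
        show ?thesis
          unfolding state_sojourn[OF elim(2) n] using \<kappa>\<phi>[OF elim(2) s, of n] n elim(1) by simp
      next
        case False
        then have "state \<omega> s = None" by (auto simp: state_def sojourn_def)
        then show ?thesis by simp
      qed
    qed
  qed
qed

lemma markov_marginalsI:
  assumes P: "process_law X Act q \<gamma> \<pi> P" and \<kappa>: "policy_kernel X A \<pi> \<kappa>"
    and marg: "\<And>t Z B. 0 < t \<Longrightarrow> Z \<in> sets X \<Longrightarrow> B \<in> sets A \<Longrightarrow>
           state_action_marginal P \<pi> t (Some ` Z) (Some ` B) =
           (\<integral>\<^sup>+z\<in>Some ` Z. emeasure (\<phi>' (the z, t)) B \<partial>state_marginal X P t)"
  shows "markov_marginals P \<kappa>"
  unfolding markov_marginals_def
proof (intro allI impI ballI)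
  fix s :: real and g :: "'x \<times> 'a \<Rightarrow> ennreal" assume s: "0 < s" and g: "g \<in> borel_measurable (X \<Otimes>\<^sub>M A)"
  note sp = space_process_law[OF P]
  note [measurable] = measurable_point_of[OF sp(5)]
  define k where "k \<omega> = \<kappa> (\<omega>, s)" for \<omega>
  define k' where "k' \<omega> = \<phi>' (point_of X (state \<omega> s), s)" for \<omega>
  have k: "k \<in> measurable (trajectories X) (subprob_algebra A)"
    unfolding k_def using s by (intro measurable_compose[OF measurable_Pair2' policy_kernelD(1)[OF \<kappa>]]) simp
  have "(\<lambda>\<omega>. (point_of X (state \<omega> s), s)) \<in> measurable (trajectories X) (X \<Otimes>\<^sub>M pos_reals)"
    using s by simp
  then have k': "k' \<in> measurable (trajectories X) (subprob_algebra A)"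
    unfolding k'_def by (rule measurable_compose[OF _ measurable_markov_kernel])
  have "(\<integral>\<^sup>+\<omega>. (case state \<omega> s of None \<Rightarrow> 0 | Some z \<Rightarrow> \<integral>\<^sup>+a. g (z, a) \<partial>k \<omega>) \<partial>P) =
    (\<integral>\<^sup>+\<omega>. (case state \<omega> s of None \<Rightarrow> 0 | Some z \<Rightarrow> \<integral>\<^sup>+a. g (z, a) \<partial>k' \<omega>) \<partial>P)"
  proof (rule state_action_laws_eqI[OF P k k' _ g])
    fix Z B assume Z: "Z \<in> sets X" and B: "B \<in> sets A"
    have "(\<integral>\<^sup>+\<omega>. indicator (Some ` Z) (state \<omega> s) * emeasure (k \<omega>) B \<partial>P) = state_action_marginal P \<pi> s (Some ` Z) (Some ` B)"
      unfolding state_action_marginal_def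
    proof (rule nn_integral_cong_law[OF P])
      fix \<omega> assume \<omega>: "\<omega> \<in> space (trajectories X)"
      show "indicator (Some ` Z) (state \<omega> s) * emeasure (k \<omega>) B = indicator (Some ` Z) (state \<omega> s) * emeasure (\<pi> \<omega> s) (Some ` B)"
      proof (cases "state \<omega> s = None")
        case True then show ?thesis by (simp add: image_iff)
      next
        case False
        then have "ereal s < explosion_time \<omega>"
          using state_None_iff[OF \<omega>, of s] s by (auto simp: not_le)
        then have \<pi>: "\<pi> \<omega> s = distr (k \<omega>) (adjoin_point A) Some"
          unfolding k_def by (rule policy_kernelD(2)[OF \<kappa> \<omega> s])
        have sk: "sets (k \<omega>) = sets A" unfolding k_def by (rule sets_policy_kernel[OF \<kappa> \<omega> s])
        then have "space (k \<omega>) = space A" by (rule sets_eq_imp_space_eq)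
        then have "Some -` Some ` B \<inter> space (k \<omega>) = B" using sets.sets_into_space[OF B] by auto
        moreover have "Some \<in> measurable (k \<omega>) (adjoin_point A)"
          using measurable_Some_adjoin_point[of A] sk by (simp cong: measurable_cong_sets)
        ultimately show ?thesis
          unfolding \<pi> using B by (simp add: emeasure_distr Some_image_in_sets_adjoin_point)
      qed
    qed
    also have "\<dots> = (\<integral>\<^sup>+z\<in>Some ` Z. emeasure (\<phi>' (the z, s)) B \<partial>state_marginal X P s)"
      by (rule marg[OF s Z B])
    also have "\<dots> = (\<integral>\<^sup>+\<omega>. emeasure (\<phi>' (the (state \<omega> s), s)) B * indicator (Some ` Z) (state \<omega> s) \<partial>P)"
      unfolding state_marginal_def
    proof (rule nn_integral_distr)
      show "(\<lambda>\<omega>. state \<omega> s) \<in> measurable P (adjoin_point X)"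
        using sp(1) measurable_state_fixed[of s X] by (simp cong: measurable_cong_sets)
      have "(\<lambda>x. emeasure (\<phi>' (x, s)) B) \<in> borel_measurable X"
        using s B by (intro measurable_compose[OF measurable_Pair2' measurable_emeasure_kernel[OF measurable_markov_kernel]]) auto
      then have "(\<lambda>x. emeasure (\<phi>' (x, s)) B * indicator Z x) \<in> borel_measurable X" using Z by simp
      moreover have "indicator (Some ` Z) (Some x) = (indicator Z x :: ennreal)" for x by (auto simp: indicator_def)
      moreover have "indicator (Some ` Z) None = (0 :: ennreal)" by (auto simp: indicator_def)
      ultimately show "(\<lambda>z. emeasure (\<phi>' (the z, s)) B * indicator (Some ` Z) z)
          \<in> borel_measurable (distr P (adjoin_point X) (\<lambda>\<omega>. state \<omega> s))"
        unfolding measurable_distr_eq1 by (intro measurable_from_adjoin_point) auto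
    qed
    also have "\<dots> = (\<integral>\<^sup>+\<omega>. indicator (Some ` Z) (state \<omega> s) * emeasure (k' \<omega>) B \<partial>P)"
      unfolding k'_def by (intro nn_integral_cong) (auto simp: indicator_def)
    finally show "(\<integral>\<^sup>+\<omega>. indicator (Some ` Z) (state \<omega> s) * emeasure (k \<omega>) B \<partial>P) =
        (\<integral>\<^sup>+\<omega>. indicator (Some ` Z) (state \<omega> s) * emeasure (k' \<omega>) B \<partial>P)" .
  qed
  also have "\<dots> = (\<integral>\<^sup>+\<omega>. (case state \<omega> s of None \<Rightarrow> 0 | Some z \<Rightarrow> \<integral>\<^sup>+a. g (z, a) \<partial>\<phi>' (z, s)) \<partial>P)"
    by (intro nn_integral_cong) (auto simp: k'_def split: option.split)
  finally show "(\<integral>\<^sup>+\<omega>. (case state \<omega> s of None \<Rightarrow> 0 | Some z \<Rightarrow> \<integral>\<^sup>+a. g (z, a) \<partial>\<kappa> (\<omega>, s)) \<partial>P) =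
    (\<integral>\<^sup>+\<omega>. (case state \<omega> s of None \<Rightarrow> 0 | Some z \<Rightarrow> \<integral>\<^sup>+a. g (z, a) \<partial>\<phi>' (z, s)) \<partial>P)"
    unfolding k_def .
qed

end

section \<open>The forward equation\<close>

context CTJMDP_kernel
begin

text \<open>
  The exit rate of state \<open>z\<close> at time \<open>s\<close>, extended by 0 to \<open>s \<le> 0\<close>.  It is bounded in \<open>s\<close>, so the
  conversion to a real number loses nothing.
\<close>

definition exit_rate :: "'x \<Rightarrow> real \<Rightarrow> real" where
  "exit_rate z s = (if 0 < s then enn2real (markov_int s z (\<lambda>_. 1)) else 0)"

lemma exit_rate_nonneg: "0 \<le> exit_rate z s"
  by (simp add: exit_rate_def)

lemma markov_int_one_le:
  assumes z: "z \<in> space X"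
  obtains K where "0 \<le> K" "\<And>s. 0 < s \<Longrightarrow> markov_int s z (\<lambda>_. 1) \<le> ennreal K"
proof -
  obtain K :: real where K: "0 \<le> K" "\<And>a. emeasure (jump_kernel z a) (space X) \<le> ennreal K"
    using jump_kernel_le_max_jump_rate[OF z finite_rate[OF z]] by blast
  have "markov_int s z (\<lambda>_. 1) \<le> ennreal K" if s: "0 < s" for s
  proof -
    interpret prob_space "\<phi>' (z, s)" by (rule markov_kernel(2)[OF z s])
    have "markov_int s z (\<lambda>_. 1) \<le> (\<integral>\<^sup>+a. ennreal K \<partial>\<phi>' (z, s))"
      unfolding markov_int_def intens_def using K by (intro nn_integral_mono) simp
    then show ?thesis by (simp add: emeasure_space_1)
  qed
  then show ?thesis using K(1) that by blast
qed

lemma exit_rate_bounded: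
  assumes z: "z \<in> space X"
  obtains K where "0 \<le> K" "\<And>s. exit_rate z s \<le> K"
proof -
  obtain K where K: "0 \<le> K" "\<And>s. 0 < s \<Longrightarrow> markov_int s z (\<lambda>_. 1) \<le> ennreal K"
    using markov_int_one_le[OF z] by blast
  have "exit_rate z s \<le> K" for s
    unfolding exit_rate_def using K enn2real_leI[OF K(1) K(2)] by simp
  then show ?thesis using K(1) that by blast
qed

lemma markov_int_const:
  assumes z: "z \<in> space X" and s: "0 < s"
  shows "markov_int s z (\<lambda>_. c) = ennreal (exit_rate z s) * c"
proof -
  obtain K where "0 \<le> K" "markov_int s z (\<lambda>_. 1) \<le> ennreal K"
    using markov_int_one_le[OF z] s by metis
  then have "markov_int s z (\<lambda>_. 1) < \<top>" using ennreal_less_top le_less_trans by blast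
  then have "markov_int s z (\<lambda>_. 1) = ennreal (exit_rate z s)" using s by (simp add: exit_rate_def)
  then show ?thesis
    using intens_cmult[of "\<lambda>_. 1" z "\<phi>' (z, s)" c] markov_kernel(1)[OF z s] z
    by (simp add: markov_int_def mult.commute)
qed

lemma measurable_exit_rate: "(\<lambda>p. exit_rate (fst p) (snd p)) \<in> borel_measurable (X \<Otimes>\<^sub>M borel)"
proof -
  have t: "(\<lambda>p. if 0 < snd p then snd p else 1) \<in> measurable (X \<Otimes>\<^sub>M borel) pos_reals"
    by (rule measurable_restrict_space2) (auto, measurable)
  have "(\<lambda>p. markov_int (if 0 < snd p then snd p else 1) (fst p) (\<lambda>_. 1)) \<in> borel_measurable (X \<Otimes>\<^sub>M (borel :: real measure))"
    by (rule measurable_markov_int[OF _ t]) (simp_all add: case_prod_beta')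
  then have "(\<lambda>p. if 0 < snd p then enn2real (markov_int (if 0 < snd p then snd p else 1) (fst p) (\<lambda>_. 1)) else 0)
      \<in> borel_measurable (X \<Otimes>\<^sub>M (borel :: real measure))"
    by measurable
  then show ?thesis
    by (rule measurable_cong[THEN iffD1, rotated]) (simp add: exit_rate_def)
qed

lemma measurable_exit_rate_comp [measurable (raw)]:
  assumes "g \<in> measurable M X" "h \<in> borel_measurable M"
  shows "(\<lambda>m. exit_rate (g m) (h m)) \<in> borel_measurable M"
  using measurable_compose[OF measurable_Pair[OF assms] measurable_exit_rate] by simp

lemma measurable_exit_rate_section: "z \<in> space X \<Longrightarrow> exit_rate z \<in> borel_measurable borel"
  using measurable_compose[OF measurable_Pair1' measurable_exit_rate] by simp

text \<open>
  The probability of no jump during \<open>(s, t]\<close> if the process is in \<open>z\<close> at time \<open>s\<close> and jumps at the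
  exit rate.
\<close>

definition survival :: "real \<Rightarrow> real \<Rightarrow> 'x \<Rightarrow> real" where
  "survival t s z = exp (- (LBINT v:{s..t}. exit_rate z v))"

lemma measurable_survival: "(\<lambda>p. survival t (fst p) (snd p)) \<in> borel_measurable (borel \<Otimes>\<^sub>M X)"
proof -
  have "(\<lambda>q. (snd (fst q), snd q)) \<in> measurable ((borel \<Otimes>\<^sub>M X) \<Otimes>\<^sub>M (lborel :: real measure)) (X \<Otimes>\<^sub>M borel)"
    by measurable
  from measurable_compose[OF this measurable_exit_rate]
  have [measurable]: "(\<lambda>q. exit_rate (snd (fst q)) (snd q)) \<in> borel_measurable (((borel :: real measure) \<Otimes>\<^sub>M X) \<Otimes>\<^sub>M (lborel :: real measure))"
    by simp
  have ind: "indicator {fst p..t} v = (if fst p \<le> v \<and> v \<le> t then 1 else 0 :: real)" for p :: "real \<times> 'x" and v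
    by (simp add: indicator_def)
  have "(\<lambda>p. LBINT v:{fst p..t}. exit_rate (snd p) v) \<in> borel_measurable ((borel :: real measure) \<Otimes>\<^sub>M X)"
    unfolding set_lebesgue_integral_def ind
    by (rule lborel.borel_measurable_lebesgue_integral) (simp add: case_prod_beta')
  then show ?thesis unfolding survival_def by measurable
qed

lemma survival_le_1: "survival t s z \<le> 1"
proof -
  have "0 \<le> (LBINT v:{s..t}. exit_rate z v)"
    unfolding set_lebesgue_integral_def using exit_rate_nonneg by (intro integral_nonneg_AE) auto
  then show ?thesis by (simp add: survival_def)
qed

lemma survival_nonneg: "0 \<le> survival t s z"
  by (simp add: survival_def)

lemma survival_self: "survival t t z = 1"
proof -
  have "(LBINT v:{t}. exit_rate z v) = 0"
    unfolding set_lebesgue_integral_def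
    by (rule integral_eq_zero_AE, rule eventually_mono[OF AE_lborel_singleton[of t]]) auto
  then show ?thesis by (simp add: survival_def)
qed

lemma survival_decay:
  assumes z: "z \<in> space X" and ab: "a \<le> b" "b \<le> t"
  shows "ennreal (survival t a z) + (\<integral>\<^sup>+s\<in>{a..b}. ennreal (exit_rate z s * survival t s z) \<partial>lborel) = ennreal (survival t b z)"
proof -
  obtain K where "0 \<le> K" "\<And>s. exit_rate z s \<le> K" using exit_rate_bounded[OF z] by blast
  then show ?thesis
    unfolding survival_def by (intro exp_decay_integral[OF measurable_exit_rate_section[OF z] exit_rate_nonneg _ ab])
qed

text \<open>
  The weight at time \<open>s\<close> of a visit of \<open>z\<close>: the probability that the visit lasts until \<open>t\<close>, if \<open>z\<close>
  is in \<open>Z\<close>.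
\<close>

definition stay :: "real \<Rightarrow> 'x set \<Rightarrow> real \<Rightarrow> 'x \<Rightarrow> ennreal" where
  "stay t Z s z = ennreal (survival t s z) * indicator Z z"

lemma measurable_stay:
  assumes "Z \<in> sets X"
  shows "(\<lambda>p. stay t Z (fst p) (snd p)) \<in> borel_measurable (borel \<Otimes>\<^sub>M X)"
  using measurable_survival assms unfolding stay_def by measurable

lemma measurable_stay_comp [measurable (raw)]:
  assumes "Z \<in> sets X" "h \<in> borel_measurable M" "g \<in> measurable M X"
  shows "(\<lambda>m. stay t Z (h m) (g m)) \<in> borel_measurable M"
  using measurable_compose[OF measurable_Pair[OF assms(2,3)] measurable_stay[OF assms(1)]] by simp

lemma stay_le_1: "stay t Z s z \<le> 1"
  using survival_le_1[of t s z] survival_nonneg[of t s z]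
  by (auto simp: stay_def indicator_def ennreal_le_1)

text \<open>
  The weight of the \<open>n\<close>-th visit at its beginning plus its growth is the weight at its end, or at
  time \<open>t\<close> if the visit is not over by then.  In the latter case the weight is the indicator of \<open>Z\<close>.
\<close>

lemma stay_balance:
  assumes \<omega>: "\<omega> \<in> space (trajectories X)" and t: "0 < t"
  shows "(if jump_time \<omega> n \<le> ereal t then stay t Z (rtime \<omega> n) (nth_state X n \<omega>) else 0) +
      (\<integral>\<^sup>+s. (if sojourn n \<omega> s \<and> s \<le> t then ennreal (exit_rate (nth_state X n \<omega>) s) * stay t Z s (nth_state X n \<omega>) else 0) \<partial>pos_lborel) =
    (if jump_time \<omega> (Suc n) \<le> ereal t then stay t Z (rtime \<omega> (Suc n)) (nth_state X n \<omega>) else 0) +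
      (if sojourn n \<omega> t then indicator Z (nth_state X n \<omega>) else 0)"
proof (cases "jump_time \<omega> n \<le> ereal t")
  case False
  then have "t < s" if "sojourn n \<omega> s" for s
    using that less_le_trans[of "ereal t" "jump_time \<omega> n" "ereal s"] by (auto simp: sojourn_def not_le)
  then have *: "\<not> (sojourn n \<omega> s \<and> s \<le> t)" for s by (meson not_le)
  have "\<not> jump_time \<omega> (Suc n) \<le> ereal t"
    using False jump_time_le_Suc[OF \<omega>, of n] order_trans by blast
  moreover have "\<not> sojourn n \<omega> t" using *[of t] by simp
  ultimately show ?thesis using False by (simp add: * del: jump_time.simps)
next
  case True
  let ?z = "nth_state X n \<omega>"
  have z: "?z \<in> space X" by (rule nth_state_in_space[OF \<omega>])
  obtain a where a: "jump_time \<omega> n = ereal a" "0 \<le> a" "a \<le> t"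
    using True jump_time_nonneg[OF \<omega>, of n] by (cases "jump_time \<omega> n") auto
  define b where "b = (if jump_time \<omega> (Suc n) \<le> ereal t then rtime \<omega> (Suc n) else t)"
  have b: "a \<le> b" "b \<le> t" "jump_time \<omega> (Suc n) \<le> ereal t \<Longrightarrow> jump_time \<omega> (Suc n) = ereal b"
    using a jump_time_le_Suc[OF \<omega>, of n] jump_time_nonneg[OF \<omega>, of "Suc n"] unfolding b_def
    by (cases "jump_time \<omega> (Suc n)"; auto simp del: jump_time.simps)+
  have "(\<integral>\<^sup>+s. (if sojourn n \<omega> s \<and> s \<le> t then ennreal (exit_rate ?z s) * stay t Z s ?z else 0) \<partial>pos_lborel) =
      (\<integral>\<^sup>+s\<in>{0<..}. (if sojourn n \<omega> s \<and> s \<le> t then ennreal (exit_rate ?z s) * stay t Z s ?z else 0) \<partial>lborel)"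
    by (rule nn_integral_pos_lborel)
  also have "\<dots> = (\<integral>\<^sup>+s. indicator Z ?z * (ennreal (exit_rate ?z s * survival t s ?z) * indicator {a..b} s) \<partial>lborel)"
  proof (rule nn_integral_cong_AE)
    have "AE s in lborel. s \<noteq> 0 \<and> s \<noteq> b \<and> s \<noteq> t"
      by (intro AE_conjI AE_lborel_singleton)
    then show "AE s in lborel. (if sojourn n \<omega> s \<and> s \<le> t then ennreal (exit_rate ?z s) * stay t Z s ?z else 0) * indicator {0<..} s =
        indicator Z ?z * (ennreal (exit_rate ?z s * survival t s ?z) * indicator {a..b} s)"
    proof (rule eventually_mono)
      fix s assume s: "s \<noteq> 0 \<and> s \<noteq> b \<and> s \<noteq> t"
      have iff: "sojourn n \<omega> s \<and> s \<le> t \<and> 0 < s \<longleftrightarrow> s \<in> {a..b}"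
      proof (cases "jump_time \<omega> (Suc n) \<le> ereal t")
        case True
        then have "jump_time \<omega> (Suc n) = ereal b" using b(3) by simp
        then show ?thesis using s a b(2) by (auto simp: sojourn_def simp del: jump_time.simps)
      next
        case False
        then have "b = t" by (simp add: b_def)
        moreover have "ereal s < jump_time \<omega> (Suc n)" if "s \<le> t"
          using False that by (auto simp: not_le intro: le_less_trans[of "ereal s" "ereal t"] simp del: jump_time.simps)
        ultimately show ?thesis using s a by (auto simp: sojourn_def simp del: jump_time.simps)
      qed
      show "(if sojourn n \<omega> s \<and> s \<le> t then ennreal (exit_rate ?z s) * stay t Z s ?z else 0) * indicator {0<..} s =
        indicator Z ?z * (ennreal (exit_rate ?z s * survival t s ?z) * indicator {a..b} s)"
      proof (cases "s \<in> {a..b}")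
        case True
        then have "sojourn n \<omega> s \<and> s \<le> t" "0 < s" using iff by auto
        then show ?thesis using True
          by (simp add: stay_def ennreal_mult exit_rate_nonneg survival_nonneg mult_ac)
      next
        case False
        then show ?thesis using iff by (auto simp: indicator_def)
      qed
    qed
  qed
  also have "\<dots> = indicator Z ?z * (\<integral>\<^sup>+s\<in>{a..b}. ennreal (exit_rate ?z s * survival t s ?z) \<partial>lborel)"
  proof (rule nn_integral_cmult)
    have 1: "exit_rate ?z \<in> borel_measurable borel" by (rule measurable_exit_rate_section[OF z])
    have 2: "(\<lambda>s. survival t s ?z) \<in> borel_measurable borel"
      using measurable_compose[OF measurable_Pair2'[OF z] measurable_survival] by simp
    show "(\<lambda>s. ennreal (exit_rate ?z s * survival t s ?z) * indicator {a..b} s) \<in> borel_measurable lborel"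
      using borel_measurable_times[OF 1 2] by simp
  qed
  finally have int: "(\<integral>\<^sup>+s. (if sojourn n \<omega> s \<and> s \<le> t then ennreal (exit_rate ?z s) * stay t Z s ?z else 0) \<partial>pos_lborel) =
      indicator Z ?z * (\<integral>\<^sup>+s\<in>{a..b}. ennreal (exit_rate ?z s * survival t s ?z) \<partial>lborel)" .
  have "(if jump_time \<omega> n \<le> ereal t then stay t Z (rtime \<omega> n) ?z else 0) +
      indicator Z ?z * (\<integral>\<^sup>+s\<in>{a..b}. ennreal (exit_rate ?z s * survival t s ?z) \<partial>lborel) =
      indicator Z ?z * (ennreal (survival t a ?z) + (\<integral>\<^sup>+s\<in>{a..b}. ennreal (exit_rate ?z s * survival t s ?z) \<partial>lborel))"
    using True by (simp add: a(1) stay_def distrib_left mult.commute)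
  also have "\<dots> = indicator Z ?z * ennreal (survival t b ?z)"
    by (simp add: survival_decay[OF z b(1,2)])
  also have "\<dots> = (if jump_time \<omega> (Suc n) \<le> ereal t then stay t Z (rtime \<omega> (Suc n)) ?z else 0) +
      (if sojourn n \<omega> t then indicator Z ?z else 0)"
  proof (cases "jump_time \<omega> (Suc n) \<le> ereal t")
    case t1: True
    then have "\<not> sojourn n \<omega> t" by (auto simp: sojourn_def not_less simp del: jump_time.simps)
    then show ?thesis using t1 b(3)[OF t1] by (simp add: stay_def mult.commute del: jump_time.simps)
  next
    case False
    then have "sojourn n \<omega> t" using True by (auto simp: sojourn_def not_le simp del: jump_time.simps)
    then show ?thesis using False by (simp add: b_def survival_self del: jump_time.simps)
  qed
  finally show ?thesis unfolding int .
qed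

text \<open>
  States whose rate is at most \<open>k\<close> at almost all times.  A supremum over all times need not be
  measurable in the state, hence the integral.
\<close>

definition level :: "nat \<Rightarrow> 'x set" where
  "level k = {z \<in> space X. (\<integral>\<^sup>+s. ennreal (exit_rate z s - real k) \<partial>pos_lborel) = 0}"

lemma measurable_exit_rate_pos: "(\<lambda>p. exit_rate (fst p) (snd p)) \<in> borel_measurable (X \<Otimes>\<^sub>M pos_lborel)"
proof -
  have "(\<lambda>p. (fst p, snd p)) \<in> measurable (X \<Otimes>\<^sub>M pos_lborel) (X \<Otimes>\<^sub>M borel)" by measurable
  from measurable_compose[OF this measurable_exit_rate] show ?thesis by simp
qed

lemma level_sets: "level k \<in> sets X"
proof -
  interpret L: sigma_finite_measure pos_lborel by (rule sigma_finite_pos_lborel)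
  have "(\<lambda>z. \<integral>\<^sup>+s. ennreal (exit_rate z s - real k) \<partial>pos_lborel) \<in> borel_measurable X"
    using measurable_exit_rate_pos by (intro L.borel_measurable_nn_integral) (simp add: case_prod_beta')
  then show ?thesis unfolding level_def by measurable
qed

lemma level_AE:
  assumes "z \<in> level k"
  shows "AE s in pos_lborel. exit_rate z s \<le> real k"
proof -
  have z: "z \<in> space X" and int: "(\<integral>\<^sup>+s. ennreal (exit_rate z s - real k) \<partial>pos_lborel) = 0"
    using assms by (auto simp: level_def)
  have "(\<lambda>s. exit_rate z s) \<in> borel_measurable pos_lborel"
    using measurable_compose[OF measurable_Pair1'[OF z] measurable_exit_rate_pos] by simp
  then have "AE s in pos_lborel. ennreal (exit_rate z s - real k) = 0"
    using int by (subst (asm) nn_integral_0_iff_AE) auto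
  then show ?thesis by (rule eventually_mono) (simp add: ennreal_eq_0_iff)
qed

lemma level_mono: "incseq level"
proof (rule incseq_SucI)
  fix k
  have "(\<integral>\<^sup>+s. ennreal (exit_rate z s - real (Suc k)) \<partial>pos_lborel) \<le> (\<integral>\<^sup>+s. ennreal (exit_rate z s - real k) \<partial>pos_lborel)" for z
    by (intro nn_integral_mono ennreal_leI) simp
  then show "level k \<subseteq> level (Suc k)" unfolding level_def by (auto simp del: of_nat_Suc) (metis le_zero_eq)
qed

lemma level_UN: "(\<Union>k. level k) = space X"
proof (intro equalityI subsetI)
  fix z assume z: "z \<in> space X"
  obtain K where K: "\<And>s. exit_rate z s \<le> K" using exit_rate_bounded[OF z] by blast
  obtain k where k: "K \<le> real k" using real_arch_simple by blast
  have "ennreal (exit_rate z s - real k) = 0" for s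
    using K[of s] k by (intro ennreal_neg) simp
  then show "z \<in> (\<Union>k. level k)" using z by (auto simp: level_def intro!: exI[of _ k])
qed (auto simp: level_def)

text \<open>
  The probability of being in \<open>Z\<close> at time \<open>t\<close>, during a visit with index in \<open>I\<close>, is the expected sum of
  the weights at the beginnings of these visits.
\<close>

lemma renewal:
  assumes P: "process_law X Act q \<gamma> \<pi> P" and bal: "jump_balance P I"
    and t: "0 < t" and Z: "Z \<in> sets X" and Zk: "Z \<subseteq> level k"
  shows "(\<integral>\<^sup>+\<omega>. (\<Sum>n. if n \<in> I \<and> jump_time \<omega> n \<le> ereal t then
        stay t Z (rtime \<omega> n) (nth_state X n \<omega>) else 0) \<partial>P) =
    (\<integral>\<^sup>+\<omega>. (\<Sum>n. if n \<in> I \<and> sojourn n \<omega> t then indicator Z (nth_state X n \<omega>) else 0) \<partial>P)"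
proof -
  note sp = space_process_law[OF P]
  interpret P: prob_space P by (rule sp(3))
  note cong = measurable_process_law[OF P]
  \<comment> \<open>The four terms of the balance of the \<open>n\<close>-th visit.\<close>
  define a where "a n \<omega> = (if n \<in> I \<and> jump_time \<omega> n \<le> ereal t then
      stay t Z (rtime \<omega> n) (nth_state X n \<omega>) else 0)" for n \<omega>
  define b where "b n \<omega> s = (if n \<in> I \<and> sojourn n \<omega> s then
      (if s \<le> t then ennreal (exit_rate (nth_state X n \<omega>) s) * stay t Z s (nth_state X n \<omega>) else 0) else 0)" for n \<omega> s
  define c where "c n \<omega> = (if n \<in> I \<and> jump_time \<omega> (Suc n) \<le> ereal t then
      stay t Z (rtime \<omega> (Suc n)) (nth_state X n \<omega>) else 0)" for n \<omega>
  define d where "d n \<omega> = (if n \<in> I \<and> sojourn n \<omega> t then indicator Z (nth_state X n \<omega>) else 0 :: ennreal)" for n \<omega>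
  have ma: "a n \<in> borel_measurable P" for n
    unfolding a_def cong using Z by measurable
  have mc: "c n \<in> borel_measurable P" for n
    unfolding c_def cong using Z by (simp del: jump_time.simps)
  have md: "d n \<in> borel_measurable P" for n
    unfolding d_def cong sojourn_def using Z by (simp del: jump_time.simps)
  have mb0: "(\<lambda>p. ennreal (exit_rate (nth_state X n (fst p)) (snd p)) * stay t Z (snd p) (nth_state X n (fst p)))
      \<in> borel_measurable (timed X)" for n
    using Z by measurable
  have mb: "(\<lambda>p. \<Sum>n. b n (fst p) (snd p)) \<in> borel_measurable (timed X)"
    unfolding b_def using mb0 by (intro measurable_sojourn_sum) simp
  have mb1: "(\<lambda>p. b n (fst p) (snd p)) \<in> borel_measurable (timed X)" for n
  proof -
    have "Measurable.pred (timed X) (\<lambda>p. sojourn n (fst p) (snd p))"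
      unfolding sojourn_def by measurable
    note [measurable] = this mb0
    show ?thesis unfolding b_def by measurable
  qed
  have mbs: "b n \<omega> \<in> borel_measurable pos_lborel" if "\<omega> \<in> space (trajectories X)" for n \<omega>
    using measurable_compose[OF measurable_Pair1'[OF that] mb1[of n]] by simp
  have "(\<integral>\<^sup>+\<omega>. (\<Sum>n. a n \<omega>) \<partial>P) + (\<integral>\<^sup>+\<omega>. \<integral>\<^sup>+s. (\<Sum>n. b n \<omega> s) \<partial>pos_lborel \<partial>P) =
      (\<integral>\<^sup>+\<omega>. (\<Sum>n. a n \<omega>) + (\<integral>\<^sup>+s. (\<Sum>n. b n \<omega> s) \<partial>pos_lborel) \<partial>P)"
  proof (rule nn_integral_add[symmetric])
    interpret L: sigma_finite_measure pos_lborel by (rule sigma_finite_pos_lborel)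
    show "(\<lambda>\<omega>. \<integral>\<^sup>+s. (\<Sum>n. b n \<omega> s) \<partial>pos_lborel) \<in> borel_measurable P"
      unfolding cong
    proof (rule L.borel_measurable_nn_integral)
      have "sets (trajectories X \<Otimes>\<^sub>M pos_lborel) = sets (timed X)"
        by (intro sets_pair_measure_cong) auto
      then show "(\<lambda>(\<omega>, s). \<Sum>n. b n \<omega> s) \<in> borel_measurable (trajectories X \<Otimes>\<^sub>M pos_lborel)"
        using mb by (simp add: case_prod_beta' cong: measurable_cong_sets)
    qed
  qed (use ma in measurable)
  also have "\<dots> = (\<integral>\<^sup>+\<omega>. (\<Sum>n. c n \<omega>) + (\<Sum>n. d n \<omega>) \<partial>P)"
  proof (rule nn_integral_cong_law[OF P])
    fix \<omega> assume \<omega>: "\<omega> \<in> space (trajectories X)"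
    have "a n \<omega> + (\<integral>\<^sup>+s. b n \<omega> s \<partial>pos_lborel) = c n \<omega> + d n \<omega>" for n
    proof (cases "n \<in> I")
      case True
      then have "b n \<omega> = (\<lambda>s. if sojourn n \<omega> s \<and> s \<le> t then ennreal (exit_rate (nth_state X n \<omega>) s) * stay t Z s (nth_state X n \<omega>) else 0)"
        by (auto simp: b_def)
      then show ?thesis using True stay_balance[OF \<omega> t, of n Z] by (simp add: a_def c_def d_def del: jump_time.simps)
    qed (simp add: a_def b_def c_def d_def)
    then have "(\<Sum>n. a n \<omega> + (\<integral>\<^sup>+s. b n \<omega> s \<partial>pos_lborel)) = (\<Sum>n. c n \<omega> + d n \<omega>)" by simp
    then show "(\<Sum>n. a n \<omega>) + (\<integral>\<^sup>+s. (\<Sum>n. b n \<omega> s) \<partial>pos_lborel) = (\<Sum>n. c n \<omega>) + (\<Sum>n. d n \<omega>)"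
      using mbs[OF \<omega>] by (simp add: nn_integral_suminf suminf_add[symmetric])
  qed
  also have "\<dots> = (\<integral>\<^sup>+\<omega>. (\<Sum>n. c n \<omega>) \<partial>P) + (\<integral>\<^sup>+\<omega>. (\<Sum>n. d n \<omega>) \<partial>P)"
    using mc md by (intro nn_integral_add) auto
  \<comment> \<open>The jump balance for a function of the state before the jump: the ends of visits.\<close>
  also have "(\<integral>\<^sup>+\<omega>. (\<Sum>n. c n \<omega>) \<partial>P) = (\<integral>\<^sup>+\<omega>. \<integral>\<^sup>+s. (\<Sum>n. b n \<omega> s) \<partial>pos_lborel \<partial>P)"
  proof -
    define f :: "(real \<times> 'x) \<times> 'x \<Rightarrow> ennreal" where
      "f = (\<lambda>p. if fst (fst p) \<le> t then stay t Z (fst (fst p)) (snd (fst p)) else 0)"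
    have f: "f \<in> borel_measurable (jumps X)"
      unfolding f_def using Z by measurable
    have "(\<integral>\<^sup>+\<omega>. (\<Sum>n. c n \<omega>) \<partial>P) = (\<integral>\<^sup>+\<omega>. jump_sum X I f \<omega> \<partial>P)"
    proof (rule nn_integral_cong, rule suminf_cong)
      fix \<omega> n assume "\<omega> \<in> space P"
      then have "\<omega> \<in> space (trajectories X)" using sp(2) by simp
      from jump_time_nonneg[OF this, of "Suc n"]
      show "c n \<omega> = (if n \<in> I \<and> jump_time \<omega> (Suc n) < \<infinity> then
        at_jump X f \<omega> n else 0)"
        by (cases "jump_time \<omega> (Suc n)") (auto simp: c_def f_def simp del: jump_time.simps)
    qed
    also have "\<dots> = (\<integral>\<^sup>+s. \<integral>\<^sup>+\<omega>. markov_int_sum I f \<omega> s \<partial>P \<partial>pos_lborel)"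
      using bal f unfolding jump_balance_def by (rule bspec)
    also have "\<dots> = (\<integral>\<^sup>+s. \<integral>\<^sup>+\<omega>. (\<Sum>n. b n \<omega> s) \<partial>P \<partial>pos_lborel)"
    proof (rule nn_integral_cong, rule nn_integral_cong, rule suminf_cong)
      fix s \<omega> n assume s: "s \<in> space pos_lborel" and "\<omega> \<in> space P"
      then have \<omega>: "\<omega> \<in> space (trajectories X)" using sp(2) by simp
      show "(if n \<in> I \<and> sojourn n \<omega> s then markov_int_at s f (nth_state X n \<omega>) else 0) = b n \<omega> s"
        using s by (simp add: markov_int_const nth_state_in_space[OF \<omega>] f_def b_def)
    qed
    also have "\<dots> = (\<integral>\<^sup>+\<omega>. \<integral>\<^sup>+s. (\<Sum>n. b n \<omega> s) \<partial>pos_lborel \<partial>P)"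
      using mb by (intro Fubini_trajectories[OF P, symmetric]) (simp add: case_prod_beta')
    finally show ?thesis .
  qed
  finally have eq: "(\<integral>\<^sup>+\<omega>. \<integral>\<^sup>+s. (\<Sum>n. b n \<omega> s) \<partial>pos_lborel \<partial>P) + (\<integral>\<^sup>+\<omega>. (\<Sum>n. a n \<omega>) \<partial>P) =
      (\<integral>\<^sup>+\<omega>. \<integral>\<^sup>+s. (\<Sum>n. b n \<omega> s) \<partial>pos_lborel \<partial>P) + (\<integral>\<^sup>+\<omega>. (\<Sum>n. d n \<omega>) \<partial>P)"
    by (simp add: add.commute)
  \<comment> \<open>The common term can be cancelled because it is finite: the rates on \<open>Z\<close> are at most \<open>k\<close>.\<close>
  have "(\<integral>\<^sup>+\<omega>. \<integral>\<^sup>+s. (\<Sum>n. b n \<omega> s) \<partial>pos_lborel \<partial>P) \<le> (\<integral>\<^sup>+\<omega>. \<integral>\<^sup>+s. (ennreal (real k) * indicator {0<..t} s) \<partial>pos_lborel \<partial>P)"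
  proof (rule nn_integral_mono, rule nn_integral_mono_AE)
    fix \<omega> assume "\<omega> \<in> space P"
    then have \<omega>: "\<omega> \<in> space (trajectories X)" using sp(2) by simp
    have "AE s in pos_lborel. nth_state X n \<omega> \<in> level k \<longrightarrow> exit_rate (nth_state X n \<omega>) s \<le> real k" for n
      using level_AE[of "nth_state X n \<omega>" k] by (cases "nth_state X n \<omega> \<in> level k") auto
    then have "AE s in pos_lborel. \<forall>n. nth_state X n \<omega> \<in> level k \<longrightarrow> exit_rate (nth_state X n \<omega>) s \<le> real k"
      by (simp add: AE_all_countable)
    moreover have "AE s in pos_lborel. 0 < s" by (rule AE_I2) simp
    ultimately show "AE s in pos_lborel. (\<Sum>n. b n \<omega> s) \<le> ennreal (real k) * indicator {0<..t} s"
    proof eventually_elim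
      case (elim s)
      have "b n \<omega> s \<le> (if sojourn n \<omega> s then ennreal (real k) * indicator {0<..t} s else 0)" for n
      proof (cases "sojourn n \<omega> s \<and> s \<le> t \<and> nth_state X n \<omega> \<in> Z")
        case True
        then have "exit_rate (nth_state X n \<omega>) s \<le> real k" using elim(1) Zk by blast
        then have "ennreal (exit_rate (nth_state X n \<omega>) s) * stay t Z s (nth_state X n \<omega>) \<le> ennreal (real k) * 1"
          by (intro mult_mono ennreal_leI stay_le_1) auto
        then show ?thesis using True elim(2) by (simp add: b_def)
      next
        case False
        then have "b n \<omega> s = 0" by (auto simp: b_def stay_def indicator_def)
        then show ?thesis by simp
      qed
      then have "(\<Sum>n. b n \<omega> s) \<le> (\<Sum>n. if sojourn n \<omega> s then ennreal (real k) * indicator {0<..t} s else 0)"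
        by (intro suminf_le) auto
      also have "\<dots> \<le> ennreal (real k) * indicator {0<..t} s"
      proof (cases "\<exists>n. sojourn n \<omega> s")
        case True
        then obtain n where "sojourn n \<omega> s" by blast
        from suminf_sojourn[OF \<omega> this, of "\<lambda>_. ennreal (real k) * indicator {0<..t} s"]
        show ?thesis by simp
      qed simp
      finally show ?case .
    qed
  qed
  also have "\<dots> = ennreal (real k) * ennreal t"
  proof -
    have "(\<integral>\<^sup>+s. ennreal (real k) * indicator {0<..t} s \<partial>pos_lborel) = (\<integral>\<^sup>+s. ennreal (real k) * indicator {0<..t} s \<partial>lborel)"
      unfolding nn_integral_pos_lborel by (intro nn_integral_cong) (auto simp: indicator_def)
    also have "\<dots> = ennreal (real k) * ennreal t"
      using t by (simp add: nn_integral_cmult)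
    finally show ?thesis by (simp add: P.emeasure_space_1)
  qed
  also have "\<dots> < \<top>" by (simp add: ennreal_mult_less_top)
  finally have "(\<integral>\<^sup>+\<omega>. \<integral>\<^sup>+s. (\<Sum>n. b n \<omega> s) \<partial>pos_lborel \<partial>P) \<noteq> \<top>" by simp
  then have "(\<integral>\<^sup>+\<omega>. (\<Sum>n. a n \<omega>) \<partial>P) = (\<integral>\<^sup>+\<omega>. (\<Sum>n. d n \<omega>) \<partial>P)"
    using eq by (simp add: ennreal_add_left_cancel)
  then show ?thesis unfolding a_def d_def .
qed

end

section \<open>Comparison of the occupation laws\<close>

context CTJMDP_kernel
begin

text \<open>
  The law of the state at time \<open>s\<close> on the event that the index of the current visit is in \<open>I\<close>.
\<close>

definition visit_law :: "'x trajectory measure \<Rightarrow> nat set \<Rightarrow> real \<Rightarrow> 'x measure" where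
  "visit_law P I s = distr (density P (\<lambda>\<omega>. \<Sum>n. if n \<in> I \<and> sojourn n \<omega> s then 1 else 0)) X
     (\<lambda>\<omega>. point_of X (state \<omega> s))"

lemma sets_visit_law [simp, measurable_cong]: "sets (visit_law P I s) = sets X"
  by (simp add: visit_law_def)

lemma space_visit_law [simp]: "space (visit_law P I s) = space X"
  by (simp add: visit_law_def)

lemma nn_integral_visit_law:
  assumes P: "process_law X Act q \<gamma> \<pi> P" and g: "g \<in> borel_measurable X"
  shows "(\<integral>\<^sup>+z. g z \<partial>visit_law P I s) =
    (\<integral>\<^sup>+\<omega>. (\<Sum>n. if n \<in> I \<and> sojourn n \<omega> s then g (nth_state X n \<omega>) else 0) \<partial>P)"
proof -
  note sp = space_process_law[OF P]
  note [measurable] = measurable_point_of[OF sp(5)] g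
  note cong = measurable_process_law[OF P]
  have 1: "(\<lambda>\<omega>. point_of X (state \<omega> s)) \<in> measurable P X" unfolding cong by measurable
  have 2: "(\<lambda>\<omega>. \<Sum>n. if n \<in> I \<and> sojourn n \<omega> s then 1 else 0 :: ennreal) \<in> borel_measurable P"
    unfolding cong sojourn_def by measurable
  have "(\<integral>\<^sup>+z. g z \<partial>visit_law P I s) =
      (\<integral>\<^sup>+\<omega>. (\<Sum>n. if n \<in> I \<and> sojourn n \<omega> s then 1 else 0) * g (point_of X (state \<omega> s)) \<partial>P)"
    unfolding visit_law_def using 1 2 measurable_compose[OF 1 g]
    by (simp add: nn_integral_distr nn_integral_density)
  also have "\<dots> = (\<integral>\<^sup>+\<omega>. (\<Sum>n. if n \<in> I \<and> sojourn n \<omega> s then g (nth_state X n \<omega>) else 0) \<partial>P)"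
  proof (rule nn_integral_cong_law[OF P])
    fix \<omega> assume \<omega>: "\<omega> \<in> space (trajectories X)"
    have "(if n \<in> I \<and> sojourn n \<omega> s then 1 else 0) * g (point_of X (state \<omega> s)) =
        (if n \<in> I \<and> sojourn n \<omega> s then g (nth_state X n \<omega>) else 0)" for n
      using state_sojourn[OF \<omega>, of n s] by simp
    then show "(\<Sum>n. if n \<in> I \<and> sojourn n \<omega> s then 1 else 0) * g (point_of X (state \<omega> s)) =
        (\<Sum>n. if n \<in> I \<and> sojourn n \<omega> s then g (nth_state X n \<omega>) else 0)"
      by (simp only: ennreal_suminf_multc[symmetric])
  qed
  finally show ?thesis .
qed

lemma nn_integral_visit_law_UNIV:
  assumes P: "process_law X Act q \<gamma> \<pi> P" and g: "g \<in> borel_measurable X"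
  shows "(\<integral>\<^sup>+z. g z \<partial>visit_law P UNIV s) = (\<integral>\<^sup>+\<omega>. (case state \<omega> s of None \<Rightarrow> 0 | Some z \<Rightarrow> g z) \<partial>P)"
  unfolding nn_integral_visit_law[OF P g]
  using sum_sojourn_eq_case_state[where s=s and g=g and X=X] space_process_law(2)[OF P] by (intro nn_integral_cong) simp

text \<open>
  Visits with index in \<open>I\<close> begin at time 0 or by a jump from a visit whose index is one less.
\<close>

lemma forward_equation:
  assumes P: "process_law X Act q \<gamma> \<pi> P" and I: "jump_balance P I" "0 \<in> I"
    and J: "jump_balance P {n. Suc n \<in> I}"
    and t: "0 < t" and Z: "Z \<in> sets X" and Zk: "Z \<subseteq> level k"
  shows "emeasure (visit_law P I t) Z = (\<integral>\<^sup>+x. stay t Z 0 x \<partial>\<gamma>) +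
    (\<integral>\<^sup>+s. \<integral>\<^sup>+z. markov_int s z (\<lambda>y. if s \<le> t then stay t Z s y else 0) \<partial>visit_law P {n. Suc n \<in> I} s \<partial>pos_lborel)"
proof -
  note sp = space_process_law[OF P]
  note cong = measurable_process_law[OF P]
  have \<gamma>: "\<gamma> = distr P X fst" using P by (simp add: process_law_def)
  define f :: "(real \<times> 'x) \<times> 'x \<Rightarrow> ennreal" where
    "f = (\<lambda>p. if fst (fst p) \<le> t then stay t Z (fst (fst p)) (snd p) else 0)"
  have f: "f \<in> borel_measurable (jumps X)"
    unfolding f_def using Z by measurable
  have st0: "stay t Z 0 \<in> borel_measurable X"
    using Z by measurable
  define a where "a n \<omega> = (if n \<in> I \<and> jump_time \<omega> n \<le> ereal t then
      stay t Z (rtime \<omega> n) (nth_state X n \<omega>) else 0)" for n \<omega>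
  define a' where "a' n \<omega> = (if n \<in> {n. Suc n \<in> I} \<and> jump_time \<omega> (Suc n) < \<infinity> then
      at_jump X f \<omega> n else 0)" for n \<omega>
  have ma': "a' n \<in> borel_measurable P" for n
  proof (cases "Suc n \<in> I")
    case True
    then show ?thesis unfolding a'_def cong using measurable_jump_fun[OF f, of n] by simp
  next
    case False
    then have "a' n = (\<lambda>_. 0)" by (auto simp: a'_def)
    then show ?thesis by simp
  qed
  have "emeasure (visit_law P I t) Z = (\<integral>\<^sup>+z. indicator Z z \<partial>visit_law P I t)"
    using Z by simp
  also have "\<dots> = (\<integral>\<^sup>+\<omega>. (\<Sum>n. a n \<omega>) \<partial>P)"
    using Z unfolding a_def renewal[OF P I(1) t Z Zk] by (intro nn_integral_visit_law[OF P]) simp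
  also have "\<dots> = (\<integral>\<^sup>+\<omega>. stay t Z 0 (fst \<omega>) + (\<Sum>n. a' n \<omega>) \<partial>P)"
  proof (rule nn_integral_cong_law[OF P])
    fix \<omega> assume \<omega>: "\<omega> \<in> space (trajectories X)"
    have "a (Suc n) \<omega> = a' n \<omega>" for n
      using jump_time_nonneg[OF \<omega>, of "Suc n"]
      by (cases "jump_time \<omega> (Suc n)") (auto simp: a_def a'_def f_def simp del: jump_time.simps)
    moreover have "a 0 \<omega> = stay t Z 0 (fst \<omega>)"
      using I(2) t by (simp add: a_def zero_ereal_def)
    ultimately show "(\<Sum>n. a n \<omega>) = stay t Z 0 (fst \<omega>) + (\<Sum>n. a' n \<omega>)"
      using suminf_offset[of "\<lambda>n. a n \<omega>" 1] by (simp add: add.commute)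
  qed
  also have "\<dots> = (\<integral>\<^sup>+\<omega>. stay t Z 0 (fst \<omega>) \<partial>P) + (\<integral>\<^sup>+\<omega>. (\<Sum>n. a' n \<omega>) \<partial>P)"
  proof (rule nn_integral_add)
    show "(\<lambda>\<omega>. stay t Z 0 (fst \<omega>)) \<in> borel_measurable P"
      unfolding cong by (rule measurable_compose[OF measurable_fst_trajectories st0])
  qed (use ma' in measurable)
  also have "(\<integral>\<^sup>+\<omega>. stay t Z 0 (fst \<omega>) \<partial>P) = (\<integral>\<^sup>+x. stay t Z 0 x \<partial>\<gamma>)"
    unfolding \<gamma> using st0 measurable_fst_trajectories[of X]
    by (intro nn_integral_distr[symmetric]) (simp_all add: cong)
  \<comment> \<open>The jump balance for a function of the state after the jump: the beginnings of visits.\<close>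
  also have "(\<integral>\<^sup>+\<omega>. (\<Sum>n. a' n \<omega>) \<partial>P) =
      (\<integral>\<^sup>+s. \<integral>\<^sup>+\<omega>. markov_int_sum {n. Suc n \<in> I} f \<omega> s \<partial>P \<partial>pos_lborel)"
    unfolding a'_def using J f unfolding jump_balance_def by (rule bspec)
  also have "\<dots> = (\<integral>\<^sup>+s. \<integral>\<^sup>+z. markov_int s z (\<lambda>y. if s \<le> t then stay t Z s y else 0) \<partial>visit_law P {n. Suc n \<in> I} s \<partial>pos_lborel)"
  proof (rule nn_integral_cong)
    fix s assume "s \<in> space pos_lborel"
    then have s: "0 < s" by simp
    have m: "(\<lambda>z. markov_int s z (\<lambda>y. if s \<le> t then stay t Z s y else 0)) \<in> borel_measurable X"
    proof (rule measurable_markov_int)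
      show "(\<lambda>(z, y). if s \<le> t then stay t Z s y else 0) \<in> borel_measurable (X \<Otimes>\<^sub>M X)"
        using Z by measurable
    qed (use s in simp_all)
    show "(\<integral>\<^sup>+\<omega>. markov_int_sum {n. Suc n \<in> I} f \<omega> s \<partial>P) =
      (\<integral>\<^sup>+z. markov_int s z (\<lambda>y. if s \<le> t then stay t Z s y else 0) \<partial>visit_law P {n. Suc n \<in> I} s)"
      unfolding nn_integral_visit_law[OF P m] f_def fst_conv snd_conv ..
  qed
  finally show ?thesis .
qed

lemma nn_integral_mono_sets:
  assumes "sets M = sets N" "\<And>Z. Z \<in> sets N \<Longrightarrow> emeasure M Z \<le> emeasure N Z"
  shows "(\<integral>\<^sup>+x. f x \<partial>M) \<le> (\<integral>\<^sup>+x. f x \<partial>N)"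
  using assms by (intro nn_integral_mono_measure) (simp_all add: le_measure)

context
  fixes \<gamma> \<pi> \<phi> P\<^sub>\<pi> P\<^sub>\<phi>
  assumes P\<^sub>\<pi>: "process_law X Act q \<gamma> \<pi> P\<^sub>\<pi>" and P\<^sub>\<phi>: "process_law X Act q \<gamma> \<phi> P\<^sub>\<phi>"
    and bal\<^sub>\<pi>: "jump_balance P\<^sub>\<pi> UNIV" and bal\<^sub>\<phi>: "\<And>N. jump_balance P\<^sub>\<phi> {..<N}"
begin

text \<open>
  On the event of fewer than \<open>N\<close> jumps the law under \<open>\<phi>\<close> is at most the law under \<open>\<pi>\<close>: the operator
  of the forward equation is monotone, the law under \<open>\<pi>\<close> is a fixed point, and the first law vanishes
  for \<open>N = 0\<close>.
\<close>

lemma visit_law_le_finite: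
  "0 < t \<Longrightarrow> Z \<in> sets X \<Longrightarrow> emeasure (visit_law P\<^sub>\<phi> {..<N} t) Z \<le> emeasure (visit_law P\<^sub>\<pi> UNIV t) Z"
proof (induction N arbitrary: t Z)
  case 0
  have "emeasure (visit_law P\<^sub>\<phi> {..<0} t) Z = (\<integral>\<^sup>+z. indicator Z z \<partial>visit_law P\<^sub>\<phi> {..<0} t)"
    using 0 by simp
  also have "\<dots> = 0" using 0 by (subst nn_integral_visit_law[OF P\<^sub>\<phi>]) auto
  finally show ?case by simp
next
  case (Suc N)
  have J: "{n. Suc n \<in> {..<Suc N}} = {..<N}" "{n. Suc n \<in> UNIV} = UNIV" by auto
  have le: "emeasure (visit_law P\<^sub>\<phi> {..<Suc N} t) (Z \<inter> level k) \<le> emeasure (visit_law P\<^sub>\<pi> UNIV t) (Z \<inter> level k)" for k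
  proof -
    let ?Z = "Z \<inter> level k"
    have Z: "?Z \<in> sets X" "?Z \<subseteq> level k" using Suc.prems level_sets by auto
    have "emeasure (visit_law P\<^sub>\<phi> {..<Suc N} t) ?Z = (\<integral>\<^sup>+x. stay t ?Z 0 x \<partial>\<gamma>) +
      (\<integral>\<^sup>+s. \<integral>\<^sup>+z. markov_int s z (\<lambda>y. if s \<le> t then stay t ?Z s y else 0) \<partial>visit_law P\<^sub>\<phi> {..<N} s \<partial>pos_lborel)"
      using forward_equation[OF P\<^sub>\<phi> bal\<^sub>\<phi>[of "Suc N"] _ _ Suc.prems(1) Z] bal\<^sub>\<phi>[of N] unfolding J by simp
    also have "\<dots> \<le> (\<integral>\<^sup>+x. stay t ?Z 0 x \<partial>\<gamma>) +
      (\<integral>\<^sup>+s. \<integral>\<^sup>+z. markov_int s z (\<lambda>y. if s \<le> t then stay t ?Z s y else 0) \<partial>visit_law P\<^sub>\<pi> UNIV s \<partial>pos_lborel)"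
      by (intro add_mono order_refl nn_integral_mono nn_integral_mono_sets) (auto intro: Suc.IH)
    also have "\<dots> = emeasure (visit_law P\<^sub>\<pi> UNIV t) ?Z"
      using forward_equation[OF P\<^sub>\<pi> bal\<^sub>\<pi> _ _ Suc.prems(1) Z] bal\<^sub>\<pi> unfolding J by simp
    finally show ?thesis .
  qed
  have inc: "incseq (\<lambda>k. Z \<inter> level k)" using level_mono by (auto simp: incseq_def)
  have U: "(\<Union>k. Z \<inter> level k) = Z"
    using level_UN sets.sets_into_space[OF Suc.prems(2)] by blast
  have SUP: "(SUP k. emeasure (visit_law P I t) (Z \<inter> level k)) = emeasure (visit_law P I t) Z" for P I
    using SUP_emeasure_incseq[OF _ inc, of "visit_law P I t"] Suc.prems(2) level_sets unfolding U by auto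
  have "(SUP k. emeasure (visit_law P\<^sub>\<phi> {..<Suc N} t) (Z \<inter> level k)) \<le> (SUP k. emeasure (visit_law P\<^sub>\<pi> UNIV t) (Z \<inter> level k))"
    using le by (rule SUP_mono')
  then show ?case unfolding SUP .
qed

lemma visit_law_le:
  assumes t: "0 < t" and Z: "Z \<in> sets X"
  shows "emeasure (visit_law P\<^sub>\<phi> UNIV t) Z \<le> emeasure (visit_law P\<^sub>\<pi> UNIV t) Z"
proof -
  note sp = space_process_law[OF P\<^sub>\<phi>]
  define F where "F n \<omega> = (if sojourn n \<omega> t then indicator Z (nth_state X n \<omega>) else 0 :: ennreal)" for n \<omega>
  have F: "F n \<in> borel_measurable P\<^sub>\<phi>" for n
  proof -
    have "F n \<in> borel_measurable (trajectories X)" unfolding F_def sojourn_def using Z by (simp del: jump_time.simps)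
    then show ?thesis using sp(1) by (simp cong: measurable_cong_sets)
  qed
  have em: "emeasure (visit_law P\<^sub>\<phi> I t) Z = (\<integral>\<^sup>+\<omega>. (\<Sum>n. if n \<in> I then F n \<omega> else 0) \<partial>P\<^sub>\<phi>)" for I
  proof -
    have "(if n \<in> I \<and> sojourn n \<omega> t then indicator Z (nth_state X n \<omega>) else 0) = (if n \<in> I then F n \<omega> else 0)" for n \<omega>
      by (simp add: F_def)
    then show ?thesis
      using nn_integral_visit_law[OF P\<^sub>\<phi>, of "indicator Z" I t] Z by simp
  qed
  have "emeasure (visit_law P\<^sub>\<phi> UNIV t) Z = (\<integral>\<^sup>+\<omega>. (\<Sum>n. F n \<omega>) \<partial>P\<^sub>\<phi>)"
    using em[of UNIV] by simp
  also have "\<dots> = (\<Sum>n. \<integral>\<^sup>+\<omega>. F n \<omega> \<partial>P\<^sub>\<phi>)" using F by (rule nn_integral_suminf)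
  also have "\<dots> \<le> emeasure (visit_law P\<^sub>\<pi> UNIV t) Z"
  proof (rule suminf_le_const[OF summableI])
    fix N
    have "(\<Sum>n<N. \<integral>\<^sup>+\<omega>. F n \<omega> \<partial>P\<^sub>\<phi>) = (\<integral>\<^sup>+\<omega>. (\<Sum>n<N. F n \<omega>) \<partial>P\<^sub>\<phi>)" using F by (simp add: nn_integral_sum)
    also have "\<dots> = emeasure (visit_law P\<^sub>\<phi> {..<N} t) Z"
    proof -
      have "(\<Sum>n. if n \<in> {..<N} then F n \<omega> else 0) = (\<Sum>n<N. F n \<omega>)" for \<omega>
        by (subst suminf_finite[of "{..<N}"]) auto
      then show ?thesis unfolding em by simp
    qed
    finally show "(\<Sum>n<N. \<integral>\<^sup>+\<omega>. F n \<omega> \<partial>P\<^sub>\<phi>) \<le> emeasure (visit_law P\<^sub>\<pi> UNIV t) Z"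
      using visit_law_le_finite[OF t Z] by simp
  qed
  finally show ?thesis .
qed

end

lemma visit_law_total:
  assumes P: "process_law X Act q \<gamma> \<pi> P"
  shows "emeasure (visit_law P UNIV s) (space X) = emeasure (state_marginal X P s) (Some ` space X)"
proof -
  note sp = space_process_law[OF P]
  have m: "(\<lambda>\<omega>. state \<omega> s) \<in> measurable P (adjoin_point X)"
    using measurable_state_fixed[of s X] sp(1) by (simp cong: measurable_cong_sets)
  have "emeasure (visit_law P UNIV s) (space X) = (\<integral>\<^sup>+z. 1 \<partial>visit_law P UNIV s)" by simp
  also have "\<dots> = (\<integral>\<^sup>+\<omega>. (case state \<omega> s of None \<Rightarrow> 0 | Some z \<Rightarrow> 1) \<partial>P)"
    by (rule nn_integral_visit_law_UNIV[OF P]) simp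
  also have "\<dots> = (\<integral>\<^sup>+\<omega>. indicator (Some ` space X) (state \<omega> s) \<partial>P)"
    using state_in_space[where X=X and s=s] sp(2) by (intro nn_integral_cong) (auto split: option.split)
  also have "\<dots> = (\<integral>\<^sup>+z. indicator (Some ` space X) z \<partial>state_marginal X P s)"
    unfolding state_marginal_def by (rule nn_integral_distr[symmetric, OF m])
      (simp add: borel_measurable_indicator Some_image_in_sets_adjoin_point)
  also have "\<dots> = emeasure (state_marginal X P s) (Some ` space X)"
    by (rule nn_integral_indicator) (simp add: state_marginal_def Some_image_in_sets_adjoin_point)
  finally show ?thesis .
qed

lemma visit_law_le_1:
  assumes P: "process_law X Act q \<gamma> \<pi> P"
  shows "emeasure (visit_law P UNIV s) (space X) \<le> 1"
proof -
  interpret prob_space P by (rule space_process_law(3)[OF P])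
  have "(\<lambda>\<omega>. state \<omega> s) \<in> measurable P (adjoin_point X)"
    using measurable_state_fixed[of s X] space_process_law(1)[OF P] by (simp cong: measurable_cong_sets)
  then interpret M: prob_space "state_marginal X P s"
    unfolding state_marginal_def by (rule prob_space_distr)
  show ?thesis unfolding visit_law_total[OF P] by (rule M.emeasure_le_1)
qed

lemma visit_law_total_antimono:
  assumes P: "process_law X Act q \<gamma> \<pi> P" and s: "0 < s" "s \<le> t"
  shows "emeasure (visit_law P UNIV t) (space X) \<le> emeasure (visit_law P UNIV s) (space X)"
proof -
  have "emeasure (visit_law P UNIV r) (space X) = (\<integral>\<^sup>+\<omega>. (case state \<omega> r of None \<Rightarrow> 0 | Some z \<Rightarrow> 1) \<partial>P)" for r
    using nn_integral_visit_law_UNIV[OF P, of "\<lambda>_. 1" r] by simp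
  moreover have "(case state \<omega> t of None \<Rightarrow> 0 :: ennreal | Some z \<Rightarrow> 1) \<le> (case state \<omega> s of None \<Rightarrow> 0 | Some z \<Rightarrow> 1)"
    if "\<omega> \<in> space P" for \<omega>
  proof -
    have \<omega>: "\<omega> \<in> space (trajectories X)" using that space_process_law(2)[OF P] by simp
    have "state \<omega> t = None" if "state \<omega> s = None"
      using that state_None_iff[OF \<omega>, of s] state_None_iff[OF \<omega>, of t] s order_trans[of "explosion_time \<omega>" "ereal s" "ereal t"] by simp
    then show ?thesis by (auto split: option.split)
  qed
  ultimately show ?thesis by (simp add: nn_integral_mono)
qed

section \<open>Costs\<close>

text \<open>The mean cost in state \<open>z\<close> at time \<open>s\<close> over the actions chosen by the Markov kernel.\<close>

definition mean_cost :: "('x option \<times> 'a option \<Rightarrow> ennreal) \<Rightarrow> real \<Rightarrow> 'x \<Rightarrow> ennreal" where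
  "mean_cost c s z = (\<integral>\<^sup>+a. c (Some z, Some a) * indicator (Act z) a \<partial>\<phi>' (z, s))"

lemma measurable_cost:
  assumes "cost_function X A c"
  shows "(\<lambda>p. c (Some (fst p), Some (snd p)) * indicator (Act (fst p)) (snd p)) \<in> borel_measurable (X \<Otimes>\<^sub>M A)"
proof -
  have c: "c \<in> borel_measurable (adjoin_point X \<Otimes>\<^sub>M adjoin_point A)"
    using assms by (simp add: cost_function_def)
  have "(\<lambda>p. c (Some (fst p), Some (snd p))) \<in> borel_measurable (X \<Otimes>\<^sub>M A)"
    by (rule measurable_compose[OF _ c]) measurable
  then have "(\<lambda>p. c (Some (fst p), Some (snd p)) * indicator (action_graph X Act) p) \<in> borel_measurable (X \<Otimes>\<^sub>M A)"
    using graph_measurable by measurable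
  then show ?thesis
    by (rule measurable_cong[THEN iffD1, rotated]) (auto simp: space_pair_measure action_graph_def indicator_def)
qed

lemma measurable_mean_cost:
  assumes c: "cost_function X A c" and s: "0 < s"
  shows "mean_cost c s \<in> borel_measurable X"
  unfolding mean_cost_def
proof (rule nn_integral_measurable_subprob_algebra2)
  show "(\<lambda>(z, a). c (Some z, Some a) * indicator (Act z) a) \<in> borel_measurable (X \<Otimes>\<^sub>M A)"
    using measurable_cost[OF c] by (simp add: case_prod_beta')
  show "(\<lambda>z. \<phi>' (z, s)) \<in> measurable X (subprob_algebra A)"
    using s by (intro measurable_compose[OF measurable_Pair2' measurable_markov_kernel]) simp
qed

text \<open>The cost rate along a trajectory.\<close>

definition path_cost :: "('x trajectory \<times> real \<Rightarrow> 'a measure) \<Rightarrow> ('x option \<times> 'a option \<Rightarrow> ennreal) \<Rightarrow>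
    'x trajectory \<times> real \<Rightarrow> ennreal" where
  "path_cost \<kappa> c p = (case state (fst p) (snd p) of None \<Rightarrow> 0 | Some z \<Rightarrow>
     \<integral>\<^sup>+a. c (Some z, Some a) * indicator (Act z) a \<partial>\<kappa> p)"

lemma action_mean_path_cost:
  assumes \<kappa>: "policy_kernel X A \<pi> \<kappa>" and c: "cost_function X A c"
    and \<omega>: "\<omega> \<in> space (trajectories X)" and s: "0 < s"
  shows "action_mean Act c (state \<omega> s) (\<pi> \<omega> s) = path_cost \<kappa> c (\<omega>, s)"
proof (cases "state \<omega> s")
  case None
  have "c (None, a) = 0" for a using c by (simp add: cost_function_def)
  then show ?thesis by (simp add: None action_mean_def path_cost_def)
next
  case (Some z)
  then have "ereal s < explosion_time \<omega>"
    using state_None_iff[OF \<omega>, of s] s by (auto simp: not_le)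
  then have "\<pi> \<omega> s = distr (\<kappa> (\<omega>, s)) (adjoin_point A) Some" by (rule policy_kernelD(2)[OF \<kappa> \<omega> s])
  moreover have "(\<lambda>a. c (Some z, Some a) * indicator (Act z) a) \<in> borel_measurable A"
    using measurable_compose[OF measurable_Pair1'[OF state_in_space[OF \<omega> Some]] measurable_cost[OF c]] by simp
  ultimately show ?thesis
    using action_mean_distr[of c z] sets_policy_kernel[OF \<kappa> \<omega> s] by (simp add: Some path_cost_def)
qed

lemma measurable_path_cost:
  assumes P: "process_law X Act q \<gamma> \<pi> P" and \<kappa>: "policy_kernel X A \<pi> \<kappa>" and c: "cost_function X A c"
  shows "path_cost \<kappa> c \<in> borel_measurable (timed X)"
  unfolding path_cost_def
proof (rule borel_measurable_case_option_adjoin[OF space_process_law(5)[OF P] _ measurable_state_pos_reals])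
  have "(\<lambda>p. \<integral>\<^sup>+a. c (Some (snd p), Some a) * indicator (Act (snd p)) a \<partial>\<kappa> (fst p))
      \<in> borel_measurable ((timed X) \<Otimes>\<^sub>M X)"
  proof (rule nn_integral_measurable_subprob_algebra2)
    have "(\<lambda>p. (snd (fst p), snd p)) \<in> measurable (((timed X) \<Otimes>\<^sub>M X) \<Otimes>\<^sub>M A) (X \<Otimes>\<^sub>M A)"
      by measurable
    from measurable_compose[OF this measurable_cost[OF c]]
    show "(\<lambda>(p, a). c (Some (snd p), Some a) * indicator (Act (snd p)) a)
        \<in> borel_measurable (((timed X) \<Otimes>\<^sub>M X) \<Otimes>\<^sub>M A)"
      by (simp add: case_prod_beta')
    show "(\<lambda>p. \<kappa> (fst p)) \<in> measurable ((timed X) \<Otimes>\<^sub>M X) (subprob_algebra A)"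
      by (rule measurable_compose[OF measurable_fst policy_kernelD(1)[OF \<kappa>]])
  qed
  then show "(\<lambda>(p, z). \<integral>\<^sup>+a. c (Some z, Some a) * indicator (Act z) a \<partial>\<kappa> p)
      \<in> borel_measurable ((timed X) \<Otimes>\<^sub>M X)"
    by (simp add: case_prod_beta')
qed

text \<open>
  In expectation the action distribution may be replaced by the Markov kernel at the current state.
\<close>

lemma nn_integral_path_cost:
  assumes P: "process_law X Act q \<gamma> \<pi> P"
    and marg: "markov_marginals P \<kappa>" and c: "cost_function X A c" and s: "0 < s"
  shows "(\<integral>\<^sup>+\<omega>. path_cost \<kappa> c (\<omega>, s) \<partial>P) = (\<integral>\<^sup>+z. mean_cost c s z \<partial>visit_law P UNIV s)"
  unfolding nn_integral_visit_law_UNIV[OF P measurable_mean_cost[OF c s]]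
  using marg[unfolded markov_marginals_def, rule_format, OF s measurable_cost[OF c]]
  unfolding path_cost_def mean_cost_def fst_conv snd_conv .

lemma total_cost_eq:
  assumes P: "process_law X Act q \<gamma> \<pi> P" and \<kappa>: "policy_kernel X A \<pi> \<kappa>"
    and marg: "markov_marginals P \<kappa>"
    and c: "cost_function X A c" and G: "\<And>i. cost_function X A (G i)" and u: "\<And>i. 0 < u i"
  shows "total_cost Act c G u T \<alpha> P \<pi> =
    (\<integral>\<^sup>+s. (if s \<le> T then ennreal (exp (- \<alpha> * s)) * (\<integral>\<^sup>+z. mean_cost c s z \<partial>visit_law P UNIV s) else 0) \<partial>pos_lborel) +
    (\<Sum>i. ennreal (exp (- \<alpha> * u i)) * (\<integral>\<^sup>+z. mean_cost (G i) (u i) z \<partial>visit_law P UNIV (u i)))"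
proof -
  note sp = space_process_law[OF P]
  note cong = measurable_process_law[OF P]
  define R where "R \<omega> s = (if s \<le> T then ennreal (exp (- \<alpha> * s)) * path_cost \<kappa> c (\<omega>, s) else 0)" for \<omega> s
  have mR: "(\<lambda>(\<omega>, s). R \<omega> s) \<in> borel_measurable (timed X)"
  proof -
    note [measurable] = measurable_path_cost[OF P \<kappa> c]
    have "(\<lambda>p. if snd p \<le> T then ennreal (exp (- \<alpha> * snd p)) * path_cost \<kappa> c p else 0)
        \<in> borel_measurable (timed X)" by measurable
    then show ?thesis by (simp add: R_def case_prod_beta')
  qed
  have mpc: "(\<lambda>\<omega>. path_cost \<kappa> d (\<omega>, s)) \<in> borel_measurable P" if "cost_function X A d" "0 < s" for d s
    unfolding cong using that(2) by (intro measurable_compose[OF measurable_Pair2' measurable_path_cost[OF P \<kappa> that(1)]]) simp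
  have "total_cost Act c G u T \<alpha> P \<pi> = (\<integral>\<^sup>+\<omega>. (\<integral>\<^sup>+s. R \<omega> s \<partial>pos_lborel) +
      (\<Sum>i. ennreal (exp (- \<alpha> * u i)) * path_cost \<kappa> (G i) (\<omega>, u i)) \<partial>P)"
    unfolding total_cost_def
  proof (rule nn_integral_cong_law[OF P])
    fix \<omega> assume \<omega>: "\<omega> \<in> space (trajectories X)"
    have "(\<integral>\<^sup>+s\<in>{s. 0 < s \<and> ereal s \<le> min (ereal T) (explosion_time \<omega>)}.
        ennreal (exp (- \<alpha> * s)) * action_mean Act c (state \<omega> s) (\<pi> \<omega> s) \<partial>lborel) = (\<integral>\<^sup>+s. R \<omega> s \<partial>pos_lborel)"
      unfolding nn_integral_pos_lborel
    proof (rule nn_integral_cong)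
      fix s :: real
      show "ennreal (exp (- \<alpha> * s)) * action_mean Act c (state \<omega> s) (\<pi> \<omega> s) *
          indicator {s. 0 < s \<and> ereal s \<le> min (ereal T) (explosion_time \<omega>)} s = R \<omega> s * indicator {0<..} s"
      proof (cases "0 < s")
        case s: True
        show ?thesis
        proof (cases "ereal s \<le> explosion_time \<omega>")
          case True
          then show ?thesis using s by (simp add: action_mean_path_cost[OF \<kappa> c \<omega> s] R_def indicator_def)
        next
          case False
          then have "state \<omega> s = None" using state_None_iff[OF \<omega>, of s] s by simp
          then show ?thesis using False by (simp add: R_def path_cost_def)
        qed
      qed simp
    qed
    then show "(\<integral>\<^sup>+s\<in>{s. 0 < s \<and> ereal s \<le> min (ereal T) (explosion_time \<omega>)}.
        ennreal (exp (- \<alpha> * s)) * action_mean Act c (state \<omega> s) (\<pi> \<omega> s) \<partial>lborel) +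
      (\<Sum>i. ennreal (exp (- \<alpha> * u i)) * action_mean Act (G i) (state \<omega> (u i)) (\<pi> \<omega> (u i))) =
      (\<integral>\<^sup>+s. R \<omega> s \<partial>pos_lborel) + (\<Sum>i. ennreal (exp (- \<alpha> * u i)) * path_cost \<kappa> (G i) (\<omega>, u i))"
      using action_mean_path_cost[OF \<kappa> G \<omega> u] by simp
  qed
  also have "\<dots> = (\<integral>\<^sup>+\<omega>. \<integral>\<^sup>+s. R \<omega> s \<partial>pos_lborel \<partial>P) +
      (\<integral>\<^sup>+\<omega>. (\<Sum>i. ennreal (exp (- \<alpha> * u i)) * path_cost \<kappa> (G i) (\<omega>, u i)) \<partial>P)"
  proof (rule nn_integral_add)
    interpret L: sigma_finite_measure pos_lborel by (rule sigma_finite_pos_lborel)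
    have "sets (trajectories X \<Otimes>\<^sub>M pos_lborel) = sets (timed X)"
      by (intro sets_pair_measure_cong) auto
    then show "(\<lambda>\<omega>. \<integral>\<^sup>+s. R \<omega> s \<partial>pos_lborel) \<in> borel_measurable P"
      unfolding cong using mR by (intro L.borel_measurable_nn_integral) (simp cong: measurable_cong_sets)
    show "(\<lambda>\<omega>. \<Sum>i. ennreal (exp (- \<alpha> * u i)) * path_cost \<kappa> (G i) (\<omega>, u i)) \<in> borel_measurable P"
      using mpc[OF G u] by measurable
  qed
  also have "(\<integral>\<^sup>+\<omega>. \<integral>\<^sup>+s. R \<omega> s \<partial>pos_lborel \<partial>P) = (\<integral>\<^sup>+s. \<integral>\<^sup>+\<omega>. R \<omega> s \<partial>P \<partial>pos_lborel)"
    by (rule Fubini_trajectories[OF P mR])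
  also have "\<dots> = (\<integral>\<^sup>+s. (if s \<le> T then ennreal (exp (- \<alpha> * s)) * (\<integral>\<^sup>+z. mean_cost c s z \<partial>visit_law P UNIV s) else 0) \<partial>pos_lborel)"
  proof (rule nn_integral_cong)
    fix s assume "s \<in> space pos_lborel"
    then have s: "0 < s" by simp
    show "(\<integral>\<^sup>+\<omega>. R \<omega> s \<partial>P) = (if s \<le> T then ennreal (exp (- \<alpha> * s)) * (\<integral>\<^sup>+z. mean_cost c s z \<partial>visit_law P UNIV s) else 0)"
      unfolding R_def nn_integral_path_cost[OF P marg c s, symmetric] using mpc[OF c s]
      by (simp add: nn_integral_cmult)
  qed
  also have "(\<integral>\<^sup>+\<omega>. (\<Sum>i. ennreal (exp (- \<alpha> * u i)) * path_cost \<kappa> (G i) (\<omega>, u i)) \<partial>P) =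
      (\<Sum>i. ennreal (exp (- \<alpha> * u i)) * (\<integral>\<^sup>+z. mean_cost (G i) (u i) z \<partial>visit_law P UNIV (u i)))"
    using mpc[OF G u] by (simp add: nn_integral_suminf nn_integral_cmult nn_integral_path_cost[OF P marg G u])
  finally show ?thesis .
qed

end

theorem theorem4:
  fixes X :: "'x measure" and A :: "'a measure"
    and Act :: "'x \<Rightarrow> 'a set" and q :: "'x \<Rightarrow> 'a \<Rightarrow> 'x set \<Rightarrow> real"
    and T :: real and u :: "nat \<Rightarrow> real"
    and c :: "'x option \<times> 'a option \<Rightarrow> ennreal"
    and G :: "nat \<Rightarrow> 'x option \<times> 'a option \<Rightarrow> ennreal"
    and \<gamma> :: "'x measure"
    and \<pi> \<phi> :: "'x trajectory \<Rightarrow> real \<Rightarrow> 'a option measure"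
    and \<phi>' :: "'x \<times> real \<Rightarrow> 'a measure"
    and P\<^sub>\<pi> P\<^sub>\<phi> :: "'x trajectory measure"
  assumes "CTJMDP X A Act q"
    and "\<And>x. x \<in> space X \<Longrightarrow> max_jump_rate X Act q x < \<infinity>"
    and "0 < T"
    and "\<And>i. 0 < u i \<and> u i \<le> T"
    and "cost_function X A c"
    and "\<And>i. cost_function X A (G i)"
    and "\<gamma> \<in> space (prob_algebra X)"
    and "policy X A Act \<pi>"
    and "markov_policy X A Act \<phi> \<phi>'"
    and "process_law X Act q \<gamma> \<pi> P\<^sub>\<pi>"
    and "process_law X Act q \<gamma> \<phi> P\<^sub>\<phi>"
    and "\<And>t Z B. 0 < t \<Longrightarrow> Z \<in> sets X \<Longrightarrow> B \<in> sets A \<Longrightarrow>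
           state_action_marginal P\<^sub>\<pi> \<pi> t (Some ` Z) (Some ` B) =
           (\<integral>\<^sup>+z\<in>Some ` Z. emeasure (\<phi>' (the z, t)) B \<partial>state_marginal X P\<^sub>\<pi> t)"
  shows "(\<forall>\<alpha>. total_cost Act c G u T \<alpha> P\<^sub>\<phi> \<phi> \<le> total_cost Act c G u T \<alpha> P\<^sub>\<pi> \<pi>) \<and>
         (emeasure (state_marginal X P\<^sub>\<phi> T) (Some ` space X) = 1 \<longrightarrow>
          (\<forall>\<alpha>. total_cost Act c G u T \<alpha> P\<^sub>\<phi> \<phi> = total_cost Act c G u T \<alpha> P\<^sub>\<pi> \<pi>))"
proof -
  interpret CTJMDP X A Act q by (rule assms(1))
  have mk: "\<phi>' \<in> measurable (X \<Otimes>\<^sub>M pos_reals) (prob_algebra A)"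
    using assms(9) by (simp add: markov_policy_def)
  interpret CTJMDP_kernel X A Act q \<phi>'
    by unfold_locales (rule mk, rule assms(2))
  note P\<^sub>\<pi> = assms(10) and P\<^sub>\<phi> = assms(11) and c = assms(5) and G = assms(6)
  have u: "0 < u i" "u i \<le> T" for i using assms(4) by auto
  obtain \<kappa>\<^sub>\<pi> where \<kappa>\<^sub>\<pi>: "policy_kernel X A \<pi> \<kappa>\<^sub>\<pi>" using policy_kernel_exists[OF assms(8)] .
  obtain \<kappa>\<^sub>\<phi> where \<kappa>\<^sub>\<phi>: "policy_kernel X A \<phi> \<kappa>\<^sub>\<phi>"
    and \<kappa>\<phi>: "\<And>\<omega> s n. \<omega> \<in> space (trajectories X) \<Longrightarrow> 0 < s \<Longrightarrow> pre_sojourn n \<omega> s \<Longrightarrow>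
      \<kappa>\<^sub>\<phi> (\<omega>, s) = \<phi>' (nth_state X n \<omega>, s)"
    using markov_policy_kernel_exists[OF assms(9)] by metis
  have m\<^sub>\<pi>: "markov_marginals P\<^sub>\<pi> \<kappa>\<^sub>\<pi>" by (rule markov_marginalsI[OF P\<^sub>\<pi> \<kappa>\<^sub>\<pi> assms(12)])
  have m\<^sub>\<phi>: "markov_marginals P\<^sub>\<phi> \<kappa>\<^sub>\<phi>" by (rule markov_marginals_markov[OF P\<^sub>\<phi> \<kappa>\<^sub>\<phi> \<kappa>\<phi>])
  have bal: "jump_balance P\<^sub>\<phi> {..<N}" for N by (rule jump_balance_markov[OF P\<^sub>\<phi> \<kappa>\<^sub>\<phi> \<kappa>\<phi>])
  note le = visit_law_le[OF P\<^sub>\<pi> P\<^sub>\<phi> jump_balance_UNIV[OF P\<^sub>\<pi> \<kappa>\<^sub>\<pi> m\<^sub>\<pi>] bal]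
  note cost\<^sub>\<pi> = total_cost_eq[OF P\<^sub>\<pi> \<kappa>\<^sub>\<pi> m\<^sub>\<pi> c G u(1)]
  note cost\<^sub>\<phi> = total_cost_eq[OF P\<^sub>\<phi> \<kappa>\<^sub>\<phi> m\<^sub>\<phi> c G u(1)]
  have int_le: "(\<integral>\<^sup>+z. g z \<partial>visit_law P\<^sub>\<phi> UNIV s) \<le> (\<integral>\<^sup>+z. g z \<partial>visit_law P\<^sub>\<pi> UNIV s)" if "0 < s" for s g
    using le[OF that] by (intro nn_integral_mono_sets) simp_all
  have "total_cost Act c G u T \<alpha> P\<^sub>\<phi> \<phi> \<le> total_cost Act c G u T \<alpha> P\<^sub>\<pi> \<pi>" for \<alpha>
    unfolding cost\<^sub>\<pi> cost\<^sub>\<phi> using u(1)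
    by (intro add_mono nn_integral_mono suminf_le summableI) (auto intro!: mult_left_mono int_le)
  moreover have "total_cost Act c G u T \<alpha> P\<^sub>\<phi> \<phi> = total_cost Act c G u T \<alpha> P\<^sub>\<pi> \<pi>"
    if one: "emeasure (state_marginal X P\<^sub>\<phi> T) (Some ` space X) = 1" for \<alpha>
  proof -
    have eq: "visit_law P\<^sub>\<phi> UNIV s = visit_law P\<^sub>\<pi> UNIV s" if s: "0 < s" "s \<le> T" for s
    proof (rule measure_eqI)
      let ?F = "visit_law P\<^sub>\<phi> UNIV s" and ?P = "visit_law P\<^sub>\<pi> UNIV s"
      \<comment> \<open>The smaller law has full mass, so the complements force equality on every set.\<close>
      have F1: "1 \<le> emeasure ?F (space X)"
        using visit_law_total_antimono[OF P\<^sub>\<phi> s] visit_law_total[OF P\<^sub>\<phi>, of T] one by simp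
      have le1: "emeasure ?F (space X) \<le> 1" "emeasure ?P (space X) \<le> 1"
        using visit_law_le_1[OF P\<^sub>\<phi>] visit_law_le_1[OF P\<^sub>\<pi>] by auto
      fix Z assume "Z \<in> sets ?F"
      then have Z: "Z \<in> sets X" "space X - Z \<in> sets X" by auto
      have compl: "emeasure M Z = emeasure M (space X) - emeasure M (space X - Z)"
        if M: "sets M = sets X" "emeasure M (space X) \<le> 1" for M
      proof -
        have sp: "space M = space X" using M(1) by (rule sets_eq_imp_space_eq)
        have "emeasure M (space X - Z) \<le> 1"
          using emeasure_mono[of "space X - Z" "space X" M] M Z by auto
        then have "emeasure M (space X - Z) \<noteq> \<infinity>" by (auto simp: top_unique)
        then have "emeasure M (space M - (space X - Z)) = emeasure M (space M) - emeasure M (space X - Z)"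
          using Z M(1) by (intro emeasure_compl) auto
        moreover have "space M - (space X - Z) = Z" using sp sets.sets_into_space[OF Z(1)] by auto
        ultimately show ?thesis by (simp add: sp)
      qed
      have "emeasure ?P Z \<le> 1 - emeasure ?P (space X - Z)"
        using compl[OF _ le1(2)] le1(2) by (simp add: ennreal_minus_mono)
      also have "\<dots> \<le> emeasure ?F (space X) - emeasure ?F (space X - Z)"
        using F1 le[OF s(1) Z(2)] by (intro ennreal_minus_mono)
      also have "\<dots> = emeasure ?F Z" using compl[OF _ le1(1)] by simp
      finally show "emeasure ?F Z = emeasure ?P Z" using le[OF s(1) Z(1)] by simp
    qed simp
    show ?thesis
      unfolding cost\<^sub>\<pi> cost\<^sub>\<phi> eq[OF u]
      by (intro arg_cong2[where f="(+)"] nn_integral_cong refl) (simp add: eq)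
  qed
  ultimately show ?thesis by blast
qed

end
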